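(* Let $X=\mathbb R^d$ and let $m$ be a measure on $X\times\mathbb R_+$ such that $m(\{x\}\times\mathbb R_+)=0$ for each $x\in X$ and $\int_{A\times\mathbb R_+}\min\{s,1\}\,dm(x,s)<\infty$ for each $A\in\mathcal B_0(X)$. Let $\mu_m$ be the corresponding completely random measure. For each $\varphi\in\operatorname{Diff}_0(X)$, let $m_\varphi$ be the pushforward of $m$ under the map $X\times\mathbb R_+\ni(x,s)\mapsto(\varphi(x),s)\in X\times\mathbb R_+$. Then $\mu_m$ is quasi-invariant with respect to the action of $\operatorname{Diff}_0(X)$ if and only if, for each $\varphi\in\operatorname{Diff}_0(X)$: (i) $m$ and $m_\varphi$ are equivalent; and (ii) $$\int_{X\times\mathbb R_+}\left(\sqrt{\frac{dm_\varphi}{dm}}-1\right)^2dm<\infty.$$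
   Context: $\mathbb R_+=(0,\infty)$. $\mathcal B_0(X)$ is the collection of Borel subsets of $X$ with compact closure. $\mathbb M(X)$ is the set of Radon measures on $X$ (finite on compact sets) with the vague topology and its Borel $\sigma$-algebra. $\mathbb K(X)\subset\mathbb M(X)$ is the set of discrete Radon measures $\eta=\sum_i s_i\delta_{x_i}$ with $s_i>0$, the $x_i\in X$ distinct and at most countably many (the zero measure included), with the trace $\sigma$-algebra. $\mu_m$ denotes the unique probability measure on $\mathbb K(X)$ with Fourier transform $\int_{\mathbb K(X)}e^{i\int f\,d\eta}\,d\mu_m(\eta)=\exp\left[\int_X\int_{\mathbb R_+}(e^{isf(x)}-1)\,dm(x,s)\right]$ for all continuous compactly supported $f:X\to\mathbb R$. $\operatorname{Diff}_0(X)$ is the group (under composition) of $C^\infty$ diffeomorphisms of $X$ that equal the identity outside a compact set. It acts on $\mathbb K(X)$ by pushforward: $\varphi^*\eta=\sum_i s_i\delta_{\varphi(x_i)}$ for $\eta=\sum_i s_i\delta_{x_i}$. $\mu_m$ is quasi-invariant with respect to $\operatorname{Diff}_0(X)$ if for each $\varphi\in\operatorname{Diff}_0(X)$ the pushforward $\mu_m^\varphi$ of $\mu_m$ under $\eta\mapsto\varphi^*\eta$ is equivalent to $\mu_m$ (mutually absolutely continuous). *)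

theory Defs
  imports "HOL-Probability.Probability"
begin

subsection \<open>Compactly supported diffeomorphisms\<close>

text \<open>\<open>times_differentiable k f\<close> is \<open>C\<^sup>k\<close> regularity on the whole space: recursively, \<open>f\<close> is
  differentiable everywhere and each of its directional derivatives is of class \<open>C\<^sup>k\<^sup>-\<^sup>1\<close>.\<close>

fun times_differentiable ::
    "nat \<Rightarrow> ('a::euclidean_space \<Rightarrow> 'b::euclidean_space) \<Rightarrow> bool" where
  "times_differentiable 0 f \<longleftrightarrow> continuous_on UNIV f"
| "times_differentiable (Suc k) f \<longleftrightarrow>
     (\<forall>x. f differentiable (at x)) \<and>
     (\<forall>v. times_differentiable k (\<lambda>x. frechet_derivative f (at x) v))"

definition smooth :: "('a::euclidean_space \<Rightarrow> 'b::euclidean_space) \<Rightarrow> bool" where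
  "smooth f \<longleftrightarrow> (\<forall>k. times_differentiable k f)"

definition Diff0 :: "('a::euclidean_space \<Rightarrow> 'a) set" where
  "Diff0 = {\<phi>. bij \<phi> \<and> smooth \<phi> \<and> smooth (inv \<phi>) \<and> (\<exists>C. compact C \<and> (\<forall>x. x \<notin> C \<longrightarrow> \<phi> x = x))}"


subsection \<open>Radon measures and discrete Radon measures\<close>

definition radon_measures :: "'a::euclidean_space measure set" where
  "radon_measures = {\<eta>. sets \<eta> = sets borel \<and> (\<forall>C. compact C \<longrightarrow> emeasure \<eta> C < \<infinity>)}"

definition Cc :: "('a::euclidean_space \<Rightarrow> real) set" where
  "Cc = {f. continuous_on UNIV f \<and> compact (closure {x. f x \<noteq> 0})}"

text \<open>The coarsest topology on the Radon measures making \<open>\<eta> \<mapsto> \<integral> f d\<eta>\<close> continuous for all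
  continuous compactly supported \<open>f\<close>, and its Borel \<open>\<sigma>\<close>-algebra.\<close>

definition vague_topology :: "'a::euclidean_space measure topology" where
  "vague_topology = topology_generated_by
     {{\<eta> \<in> radon_measures. (\<integral>x. f x \<partial>\<eta>) \<in> U} | f U. f \<in> Cc \<and> open U}"

lemma topspace_vague_topology: "topspace vague_topology = radon_measures"
proof -
  have "(\<lambda>_. 0) \<in> (Cc :: ('a \<Rightarrow> real) set)"
    by (simp add: Cc_def)
  then have "radon_measures \<in>
      {{\<eta> \<in> radon_measures :: 'a measure set. (\<integral>x. f x \<partial>\<eta>) \<in> U} | f U. f \<in> Cc \<and> open U}"
    by (auto intro!: exI[of _ "\<lambda>_. 0"] exI[of _ UNIV])
  then show ?thesis
    by (auto simp: vague_topology_def)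
qed

definition vague_borel :: "'a::euclidean_space measure measure" where
  "vague_borel = sigma radon_measures {U. openin vague_topology U}"

text \<open>The countable set \<open>S\<close> carries the (distinct) atoms \<open>x\<^sub>i\<close>, and \<open>s x > 0\<close> is the weight of the
  atom \<open>x\<close>, so that the condition on \<open>\<eta>\<close> reads \<open>\<eta> = (\<Sum>x\<in>S. s x \<cdot> \<delta>\<^sub>x)\<close>.\<close>

definition discrete_radon_measures :: "'a::euclidean_space measure set" where
  "discrete_radon_measures = {\<eta> \<in> radon_measures. \<exists>S s. countable S \<and> (\<forall>x\<in>S. (s x :: real) > 0) \<and>
     (\<forall>A\<in>sets borel. emeasure \<eta> A = (\<integral>\<^sup>+x. ennreal (s x) * indicator A x \<partial>count_space S))}"

definition discrete_radon_space :: "'a::euclidean_space measure measure" where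
  "discrete_radon_space = restrict_space vague_borel discrete_radon_measures"

lemma space_discrete_radon_space: "space discrete_radon_space = discrete_radon_measures"
proof -
  have "{U. openin vague_topology U} \<subseteq> Pow (radon_measures :: 'a measure set)"
    using openin_subset topspace_vague_topology by blast
  then have "space (vague_borel :: 'a measure measure) = radon_measures"
    by (simp add: vague_borel_def space_measure_of)
  then show ?thesis
    by (auto simp: discrete_radon_space_def space_restrict_space discrete_radon_measures_def)
qed


subsection \<open>Completely random measures\<close>

definition half_space :: "('a::euclidean_space \<times> real) measure" where
  "half_space = borel \<Otimes>\<^sub>M restrict_space borel {0<..}"

text \<open>\<open>\<mu>\<close> is a completely random measure with intensity \<open>m\<close>: a probability measure on the discrete
  Radon measures with the prescribed Fourier transform. It is characterised, not constructed, here.\<close>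

definition completely_random_measure ::
    "('a::euclidean_space \<times> real) measure \<Rightarrow> 'a measure measure \<Rightarrow> bool" where
  "completely_random_measure m \<mu> \<longleftrightarrow>
     prob_space \<mu> \<and> sets \<mu> = sets discrete_radon_space \<and>
     (\<forall>f\<in>Cc. (\<integral>\<eta>. exp (\<i> * complex_of_real (\<integral>x. f x \<partial>\<eta>)) \<partial>\<mu>) =
        exp (\<integral>z. (exp (\<i> * complex_of_real (snd z * f (fst z))) - 1) \<partial>m))"


subsection \<open>Quasi-invariance\<close>

definition equivalent_measures :: "'a measure \<Rightarrow> 'a measure \<Rightarrow> bool" where
  "equivalent_measures M N \<longleftrightarrow>
     sets M = sets N \<and> absolutely_continuous M N \<and> absolutely_continuous N M"

definition push :: "('a::euclidean_space \<Rightarrow> 'a) \<Rightarrow> 'a measure \<Rightarrow> 'a measure" where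
  "push \<phi> \<eta> = distr \<eta> borel \<phi>"

text \<open>On discrete measures this is \<open>(\<Sum>x\<in>S. s x \<cdot> \<delta>\<^sub>x) \<mapsto> (\<Sum>x\<in>S. s x \<cdot> \<delta>\<^bsub>\<phi> x\<^esub>)\<close>:\<close>

lemma emeasure_push_discrete:
  assumes "sets \<eta> = sets borel" "\<phi> \<in> borel_measurable borel" "A \<in> sets borel"
    and "\<And>A. A \<in> sets borel \<Longrightarrow>
      emeasure \<eta> A = (\<integral>\<^sup>+x. ennreal (s x) * indicator A x \<partial>count_space S)"
  shows "emeasure (push \<phi> \<eta>) A = (\<integral>\<^sup>+x. ennreal (s x) * indicator A (\<phi> x) \<partial>count_space S)"
proof -
  have [measurable]: "\<phi> \<in> measurable \<eta> borel"
    using assms(1,2) measurable_cong_sets by blast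
  have sp: "space \<eta> = UNIV"
    using sets_eq_imp_space_eq[OF assms(1)] by simp
  have "\<phi> -` A \<in> sets borel"
    using measurable_sets[OF assms(2,3)] by simp
  then show ?thesis
    using assms(3,4) by (simp add: push_def emeasure_distr sp indicator_def)
qed

definition quasi_invariant :: "'a::euclidean_space measure measure \<Rightarrow> bool" where
  "quasi_invariant \<mu> \<longleftrightarrow> (\<forall>\<phi>\<in>Diff0. equivalent_measures (distr \<mu> \<mu> (push \<phi>)) \<mu>)"

definition push_fst ::
    "('a::euclidean_space \<Rightarrow> 'a) \<Rightarrow> ('a \<times> real) measure \<Rightarrow> ('a \<times> real) measure" where
  "push_fst \<phi> m = distr m m (\<lambda>(x, s). (\<phi> x, s))"

end

theory Submission
  imports Defs "HOL-Complex_Analysis.Conformal_Mappings"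
begin

text \<open>Why the theorem holds. Under a completely random measure with intensity \<open>m\<close> the pairs (location, mass) of the atoms form a
Poisson process on \<open>X \<times> (0, \<infinity>)\<close>, and a diffeomorphism moves this process to the Poisson process with intensity \<open>m\<^sub>\<phi>\<close>.
Two Poisson processes are equivalent if and only if their intensities are equivalent and have finite Hellinger
distance; this is the analogue of Kakutani's dichotomy for infinite products. The condition on the fibres ensures that distinct
points of the process have distinct locations, so that the process can be recovered from the random measure.

The Poisson process itself is never constructed. The law is given only by its Fourier transform, and everything
is extracted from it by the following chain. Analytic continuation (\<open>laplace_of_fourier\<close>) turns the Fourier transform into
the Laplace functional \<open>E exp (- \<integral>g d\<eta>) = exp (- \<integral>(1 - exp (- s g x)) dm)\<close> for test functions \<open>g \<ge> 0\<close>. Its derivative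
in \<open>g\<close> is a special case of the Mecke formula, which says that summing over the atoms amounts to inserting one further atom
with law \<open>m\<close>. The Mecke formula is linear in the integrand, so it extends from exponentials to all measurable functions
(\<open>mecke\<close>), and after removal of the bias by the mass it reads
\<open>E (\<Sum>x. k (x, \<eta> {x}) G \<eta>) = \<integral>E (k z G (\<eta> + s \<delta>\<^sub>x)) dm z\<close> for \<open>z = (x, s)\<close> (\<open>mecke_atoms\<close>). Sorting configurations by
their number of atoms in a set \<open>B\<close> of finite intensity yields the exponential formula
\<open>E (\<Prod> w) = exp (\<integral>(w - 1) dm)\<close>, where the product of \<open>w\<close> is over the atoms with mark in \<open>B\<close> and the integral is over \<open>B\<close>, together with its
version damped by \<open>exp (- \<integral>f d\<eta>)\<close> (\<open>exponential_formula\<close>).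

Let \<open>P\<close>, \<open>P'\<close> be the laws for \<open>m\<close> and \<open>m' = \<rho> m\<close>. If \<open>P'\<close> has a density \<open>D\<close> then the affinity \<open>\<integral>sqrt D dP\<close> is positive, while
the Cauchy-Schwarz inequality and the exponential formula for \<open>sqrt \<rho>\<close> and its inverse bound its square by the exponential of minus the
Hellinger integral (\<open>hellinger_necessary\<close>). Conversely, if the Hellinger integral is finite, the products of \<open>\<rho>\<close> over the atoms
in an exhausting sequence of sets, suitably normalised, converge in mean to a density of \<open>P'\<close>, because their mutual affinities are again given
by the exponential formula (\<open>hellinger_sufficient\<close>). Null sets of intensities are recognised from the expected number of atoms
(\<open>crm_intensity_absolutely_continuous\<close>). Since the inverse of a diffeomorphism is again admissible, absolute continuity in
one direction for all diffeomorphisms already gives equivalence.\<close>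

section \<open>Test functions\<close>

definition Cc_nonneg :: "('a::euclidean_space \<Rightarrow> real) set" where
  "Cc_nonneg = {f \<in> Cc. \<forall>x. 0 \<le> f x}"

lemma Cc_iff: "f \<in> Cc \<longleftrightarrow> continuous_on UNIV f \<and> bounded {x. f x \<noteq> 0}"
  by (simp add: Cc_def)

lemma Cc_nonnegD: "f \<in> Cc_nonneg \<Longrightarrow> f \<in> Cc" "f \<in> Cc_nonneg \<Longrightarrow> 0 \<le> f x"
  by (auto simp: Cc_nonneg_def)

lemma Cc_nonneg_zero: "(\<lambda>_. 0) \<in> Cc_nonneg"
  by (auto simp: Cc_iff Cc_nonneg_def)

lemma Cc_add: "f \<in> Cc \<Longrightarrow> g \<in> Cc \<Longrightarrow> (\<lambda>x. f x + g x) \<in> Cc"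
  unfolding Cc_iff
  by (auto intro!: continuous_intros intro: bounded_subset[of "{x. f x \<noteq> 0} \<union> {x. g x \<noteq> 0}"])

lemma Cc_mult: "f \<in> Cc \<Longrightarrow> continuous_on UNIV g \<Longrightarrow> (\<lambda>x. g x * f x) \<in> Cc"
  unfolding Cc_iff
  by (auto intro!: continuous_intros intro: bounded_subset[of "{x. f x \<noteq> 0}"])

lemma Cc_cmult: "f \<in> Cc \<Longrightarrow> (\<lambda>x. c * f x) \<in> Cc"
  by (rule Cc_mult) auto

lemma Cc_nonneg_add: "f \<in> Cc_nonneg \<Longrightarrow> g \<in> Cc_nonneg \<Longrightarrow> (\<lambda>x. f x + g x) \<in> Cc_nonneg"
  by (simp add: Cc_nonneg_def Cc_add)

lemma Cc_nonneg_cmult: "f \<in> Cc_nonneg \<Longrightarrow> 0 \<le> c \<Longrightarrow> (\<lambda>x. c * f x) \<in> Cc_nonneg"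
  by (simp add: Cc_nonneg_def Cc_cmult)

lemma Cc_nonneg_max: "f \<in> Cc_nonneg \<Longrightarrow> g \<in> Cc_nonneg \<Longrightarrow> (\<lambda>x. max (f x) (g x)) \<in> Cc_nonneg"
  unfolding Cc_iff Cc_nonneg_def
  by (auto intro!: continuous_on_max intro: bounded_subset[of "{x. f x \<noteq> 0} \<union> {x. g x \<noteq> 0}"]
      simp: le_max_iff_disj)

lemma Cc_pos_part: assumes "f \<in> Cc" shows "(\<lambda>x. max 0 (f x)) \<in> Cc_nonneg"
  using assms unfolding Cc_iff Cc_nonneg_def
  by (auto intro!: continuous_intros intro: bounded_subset[of "{x. f x \<noteq> 0}"])

lemma Cc_borel_measurable: "f \<in> Cc \<Longrightarrow> f \<in> borel_measurable borel"
  by (simp add: Cc_iff borel_measurable_continuous_onI)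

lemma Cc_support: assumes "f \<in> Cc" obtains R where "R > 0" "\<And>x. f x \<noteq> 0 \<Longrightarrow> norm x < R"
proof -
  obtain b where "b > 0" "\<forall>x\<in>{x. f x \<noteq> 0}. norm x \<le> b"
    using assms unfolding Cc_iff bounded_pos by auto
  then show ?thesis using that[of "b+1"] by force
qed

lemma Cc_bounded: assumes "f \<in> Cc" obtains B where "B > 0" "\<And>x. \<bar>f x\<bar> \<le> B"
proof -
  have "compact (f ` closure {x. f x \<noteq> 0})"
    using assms unfolding Cc_def by (auto intro!: compact_continuous_image intro: continuous_on_subset)
  then obtain b where b: "b > 0" "\<forall>y\<in>f ` closure {x. f x \<noteq> 0}. norm y \<le> b"
    using compact_imp_bounded bounded_pos by metis
  have "\<bar>f x\<bar> \<le> b" for x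
    using b closure_subset[of "{x. f x \<noteq> 0}"] by (cases "f x = 0") auto
  with b(1) show ?thesis by (rule that)
qed

lemma radon_measuresD:
  assumes "\<eta> \<in> radon_measures"
  shows "sets \<eta> = sets borel" "space \<eta> = UNIV" "bounded A \<Longrightarrow> emeasure \<eta> A < \<infinity>"
proof -
  show s: "sets \<eta> = sets borel" using assms by (simp add: radon_measures_def)
  then show sp: "space \<eta> = UNIV" using sets_eq_imp_space_eq by fastforce
  assume "bounded A"
  then have c: "compact (closure A)" by simp
  have "emeasure \<eta> A \<le> emeasure \<eta> (closure A)"
    by (rule emeasure_mono) (auto simp: s closure_subset)
  also have "\<dots> < \<infinity>" using c assms by (simp add: radon_measures_def)
  finally show "emeasure \<eta> A < \<infinity>" .
qed

lemma Cc_integrable: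
  assumes "\<eta> \<in> radon_measures" "f \<in> Cc"
  shows "integrable \<eta> f"
proof -
  obtain B where B: "B > 0" "\<And>x. \<bar>f x\<bar> \<le> B" using Cc_bounded[OF assms(2)] by metis
  obtain R where R: "R > 0" "\<And>x. f x \<noteq> 0 \<Longrightarrow> norm x < R" using Cc_support[OF assms(2)] by metis
  note [simp] = radon_measuresD[OF assms(1)]
  have m: "f \<in> borel_measurable \<eta>"
    using Cc_borel_measurable[OF assms(2)] by (simp cong: measurable_cong_sets)
  show ?thesis
  proof (rule Bochner_Integration.integrable_bound[OF _ m])
    show "integrable \<eta> (\<lambda>x. B * indicator (cball 0 R) x)"
      using radon_measuresD(3)[OF assms(1), of "cball 0 R"] by (simp add: integrable_real_mult_indicator integrable_indicator_iff less_top)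
    show "AE x in \<eta>. norm (f x) \<le> norm (B * indicator (cball 0 R) x)"
      using B R by (intro AE_I2) (force simp: indicator_def)
  qed
qed

lemma Cc_nonneg_nn_integral:
  assumes "\<eta> \<in> radon_measures" "f \<in> Cc_nonneg"
  shows "(\<integral>\<^sup>+x. ennreal (f x) \<partial>\<eta>) = ennreal (\<integral>x. f x \<partial>\<eta>)"
  using assms by (intro nn_integral_eq_integral Cc_integrable) (auto simp: Cc_nonneg_def)

lemma Cc_nonneg_integral_nonneg: "f \<in> Cc_nonneg \<Longrightarrow> 0 \<le> (\<integral>x. f x \<partial>\<eta>)"
  by (intro Bochner_Integration.integral_nonneg) (auto simp: Cc_nonneg_def)

section \<open>A countable dense family of test functions\<close>

definition tent :: "'a::euclidean_space \<times> real \<times> real \<Rightarrow> 'a \<Rightarrow> real" where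
  "tent = (\<lambda>(c, r, q) x. max 0 (r - q * dist x c))"

lemma tent_Cc_nonneg: assumes "q > 0" shows "tent (c, r, q) \<in> Cc_nonneg"
proof -
  have "tent (c,r,q) x \<noteq> 0 \<Longrightarrow> x \<in> cball c (r / q)" for x
    using assms by (auto simp: tent_def dist_commute field_simps split: if_splits)
  then have "bounded {x. tent (c,r,q) x \<noteq> 0}"
    by (intro bounded_subset[OF bounded_cball[of c "r/q"]]) auto
  then show ?thesis
    by (auto simp: Cc_nonneg_def Cc_iff tent_def intro!: continuous_intros)
qed

definition cutoff :: "nat \<Rightarrow> 'a::euclidean_space \<Rightarrow> real" where
  "cutoff n x = max 0 (real n - norm x)"

lemma cutoff_Cc_nonneg: "cutoff n \<in> Cc_nonneg"
  using tent_Cc_nonneg[of 1 0 "real n"] by (simp add: tent_def cutoff_def[abs_def])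

definition tent_max :: "('a::euclidean_space \<times> real \<times> real) list \<Rightarrow> 'a \<Rightarrow> real" where
  "tent_max ps = foldr (\<lambda>p g x. max (tent p x) (g x)) ps (\<lambda>_. 0)"

lemma tent_max_Cc_nonneg: "(\<And>c r q. (c,r,q) \<in> set ps \<Longrightarrow> q > 0) \<Longrightarrow> tent_max ps \<in> Cc_nonneg"
  by (induction ps) (auto simp: tent_max_def Cc_nonneg_zero intro!: Cc_nonneg_max tent_Cc_nonneg)

lemma tent_max_upper: "(\<And>p. p \<in> set ps \<Longrightarrow> tent p x \<le> b) \<Longrightarrow> 0 \<le> b \<Longrightarrow> tent_max ps x \<le> b"
  by (induction ps) (auto simp: tent_max_def)

lemma tent_max_lower: "p \<in> set ps \<Longrightarrow> tent p x \<le> tent_max ps x"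
  by (induction ps) (auto simp: tent_max_def)

text \<open>Near \<open>x\<close> the function \<open>f\<close> stays above \<open>f x - e/2\<close>. A tent that is lower than this and whose base lies in that
neighbourhood is therefore below \<open>f\<close> everywhere. All conditions on centre, height and slope are open, so the
parameters can be taken from a countable set.\<close>

lemma tent_below:
  fixes f :: "'a::euclidean_space \<Rightarrow> real"
  assumes f: "f \<in> Cc_nonneg" and e: "e > 0" 
    and D: "\<And>X. open X \<Longrightarrow> X \<noteq> {} \<Longrightarrow> \<exists>d\<in>D. d \<in> X"
  shows "\<exists>p\<in>D \<times> \<rat> \<times> (\<rat> \<inter> {0<..}). (\<forall>y. tent p y \<le> f y) \<and> f x - e < tent p x"
proof (cases "f x < e")
  case True
  obtain d where "d \<in> D" using D[of UNIV] by auto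
  then have "(d,0,1::real) \<in> D \<times> (\<rat> :: real set) \<times> (\<rat> \<inter> {0<..})" by simp
  moreover have "tent (d,0,1) = (\<lambda>_. 0)" by (auto simp: tent_def)
  ultimately show ?thesis
    using True Cc_nonnegD(2)[OF f] by (intro bexI[of _ "(d,0,1)"]) auto
next
  case False
  have "isCont f x" using f by (auto simp: Cc_nonneg_def Cc_iff continuous_on_eq_continuous_at)
  then obtain \<delta> where \<delta>: "\<delta> > 0" "\<And>y. dist y x < \<delta> \<Longrightarrow> \<bar>f y - f x\<bar> < e/2"
    using e unfolding continuous_at_eps_delta dist_real_def by (metis half_gt_zero)
  obtain r where r: "r \<in> \<rat>" "f x - 3*e/4 < r" "r < f x - e/2"
    using Rats_dense_in_real[of "f x - 3*e/4" "f x - e/2"] e by auto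
  have r0: "r > 0" using r False e by auto
  obtain q where q: "q \<in> \<rat>" "q > 2 * r / \<delta>" using Rats_dense_in_real[of "2*r/\<delta>" "2*r/\<delta>+1"] by auto
  have q0: "q > 0" using q(2) r0 \<delta>(1) by (meson divide_pos_pos less_trans mult_pos_pos zero_less_numeral)
  have rq: "r / q < \<delta> / 2" using q q0 \<delta>(1) by (auto simp: field_simps)
  have "min (\<delta>/2) (e/(8*q)) > 0" using \<delta>(1) e q0 by simp
  then obtain c where c: "c \<in> D" "c \<in> ball x (min (\<delta>/2) (e/(8*q)))"
    using D[OF open_ball, of x "min (\<delta>/2) (e/(8*q))"] by (metis centre_in_ball empty_iff)
  have cx: "dist x c < \<delta>/2" "dist x c < e/(8*q)" using c(2) by auto
  have "tent (c,r,q) y \<le> f y" for y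
  proof (cases "r - q * dist y c \<le> 0")
    case True then show ?thesis using Cc_nonnegD(2)[OF f] by (auto simp: tent_def)
  next
    case F: False
    have "dist y c < r / q" using F q0 by (auto simp: field_simps)
    then have "dist y x < \<delta>" using rq cx(1) dist_triangle[of y x c] unfolding dist_commute[of c x] by linarith
    from \<delta>(2)[OF this] have "f y > r" using r(3) by linarith
    then show ?thesis using F q0 zero_le_dist[of y c] by (auto simp: tent_def max_def intro: order_trans[of _ r])
  qed
  moreover have "q * dist x c < e/8" using cx(2) q0 by (auto simp: field_simps)
  then have "f x - e < tent (c,r,q) x" using r e by (auto simp: tent_def max_def)
  ultimately show ?thesis using c(1) r(1) q(1) q0 by (intro bexI[of _ "(c,r,q)"]) auto
qed

text \<open>By compactness, finitely many tents below \<open>f\<close> come within \<open>e\<close> of \<open>f\<close> on its support; off the support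
their maximum vanishes, because it lies between \<open>0\<close> and \<open>f\<close>.\<close>

lemma Cc_nonneg_separable:
  obtains G :: "('a::euclidean_space \<Rightarrow> real) set" where "countable G" "G \<subseteq> Cc_nonneg"
    "\<And>f e. f \<in> Cc_nonneg \<Longrightarrow> e > 0 \<Longrightarrow> \<exists>g\<in>G. \<forall>x. g x \<le> f x \<and> f x \<le> g x + e"
proof -
  obtain D :: "'a set" where D: "countable D" "\<And>X. open X \<Longrightarrow> X \<noteq> {} \<Longrightarrow> \<exists>d\<in>D. d \<in> X"
    using countable_dense_exists by blast
  let ?I = "D \<times> \<rat> \<times> (\<rat> \<inter> {0<..}) :: ('a \<times> real \<times> real) set"
  have cI: "countable ?I" using D(1) countable_rat by auto
  show ?thesis
  proof (rule that[of "tent_max ` lists ?I"])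
    show "countable (tent_max ` lists ?I)" using cI by auto
    show "tent_max ` lists ?I \<subseteq> Cc_nonneg"
      by (auto intro!: tent_max_Cc_nonneg)
    fix f :: "'a \<Rightarrow> real" and e :: real assume f: "f \<in> Cc_nonneg" and e: "e > 0"
    have "\<forall>x. \<exists>p\<in>?I. (\<forall>y. tent p y \<le> f y) \<and> f x - e < tent p x"
      using tent_below[OF f e D(2)] by blast
    then obtain p where p: "\<And>x. p x \<in> ?I" "\<And>x y. tent (p x) y \<le> f y" "\<And>x. f x - e < tent (p x) x"
      by metis
    let ?K = "closure {x. f x \<noteq> 0}"
    have K: "compact ?K" and cf: "continuous_on UNIV f" using f by (auto simp: Cc_nonneg_def Cc_def)
    have ct: "continuous_on UNIV (tent (p x))" for x
      using tent_Cc_nonneg p(1)[of x] by (cases "p x") (auto simp: Cc_nonneg_def Cc_def)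
    define W where "W x = {y. f y - e < tent (p x) y}" for x
    have "open (W x)" for x
      unfolding W_def by (intro open_Collect_less continuous_intros cf ct)
    moreover have "?K \<subseteq> \<Union>(range W)" using p(3) by (auto simp: W_def)
    ultimately obtain N where N: "finite N" "?K \<subseteq> (\<Union>x\<in>N. W x)"
      using compactE_image[OF K, of UNIV W] by auto
    obtain xs where xs: "set xs = N" using finite_list[OF N(1)] by auto
    show "\<exists>g\<in>tent_max ` lists ?I. \<forall>x. g x \<le> f x \<and> f x \<le> g x + e"
    proof (intro bexI[of _ "tent_max (map p xs)"] allI conjI)
      show "tent_max (map p xs) \<in> tent_max ` lists ?I" using p(1) by (intro imageI) (auto simp: in_lists_conv_set simp del: mem_Sigma_iff)
      fix y
      show "tent_max (map p xs) y \<le> f y"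
        using p(2) Cc_nonnegD(2)[OF f] by (intro tent_max_upper) auto
      show "f y \<le> tent_max (map p xs) y + e"
      proof (cases "f y = 0")
        case True
        have "tent_max (map p xs) \<in> Cc_nonneg"
          using p(1) by (intro tent_max_Cc_nonneg) (auto, metis IntD2 greaterThan_iff mem_Sigma_iff)
        then show ?thesis using True e Cc_nonnegD(2)[of "tent_max (map p xs)" y] by auto
      next
        case False
        then have "y \<in> ?K" by (intro subsetD[OF closure_subset]) simp
        then obtain x where "x \<in> N" "y \<in> W x" using N by auto
        then show ?thesis using tent_max_lower[of "p x" "map p xs" y] xs by (auto simp: W_def)
      qed
    qed
  qed
qed

section \<open>The Borel structure of the vague topology\<close>

text \<open>The vague topology is generated by uncountably many functionals, so it is not automatic that its open sets belong to
the \<open>\<sigma>\<close>-algebra generated by those functionals. Countably many of them suffice, however: if \<open>g \<le> f \<le> g + d\<close> then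
\<open>\<integral>f d\<eta>\<close> and \<open>\<integral>g d\<eta>\<close> differ by at most \<open>d\<close> times the integral of a cutoff function, and if the cutoff is one of the
chosen functionals, this error is small on a whole neighbourhood of a given measure. Open sets thus become preimages
of open sets of real sequences.\<close>

lemma vague_open_coordinates:
  obtains \<Phi> :: "nat \<Rightarrow> 'a::euclidean_space \<Rightarrow> real" where
    "\<And>n. \<Phi> n \<in> Cc_nonneg"
    "\<And>U. openin vague_topology U \<Longrightarrow>
       \<exists>V. open V \<and> U = {\<eta> \<in> radon_measures. (\<lambda>n. \<integral>x. \<Phi> n x \<partial>\<eta>) \<in> V}"
proof -
  obtain G :: "('a \<Rightarrow> real) set" where G: "countable G" "G \<subseteq> Cc_nonneg"
    "\<And>f e. f \<in> Cc_nonneg \<Longrightarrow> e > 0 \<Longrightarrow> \<exists>g\<in>G. \<forall>x. g x \<le> f x \<and> f x \<le> g x + e"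
    using Cc_nonneg_separable by blast
  define H where "H = G \<union> range (cutoff :: nat \<Rightarrow> 'a \<Rightarrow> real)"
  have H: "countable H" "H \<noteq> {}" "H \<subseteq> Cc_nonneg" using G cutoff_Cc_nonneg by (auto simp: H_def)
  define \<Phi> where "\<Phi> = from_nat_into H"
  have rng: "range \<Phi> = H" using H by (simp add: \<Phi>_def range_from_nat_into)
  have \<Phi>: "\<Phi> n \<in> Cc_nonneg" for n using rng H(3) by auto
  define E where "E \<eta> n = (\<integral>x. \<Phi> n x \<partial>\<eta>)" for \<eta> n
  have approx: "\<exists>V. open V \<and> E \<eta>0 \<in> V \<and> (\<forall>\<eta>\<in>radon_measures. E \<eta> \<in> V \<longrightarrow> \<bar>(\<integral>x. f x \<partial>\<eta>) - (\<integral>x. f x \<partial>\<eta>0)\<bar> < e)"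
    if f: "f \<in> Cc_nonneg" and e: "e > 0" and \<eta>0: "\<eta>0 \<in> radon_measures" for f e \<eta>0
  proof -
    obtain R where R: "R > 0" "\<And>x. f x \<noteq> 0 \<Longrightarrow> norm x < R" using Cc_support Cc_nonnegD(1)[OF f] by metis
    obtain N where N: "real N > R + 1" using reals_Archimedean2 by blast
    obtain j where j: "\<Phi> j = cutoff N" using rng by (metis H_def UnI2 rangeE rangeI)
    have c1: "f x \<noteq> 0 \<Longrightarrow> cutoff N x \<ge> 1" for x using R(2)[of x] N by (auto simp: cutoff_def max_def)
    define c where "c = E \<eta>0 j + 1"
    have c0: "c > 0" using Cc_nonneg_integral_nonneg[OF \<Phi>[of j], of \<eta>0] by (simp add: c_def E_def)
    \<comment> \<open>On the neighbourhood chosen below the integral of the cutoff is less than \<open>c\<close>, so the error is at most \<open>e / 4\<close>.\<close>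
    define d where "d = e / (4 * c)"
    have d0: "d > 0" using e c0 by (simp add: d_def)
    obtain g where g: "g \<in> G" "\<forall>x. g x \<le> f x \<and> f x \<le> g x + d" using G(3)[OF f d0] by blast
    obtain i where i: "\<Phi> i = g" using rng g(1) by (metis H_def UnI1 rangeE)
    have b: "g x \<le> f x" "f x \<le> g x + d * cutoff N x" for x
    proof -
      show "g x \<le> f x" using g by auto
      show "f x \<le> g x + d * cutoff N x"
      proof (cases "f x = 0")
        case True
        then show ?thesis using Cc_nonnegD(2)[OF \<Phi>[of i], of x] i d0 by (simp add: cutoff_def)
      next
        case False
        then have "d \<le> d * cutoff N x" using c1[of x] d0 by simp
        then show ?thesis using g(2) by (meson add_left_mono order_trans)
      qed
    qed
    have I: "E \<eta> i \<le> (\<integral>x. f x \<partial>\<eta>) \<and> (\<integral>x. f x \<partial>\<eta>) \<le> E \<eta> i + d * E \<eta> j" if \<eta>: "\<eta> \<in> radon_measures" for \<eta>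
    proof -
      note Q = Cc_integrable[OF \<eta>]
      have ig: "integrable \<eta> g" "integrable \<eta> f" "integrable \<eta> (cutoff N)"
        using Q Cc_nonnegD(1) f \<Phi>[of i] i \<Phi>[of j] j by auto
      have "(\<integral>x. g x \<partial>\<eta>) \<le> (\<integral>x. f x \<partial>\<eta>)" using ig b by (intro integral_mono) auto
      moreover have "(\<integral>x. f x \<partial>\<eta>) \<le> (\<integral>x. g x + d * cutoff N x \<partial>\<eta>)" using ig b by (intro integral_mono) auto
      ultimately show ?thesis using ig by (simp add: E_def i j)
    qed
    define V where "V = {y::nat\<Rightarrow>real. \<bar>y i - E \<eta>0 i\<bar> < e/4 \<and> \<bar>y j - E \<eta>0 j\<bar> < 1}"
    have "open V" unfolding V_def
      by (intro open_Collect_conj open_Collect_less continuous_intros continuous_on_product_coordinates)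
    moreover have "E \<eta>0 \<in> V" using e by (simp add: V_def)
    moreover have "\<bar>(\<integral>x. f x \<partial>\<eta>) - (\<integral>x. f x \<partial>\<eta>0)\<bar> < e" if \<eta>: "\<eta> \<in> radon_measures" and v: "E \<eta> \<in> V" for \<eta>
    proof -
      have "E \<eta> j < c" "E \<eta>0 j < c" using v by (auto simp: V_def c_def)
      then have "d * E \<eta> j < d * c" "d * E \<eta>0 j < d * c" using d0 by auto
      moreover have "d * c = e/4" using c0 by (simp add: d_def)
      ultimately have "d * E \<eta> j < e/4" "d * E \<eta>0 j < e/4" by auto
      moreover have "\<bar>E \<eta> i - E \<eta>0 i\<bar> < e/4" using v by (simp add: V_def)
      ultimately show ?thesis using I[OF \<eta>] I[OF \<eta>0] unfolding abs_less_iff by linarith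
    qed
    ultimately show ?thesis by blast
  qed
  have basis: "\<exists>V. open V \<and> {\<eta> \<in> radon_measures. (\<integral>x. f x \<partial>\<eta>) \<in> U} = {\<eta> \<in> radon_measures. E \<eta> \<in> V}"
    if f: "f \<in> Cc" and U: "open U" for f :: "'a \<Rightarrow> real" and U
  proof -
    let ?W = "{\<eta> \<in> radon_measures. (\<integral>x. f x \<partial>\<eta>) \<in> U}"
    have "\<exists>V. open V \<and> E \<eta>0 \<in> V \<and> (\<forall>\<eta>\<in>radon_measures. E \<eta> \<in> V \<longrightarrow> \<eta> \<in> ?W)" if \<eta>0: "\<eta>0 \<in> ?W" for \<eta>0
    proof -
      obtain e where e: "e > 0" "\<And>y. \<bar>y - (\<integral>x. f x \<partial>\<eta>0)\<bar> < e \<Longrightarrow> y \<in> U"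
        using U \<eta>0 unfolding open_dist dist_real_def by auto
      let ?p = "\<lambda>x. max 0 (f x)" and ?m = "\<lambda>x. max 0 (- 1 * f x)"
      have p: "?p \<in> Cc_nonneg" "?m \<in> Cc_nonneg" using f by (intro Cc_pos_part Cc_cmult; simp)+
      have dec: "(\<integral>x. f x \<partial>\<eta>) = (\<integral>x. ?p x \<partial>\<eta>) - (\<integral>x. ?m x \<partial>\<eta>)" if "\<eta> \<in> radon_measures" for \<eta>
      proof -
        have "(\<integral>x. f x \<partial>\<eta>) = (\<integral>x. ?p x - ?m x \<partial>\<eta>)"
          by (intro Bochner_Integration.integral_cong) auto
        also have "\<dots> = (\<integral>x. ?p x \<partial>\<eta>) - (\<integral>x. ?m x \<partial>\<eta>)"
          by (intro Bochner_Integration.integral_diff Cc_integrable that Cc_nonnegD(1) p)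
        finally show ?thesis .
      qed
      obtain V1 where V1: "open V1" "E \<eta>0 \<in> V1" "\<forall>\<eta>\<in>radon_measures. E \<eta> \<in> V1 \<longrightarrow> \<bar>(\<integral>x. ?p x \<partial>\<eta>) - (\<integral>x. ?p x \<partial>\<eta>0)\<bar> < e/2"
        using approx[OF p(1), of "e/2" \<eta>0] e(1) \<eta>0 by auto
      obtain V2 where V2: "open V2" "E \<eta>0 \<in> V2" "\<forall>\<eta>\<in>radon_measures. E \<eta> \<in> V2 \<longrightarrow> \<bar>(\<integral>x. ?m x \<partial>\<eta>) - (\<integral>x. ?m x \<partial>\<eta>0)\<bar> < e/2"
        using approx[OF p(2), of "e/2" \<eta>0] e(1) \<eta>0 by auto
      have "\<eta> \<in> ?W" if \<eta>: "\<eta> \<in> radon_measures" and v: "E \<eta> \<in> V1 \<inter> V2" for \<eta>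
      proof -
        have "\<bar>(\<integral>x. f x \<partial>\<eta>) - (\<integral>x. f x \<partial>\<eta>0)\<bar> < e"
        proof -
          have "\<eta>0 \<in> radon_measures" "E \<eta> \<in> V1" "E \<eta> \<in> V2" using \<eta>0 v by auto
          then show ?thesis
            using dec[OF \<eta>] dec[of \<eta>0] V1(3)[rule_format, OF \<eta>] V2(3)[rule_format, OF \<eta>]
            unfolding abs_less_iff by linarith
        qed
        then show ?thesis using e(2) \<eta> by auto
      qed
      then show ?thesis using V1 V2 by (intro exI[of _ "V1 \<inter> V2"]) auto
    qed
    then have "\<forall>\<eta>0\<in>?W. \<exists>V. open V \<and> E \<eta>0 \<in> V \<and> (\<forall>\<eta>\<in>radon_measures. E \<eta> \<in> V \<longrightarrow> \<eta> \<in> ?W)" by (rule ballI)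
    from bchoice[OF this] obtain V where V: "\<And>\<eta>. \<eta> \<in> ?W \<Longrightarrow> open (V \<eta>) \<and> E \<eta> \<in> V \<eta> \<and> (\<forall>\<eta>'\<in>radon_measures. E \<eta>' \<in> V \<eta> \<longrightarrow> \<eta>' \<in> ?W)"
      by (elim exE) (rule that, drule (1) bspec)
    show ?thesis
    proof (intro exI[of _ "\<Union>\<eta>\<in>?W. V \<eta>"] conjI set_eqI iffI)
      show "open (\<Union>\<eta>\<in>?W. V \<eta>)" using V by (intro open_UN ballI) simp
    next
      fix \<eta> assume \<eta>: "\<eta> \<in> ?W"
      then show "\<eta> \<in> {\<eta> \<in> radon_measures. E \<eta> \<in> (\<Union>\<eta>\<in>?W. V \<eta>)}"
        using V[OF \<eta>] by (intro CollectI conjI UN_I[OF \<eta>]) simp_all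
    next
      fix \<eta> assume "\<eta> \<in> {\<eta> \<in> radon_measures. E \<eta> \<in> (\<Union>\<eta>\<in>?W. V \<eta>)}"
      then obtain \<eta>' where "\<eta> \<in> radon_measures" "\<eta>' \<in> ?W" "E \<eta> \<in> V \<eta>'" by blast
      then show "\<eta> \<in> ?W" using V[of \<eta>'] by blast
    qed
  qed
  show ?thesis
  proof (rule that[of \<Phi>])
    show "\<Phi> n \<in> Cc_nonneg" for n by (rule \<Phi>)
    fix U :: "'a measure set" assume "openin vague_topology U"
    then have "generate_topology_on {{\<eta> \<in> radon_measures. (\<integral>x. f x \<partial>\<eta>) \<in> U} | f U. f \<in> Cc \<and> open U} U"
      by (simp add: vague_topology_def openin_topology_generated_by_iff)
    then have "\<exists>V. open V \<and> U = {\<eta> \<in> radon_measures. E \<eta> \<in> V}"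
    proof induction
      case Empty then show ?case by (intro exI[of _ "{}"]) auto
    next
      case (Int a b)
      then obtain V W where "open V" "a = {\<eta> \<in> radon_measures. E \<eta> \<in> V}" "open W" "b = {\<eta> \<in> radon_measures. E \<eta> \<in> W}" by auto
      then show ?case by (intro exI[of _ "V \<inter> W"]) auto
    next
      case (UN K)
      then obtain V where "\<And>k. k \<in> K \<Longrightarrow> open (V k) \<and> k = {\<eta> \<in> radon_measures. E \<eta> \<in> V k}" by metis
      then show ?case by (intro exI[of _ "\<Union>k\<in>K. V k"]) auto
    next
      case (Basis s)
      then show ?case using basis by auto
    qed
    then show "\<exists>V. open V \<and> U = {\<eta> \<in> radon_measures. (\<lambda>n. \<integral>x. \<Phi> n x \<partial>\<eta>) \<in> V}"
      by (simp add: E_def[abs_def])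
  qed
qed

text \<open>Open sets of sequences are measurable in the product \<open>\<sigma>\<close>-algebra, so a map into the space of discrete Radon measures
can be tested on the functionals alone.\<close>

lemma measurable_discrete_radon_space:
  fixes T :: "'b \<Rightarrow> 'a::euclidean_space measure"
  assumes T: "\<And>\<omega>. \<omega> \<in> space M \<Longrightarrow> T \<omega> \<in> discrete_radon_measures"
    and m: "\<And>f. f \<in> Cc_nonneg \<Longrightarrow> (\<lambda>\<omega>. \<integral>x. f x \<partial>T \<omega>) \<in> borel_measurable M"
  shows "T \<in> measurable M discrete_radon_space"
proof -
  have TR: "T \<in> space M \<rightarrow> radon_measures" using T by (auto simp: discrete_radon_measures_def)
  obtain \<Phi> :: "nat \<Rightarrow> 'a \<Rightarrow> real" where \<Phi>: "\<And>n. \<Phi> n \<in> Cc_nonneg"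
    "\<And>U. openin vague_topology U \<Longrightarrow>
       \<exists>V. open V \<and> U = {\<eta> \<in> radon_measures. (\<lambda>n. \<integral>x. \<Phi> n x \<partial>\<eta>) \<in> V}"
    using vague_open_coordinates by blast
  have m': "(\<lambda>\<omega> n. \<integral>x. \<Phi> n x \<partial>T \<omega>) \<in> borel_measurable M"
    by (intro measurable_coordinatewise_then_product m \<Phi>)
  have "T \<in> measurable M vague_borel"
    unfolding vague_borel_def
  proof (rule measurable_measure_of)
    show "{U. openin vague_topology U} \<subseteq> Pow (radon_measures :: 'a measure set)"
      using openin_subset topspace_vague_topology by blast
    fix U :: "'a measure set" assume "U \<in> {U. openin vague_topology U}"
    then obtain V where V: "open V" "U = {\<eta> \<in> radon_measures. (\<lambda>n. \<integral>x. \<Phi> n x \<partial>\<eta>) \<in> V}" using \<Phi>(2) by auto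
    have "T -` U \<inter> space M = (\<lambda>\<omega> n. \<integral>x. \<Phi> n x \<partial>T \<omega>) -` V \<inter> space M"
      using TR V by auto
    also have "\<dots> \<in> sets M" using m' V(1) by (intro measurable_sets[where A=borel]) auto
    finally show "T -` U \<inter> space M \<in> sets M" .
  qed (rule TR)
  then show ?thesis unfolding discrete_radon_space_def
    using T by (intro measurable_restrict_space2) auto
qed

lemma integral_measurable_discrete:
  fixes f :: "'a::euclidean_space \<Rightarrow> real"
  assumes "f \<in> Cc"
  shows "(\<lambda>\<eta>. \<integral>x. f x \<partial>\<eta>) \<in> borel_measurable discrete_radon_space"
proof -
  have P: "{U. openin vague_topology U} \<subseteq> Pow (radon_measures :: 'a measure set)"
    using openin_subset topspace_vague_topology by blast
  have sp: "space (vague_borel :: 'a measure measure) = radon_measures"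
    using P by (simp add: vague_borel_def space_measure_of)
  have "(\<lambda>\<eta>. \<integral>x. f x \<partial>\<eta>) \<in> borel_measurable vague_borel"
  proof (rule borel_measurableI)
    fix S :: "real set" assume "open S"
    then have "openin vague_topology {\<eta> \<in> radon_measures. (\<integral>x. f x \<partial>\<eta>) \<in> S}"
      unfolding vague_topology_def using assms by (intro topology_generated_by_Basis) auto
    moreover have "(\<lambda>\<eta>. \<integral>x. f x \<partial>\<eta>) -` S \<inter> space vague_borel = {\<eta> \<in> radon_measures. (\<integral>x. f x \<partial>\<eta>) \<in> S}"
      by (auto simp: sp)
    ultimately show "(\<lambda>\<eta>. \<integral>x. f x \<partial>\<eta>) -` S \<inter> space vague_borel \<in> sets vague_borel"
      unfolding vague_borel_def using P by (simp add: sets_measure_of)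
  qed
  then show ?thesis unfolding discrete_radon_space_def by (rule measurable_restrict_space1)
qed

section \<open>Laplace functionals determine random measures\<close>

text \<open>Equality passes from monomials in \<open>X\<close> to polynomials, by Weierstrass to continuous functions on the unit interval,
and by bounded convergence of ramps to the indicator of \<open>X > a\<close>. The weight \<open>R\<close> makes it possible to treat several
functions \<open>X\<close> one after the other.\<close>

lemma equal_moments_imp_equal_tails:
  fixes X R :: "'b \<Rightarrow> real"
  assumes fin: "finite_measure P" "finite_measure Q" and s: "sets Q = sets P"
    and X[measurable]: "X \<in> borel_measurable P" and X01: "\<And>\<omega>. 0 \<le> X \<omega> \<and> X \<omega> \<le> 1"
    and R[measurable]: "R \<in> borel_measurable P" and R1: "\<And>\<omega>. 0 \<le> R \<omega> \<and> R \<omega> \<le> 1"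
    and eq: "\<And>l. (\<integral>\<omega>. R \<omega> * X \<omega> ^ l \<partial>P) = (\<integral>\<omega>. R \<omega> * X \<omega> ^ l \<partial>Q)"
  shows "(\<integral>\<omega>. R \<omega> * (if X \<omega> > a then 1 else 0) \<partial>P) = (\<integral>\<omega>. R \<omega> * (if X \<omega> > a then 1 else 0) \<partial>Q)"
proof -
  interpret P: finite_measure P by fact
  interpret Q: finite_measure Q by fact
  have [measurable]: "X \<in> borel_measurable Q" "R \<in> borel_measurable Q"
    using X R s by (auto cong: measurable_cong_sets)
  have bi: "integrable P (\<lambda>\<omega>. R \<omega> * h (X \<omega>))" "integrable Q (\<lambda>\<omega>. R \<omega> * h (X \<omega>))"
    if [measurable]: "h \<in> borel_measurable borel" and b: "\<And>x. 0 \<le> x \<Longrightarrow> x \<le> 1 \<Longrightarrow> \<bar>h x\<bar> \<le> b" for h b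
  proof -
    have "norm (R \<omega> * h (X \<omega>)) \<le> 1 * b" for \<omega>
      unfolding norm_mult using R1[of \<omega>] b[of "X \<omega>"] X01[of \<omega>] by (intro mult_mono) auto
    then show "integrable P (\<lambda>\<omega>. R \<omega> * h (X \<omega>))" "integrable Q (\<lambda>\<omega>. R \<omega> * h (X \<omega>))"
      by (auto intro!: P.integrable_const_bound[of _ "1*b"] Q.integrable_const_bound[of _ "1*b"])
  qed
  have poly: "(\<integral>\<omega>. R \<omega> * p (X \<omega>) \<partial>P) = (\<integral>\<omega>. R \<omega> * p (X \<omega>) \<partial>Q)" if pp: "real_polynomial_function p" for p
  proof -
    obtain c :: "nat \<Rightarrow> real" and n where p: "p = (\<lambda>x. \<Sum>i\<le>n. c i * x^i)" using pp unfolding real_polynomial_function_iff_sum by blast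
    have ii: "integrable P (\<lambda>\<omega>. R \<omega> * X \<omega> ^ i)" "integrable Q (\<lambda>\<omega>. R \<omega> * X \<omega> ^ i)" for i
      by (rule bi[of "\<lambda>x. x^i" 1]; simp add: power_le_one)+
    have "R \<omega> * p (X \<omega>) = (\<Sum>i\<le>n. c i * (R \<omega> * X \<omega> ^ i))" for \<omega>
      by (simp add: p sum_distrib_left mult_ac)
    then show ?thesis using ii eq by (simp add: Bochner_Integration.integral_sum)
  qed
  have cont: "(\<integral>\<omega>. R \<omega> * h (X \<omega>) \<partial>P) = (\<integral>\<omega>. R \<omega> * h (X \<omega>) \<partial>Q)"
    if h: "continuous_on UNIV h" and hb: "\<And>x. \<bar>h x\<bar> \<le> 1" for h
  proof -
    define C where "C = measure P (space P) + measure Q (space Q)"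
    have C0: "C \<ge> 0" by (simp add: C_def)
    have hm[measurable]: "h \<in> borel_measurable borel" using h by (rule borel_measurable_continuous_onI)
    have "\<bar>(\<integral>\<omega>. R \<omega> * h (X \<omega>) \<partial>P) - (\<integral>\<omega>. R \<omega> * h (X \<omega>) \<partial>Q)\<bar> \<le> e * C" if e: "e > 0" for e
    proof -
      obtain p where p: "real_polynomial_function p" "\<And>x. x \<in> {0..1} \<Longrightarrow> \<bar>h x - p x\<bar> < e"
        using Stone_Weierstrass_real_polynomial_function[of "{0..1::real}" h e] h e continuous_on_subset by blast
      have pm[measurable]: "p \<in> borel_measurable borel"
        using p(1) by (intro borel_measurable_continuous_onI) (simp add: continuous_on_polymonial_function real_polynomial_function_eq)
      have pb: "\<bar>p x\<bar> \<le> 1 + e" if "0 \<le> x" "x \<le> 1" for x using p(2)[of x] hb[of x] that by auto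
      have ih: "integrable P (\<lambda>\<omega>. R \<omega> * h (X \<omega>))" "integrable Q (\<lambda>\<omega>. R \<omega> * h (X \<omega>))"
        by (rule bi(1)[of h 1, OF hm], rule hb, rule bi(2)[of h 1, OF hm], rule hb)
      have ip: "integrable P (\<lambda>\<omega>. R \<omega> * p (X \<omega>))" "integrable Q (\<lambda>\<omega>. R \<omega> * p (X \<omega>))"
        by (rule bi(1)[of p "1+e", OF pm], erule (1) pb, rule bi(2)[of p "1+e", OF pm], erule (1) pb)
      have d: "\<bar>R \<omega> * h (X \<omega>) - R \<omega> * p (X \<omega>)\<bar> \<le> e" for \<omega>
      proof -
        have "\<bar>R \<omega>\<bar> * \<bar>h (X \<omega>) - p (X \<omega>)\<bar> \<le> 1 * e"
          using R1[of \<omega>] p(2)[of "X \<omega>"] X01[of \<omega>] by (intro mult_mono) auto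
        then show ?thesis by (simp add: abs_mult[symmetric] right_diff_distrib)
      qed
      have "\<bar>\<integral>\<omega>. R \<omega> * h (X \<omega>) - R \<omega> * p (X \<omega>) \<partial>P\<bar> \<le> (\<integral>\<omega>. e \<partial>P)"
        by (rule order_trans[OF integral_abs_bound integral_mono[OF integrable_abs[OF Bochner_Integration.integrable_diff[OF ih(1) ip(1)]] P.integrable_const d]])
      then have 1: "\<bar>(\<integral>\<omega>. R \<omega> * h (X \<omega>) \<partial>P) - (\<integral>\<omega>. R \<omega> * p (X \<omega>) \<partial>P)\<bar> \<le> e * measure P (space P)"
        unfolding Bochner_Integration.integral_diff[OF ih(1) ip(1)] by (simp add: mult.commute)
      have "\<bar>\<integral>\<omega>. R \<omega> * h (X \<omega>) - R \<omega> * p (X \<omega>) \<partial>Q\<bar> \<le> (\<integral>\<omega>. e \<partial>Q)"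
        by (rule order_trans[OF integral_abs_bound integral_mono[OF integrable_abs[OF Bochner_Integration.integrable_diff[OF ih(2) ip(2)]] Q.integrable_const d]])
      then have 2: "\<bar>(\<integral>\<omega>. R \<omega> * h (X \<omega>) \<partial>Q) - (\<integral>\<omega>. R \<omega> * p (X \<omega>) \<partial>Q)\<bar> \<le> e * measure Q (space Q)"
        unfolding Bochner_Integration.integral_diff[OF ih(2) ip(2)] by (simp add: mult.commute)
      show ?thesis
        using 1 2 poly[OF p(1)] unfolding C_def distrib_left by linarith
    qed
    then have le: "\<bar>(\<integral>\<omega>. R \<omega> * h (X \<omega>) \<partial>P) - (\<integral>\<omega>. R \<omega> * h (X \<omega>) \<partial>Q)\<bar> \<le> e * C" if "e > 0" for e
      using that .
    have small: "x = 0" if "\<And>e. e > 0 \<Longrightarrow> \<bar>x\<bar> \<le> e * C" for x :: real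
    proof (rule ccontr)
      assume "x \<noteq> 0"
      define e where "e = \<bar>x\<bar> / (2 * (C + 1))"
      have "e > 0" using \<open>x \<noteq> 0\<close> C0 by (simp add: e_def)
      have "e * C \<le> e * (C+1)" using \<open>e > 0\<close> by simp
      also have "\<dots> = \<bar>x\<bar>/2" using C0 by (simp add: e_def field_simps)
      finally show False using that[OF \<open>e > 0\<close>] \<open>x \<noteq> 0\<close> by simp
    qed
    show ?thesis using small[OF le] by simp
  qed
  define u where "u n x = min 1 (max 0 (real n * (x - a)))" for n and x :: real
  have cu: "continuous_on UNIV (u n)" for n unfolding u_def[abs_def] by (intro continuous_intros)
  have mu[measurable]: "u n \<in> borel_measurable borel" for n by (rule borel_measurable_continuous_onI[OF cu])
  have ub: "0 \<le> u n x \<and> u n x \<le> 1" for n x by (simp add: u_def)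
  have ul: "(\<lambda>n. u n x) \<longlonglongrightarrow> (if x > a then 1 else 0)" for x
  proof (cases "x > a")
    case True
    obtain N where N: "real N > 1/(x-a)" using reals_Archimedean2 by blast
    have "u n x = 1" if "n \<ge> N" for n
    proof -
      have "real n > 1/(x-a)" using N that by linarith
      then have "real n * (x-a) > 1" using True by (simp add: field_simps)
      then show ?thesis by (simp add: u_def)
    qed
    then show ?thesis using True by (intro tendsto_eventually) (auto simp: eventually_sequentially)
  next
    case False
    then have "u n x = 0" for n using mult_nonneg_nonpos[of "real n" "x-a"] by (auto simp: u_def max_def)
    then show ?thesis using False by simp
  qed
  have l: "(\<lambda>n. \<integral>\<omega>. R \<omega> * u n (X \<omega>) \<partial>M) \<longlonglongrightarrow> (\<integral>\<omega>. R \<omega> * (if X \<omega> > a then 1 else 0) \<partial>M)"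
    if M: "M = P \<or> M = Q" for M
  proof (rule integral_dominated_convergence[where w="\<lambda>_. 1"])
    have [measurable]: "X \<in> borel_measurable M" "R \<in> borel_measurable M" using M by auto
    show "(\<lambda>\<omega>. R \<omega> * u n (X \<omega>)) \<in> borel_measurable M" for n by measurable
    show "(\<lambda>\<omega>. R \<omega> * (if X \<omega> > a then 1 else 0)) \<in> borel_measurable M" by measurable
    show "integrable M (\<lambda>_. 1::real)" using M by auto
    show "AE x in M. (\<lambda>n. R x * u n (X x)) \<longlonglongrightarrow> R x * (if a < X x then 1 else 0)"
      by (intro AE_I2 tendsto_mult tendsto_const ul)
    show "AE x in M. norm (R x * u n (X x)) \<le> 1" for n
      using R1 ub by (intro AE_I2) (auto simp: abs_mult intro!: mult_le_one)
  qed
  have "(\<integral>\<omega>. R \<omega> * u n (X \<omega>) \<partial>P) = (\<integral>\<omega>. R \<omega> * u n (X \<omega>) \<partial>Q)" for n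
    using cont[OF cu[of n]] ub by simp
  then show ?thesis using l[of P] l[of Q] LIMSEQ_unique by simp
qed


lemma discrete_radonD: "\<eta> \<in> discrete_radon_measures \<Longrightarrow> \<eta> \<in> radon_measures"
  by (simp add: discrete_radon_measures_def)

text \<open>The constraints are collected in a list because appending lists intersects the sets, which makes the family stable
under intersections.\<close>

definition laplace_box :: "(('a::euclidean_space \<Rightarrow> real) \<times> real) list \<Rightarrow> 'a measure set" where
  "laplace_box L = {\<eta> \<in> discrete_radon_measures. \<forall>(g, a)\<in>set L. exp (- (\<integral>x. g x \<partial>\<eta>)) > a}"

lemma sets_discrete_radon_space:
  "sets discrete_radon_space =
     sigma_sets discrete_radon_measures (laplace_box ` lists (Cc_nonneg \<times> UNIV))" (is "_ = sigma_sets ?D ?E")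
proof
  have sub: "?E \<subseteq> Pow ?D" by (auto simp: laplace_box_def)
  let ?G = "sigma ?D ?E :: 'a measure measure"
  have "(\<lambda>x. x) \<in> measurable ?G discrete_radon_space"
  proof (rule measurable_discrete_radon_space)
    show "\<omega> \<in> space ?G \<Longrightarrow> \<omega> \<in> ?D" for \<omega> using sub by (simp add: space_measure_of)
    fix f :: "'a \<Rightarrow> real" assume f: "f \<in> Cc_nonneg"
    have "(\<lambda>\<eta>. exp (- (\<integral>x. f x \<partial>\<eta>))) \<in> borel_measurable ?G"
      unfolding borel_measurable_iff_greater
    proof
      fix a :: real
      have "{w \<in> space ?G. a < exp (- (\<integral>x. f x \<partial>w))} = laplace_box [(f, a)]"
        using sub by (auto simp: laplace_box_def space_measure_of)
      moreover have "laplace_box [(f,a)] \<in> ?E" using f by auto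
      ultimately show "{w \<in> space ?G. a < exp (- (\<integral>x. f x \<partial>w))} \<in> sets ?G"
        using sub by (simp add: sets_measure_of)
    qed
    then have "(\<lambda>\<eta>. - ln (exp (- (\<integral>x. f x \<partial>\<eta>)))) \<in> borel_measurable ?G" by measurable
    then show "(\<lambda>\<eta>. \<integral>x. f x \<partial>\<eta>) \<in> borel_measurable ?G" by simp
  qed
  then have "sets discrete_radon_space \<subseteq> sets ?G"
  proof (intro subsetI)
    fix A :: "'a measure set" assume m: "(\<lambda>x. x) \<in> measurable ?G discrete_radon_space" and A: "A \<in> sets discrete_radon_space"
    have "A \<subseteq> ?D" using sets.sets_into_space[OF A] by (simp add: space_discrete_radon_space)
    then have "(\<lambda>x. x) -` A \<inter> space ?G = A" using sub by (auto simp: space_measure_of)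
    then show "A \<in> sets ?G" using measurable_sets[OF m A] by simp
  qed
  then show "sets discrete_radon_space \<subseteq> sigma_sets ?D ?E" using sub by (simp add: sets_measure_of)
  show "sigma_sets ?D ?E \<subseteq> sets discrete_radon_space"
    unfolding space_discrete_radon_space[symmetric]
  proof (rule sets.sigma_sets_subset, safe)
    fix L :: "(('a \<Rightarrow> real) \<times> real) list" assume L: "\<forall>x\<in>set L. x \<in> Cc_nonneg \<times> UNIV"
    have "Measurable.pred discrete_radon_space (\<lambda>\<eta>. \<forall>p\<in>set L. exp (- (\<integral>x. fst p x \<partial>\<eta>)) > snd p)"
    proof (intro pred_intros_finite finite_set)
      fix p assume "p \<in> set L"
      then have [measurable]: "(\<lambda>\<eta>. \<integral>x. fst p x \<partial>\<eta>) \<in> borel_measurable discrete_radon_space"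
        using L by (intro integral_measurable_discrete) (auto simp: Cc_nonneg_def)
      show "Measurable.pred discrete_radon_space (\<lambda>\<eta>. exp (- (\<integral>x. fst p x \<partial>\<eta>)) > snd p)" by measurable
    qed
    then have "{\<eta> \<in> space discrete_radon_space. \<forall>p\<in>set L. exp (- (\<integral>x. fst p x \<partial>\<eta>)) > snd p} \<in> sets discrete_radon_space"
      by (simp add: pred_def)
    then show "laplace_box L \<in> sets discrete_radon_space"
      by (simp add: laplace_box_def space_discrete_radon_space split_beta)
  qed
qed

text \<open>Products and powers of the functions \<open>exp (- \<integral>g d\<eta>)\<close> are again of this form. Hence each factor of such a product has
moments, weighted by the others, that agree for \<open>P\<close> and \<open>Q\<close>, and the factors can be replaced by indicators one at a time.\<close>

lemma laplace_functional_unique: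
  fixes P Q :: "'a::euclidean_space measure measure"
  assumes fin: "finite_measure P" "finite_measure Q"
    and s: "sets P = sets discrete_radon_space" "sets Q = sets discrete_radon_space"
    and eq: "\<And>g. g \<in> Cc_nonneg \<Longrightarrow> (\<integral>\<eta>. exp (- (\<integral>x. g x \<partial>\<eta>)) \<partial>P) = (\<integral>\<eta>. exp (- (\<integral>x. g x \<partial>\<eta>)) \<partial>Q)"
  shows "P = Q"
proof -
  interpret P: finite_measure P by fact
  interpret Q: finite_measure Q by fact
  have sp: "space P = discrete_radon_measures" "space Q = discrete_radon_measures"
    using sets_eq_imp_space_eq[OF s(1)] sets_eq_imp_space_eq[OF s(2)] by (simp_all only: space_discrete_radon_space)
  have mI: "(\<lambda>\<eta>. \<integral>x. g x \<partial>\<eta>) \<in> borel_measurable P" if "g \<in> Cc_nonneg" for g :: "'a \<Rightarrow> real"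
    unfolding measurable_cong_sets[OF s(1) refl] using that by (intro integral_measurable_discrete Cc_nonnegD)
  have bx: "laplace_box L \<in> sets P" if "L \<in> lists (Cc_nonneg \<times> UNIV)" for L :: "(('a \<Rightarrow> real) \<times> real) list"
    unfolding s(1) sets_discrete_radon_space using that by (intro sigma_sets.Basic imageI)
  have mix: "(\<integral>\<eta>. exp (- (\<integral>x. g x \<partial>\<eta>)) * indicator (laplace_box L) \<eta> \<partial>P) =
      (\<integral>\<eta>. exp (- (\<integral>x. g x \<partial>\<eta>)) * indicator (laplace_box L) \<eta> \<partial>Q)"
    if "g \<in> Cc_nonneg" "L \<in> lists (Cc_nonneg \<times> UNIV)" for g :: "'a \<Rightarrow> real" and L
    using that
  proof (induction L arbitrary: g)
    case Nil
    have "(\<integral>\<eta>. exp (- (\<integral>x. g x \<partial>\<eta>)) * indicator (laplace_box []) \<eta> \<partial>M) = (\<integral>\<eta>. exp (- (\<integral>x. g x \<partial>\<eta>)) \<partial>M)"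
      if "M = P \<or> M = Q" for M
      using that sp by (intro Bochner_Integration.integral_cong) (auto simp: laplace_box_def)
    then show ?case using eq[OF Nil(1)] by simp
  next
    case (Cons p L)
    obtain h a where p: "p = (h, a)" by (cases p)
    have h: "h \<in> Cc_nonneg" and L: "L \<in> lists (Cc_nonneg \<times> UNIV)" using Cons p by auto
    note mI[OF h, measurable] mI[OF Cons(2), measurable] bx[OF L, measurable]
    let ?X = "\<lambda>\<eta>. exp (- (\<integral>x. h x \<partial>\<eta>))"
    let ?R = "\<lambda>\<eta>. exp (- (\<integral>x. g x \<partial>\<eta>)) * indicator (laplace_box L) \<eta>"
    have "(\<integral>\<eta>. ?R \<eta> * (if ?X \<eta> > a then 1 else 0) \<partial>P) = (\<integral>\<eta>. ?R \<eta> * (if ?X \<eta> > a then 1 else 0) \<partial>Q)"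
    proof (rule equal_moments_imp_equal_tails[OF fin])
      show "sets Q = sets P" using s by simp
      show "?X \<in> borel_measurable P" "?R \<in> borel_measurable P" by measurable
      show "0 \<le> ?X \<eta> \<and> ?X \<eta> \<le> 1" "0 \<le> ?R \<eta> \<and> ?R \<eta> \<le> 1" for \<eta>
        using Cc_nonneg_integral_nonneg[OF h, of \<eta>] Cc_nonneg_integral_nonneg[OF Cons(2), of \<eta>]
        by (auto simp: indicator_def)
      fix l :: nat
      let ?g = "\<lambda>x. g x + real l * h x"
      have g: "?g \<in> Cc_nonneg" using h Cons(2) by (intro Cc_nonneg_add Cc_nonneg_cmult) auto
      have "(\<integral>\<eta>. ?R \<eta> * ?X \<eta> ^ l \<partial>M) = (\<integral>\<eta>. exp (- (\<integral>x. ?g x \<partial>\<eta>)) * indicator (laplace_box L) \<eta> \<partial>M)"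
        if M: "M = P \<or> M = Q" for M
      proof (rule Bochner_Integration.integral_cong[OF refl])
        fix \<eta> assume "\<eta> \<in> space M"
        then have \<eta>: "\<eta> \<in> radon_measures" using M sp discrete_radonD by auto
        have "(\<integral>x. ?g x \<partial>\<eta>) = (\<integral>x. g x \<partial>\<eta>) + real l * (\<integral>x. h x \<partial>\<eta>)"
          using Cc_integrable[OF \<eta>] h Cons(2) by (simp add: Cc_nonneg_def)
        then show "?R \<eta> * ?X \<eta> ^ l = exp (- (\<integral>x. ?g x \<partial>\<eta>)) * indicator (laplace_box L) \<eta>"
          by (simp add: exp_of_nat_mult[symmetric] mult_exp_exp)
      qed
      then show "(\<integral>\<eta>. ?R \<eta> * ?X \<eta> ^ l \<partial>P) = (\<integral>\<eta>. ?R \<eta> * ?X \<eta> ^ l \<partial>Q)"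
        using Cons.IH[OF g L] by simp
    qed
    moreover have "?R \<eta> * (if ?X \<eta> > a then 1 else 0) =
        exp (- (\<integral>x. g x \<partial>\<eta>)) * indicator (laplace_box (p # L)) \<eta>" for \<eta>
      by (auto simp: indicator_def laplace_box_def p)
    ultimately show ?case by simp
  qed
  have nil: "laplace_box [] = (discrete_radon_measures :: 'a measure set)" by (simp add: laplace_box_def)
  show ?thesis
  proof (rule measure_eqI_generator_eq[where E="laplace_box ` lists (Cc_nonneg \<times> UNIV)" and A="\<lambda>_. laplace_box []"
        and \<Omega>="discrete_radon_measures :: 'a measure set"])
    show "Int_stable (laplace_box ` lists (Cc_nonneg \<times> UNIV) :: 'a measure set set)"
      unfolding Int_stable_def
    proof (safe)
      fix L L' :: "(('a \<Rightarrow> real) \<times> real) list"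
      assume "\<forall>x\<in>set L. x \<in> Cc_nonneg \<times> UNIV" "\<forall>x\<in>set L'. x \<in> Cc_nonneg \<times> UNIV"
      then show "laplace_box L \<inter> laplace_box L' \<in> laplace_box ` lists (Cc_nonneg \<times> UNIV)"
        by (intro image_eqI[of _ _ "L @ L'"]) (auto simp: laplace_box_def)
    qed
    fix X assume "X \<in> (laplace_box ` lists (Cc_nonneg \<times> UNIV) :: 'a measure set set)"
    then obtain L where L: "X = laplace_box L" "L \<in> lists (Cc_nonneg \<times> UNIV)" by auto
    have XP: "X \<in> sets P" "X \<in> sets Q" using bx[OF L(2)] L(1) s by auto
    show "emeasure P X = emeasure Q X"
      using mix[OF Cc_nonneg_zero L(2)] XP by (simp add: P.emeasure_eq_measure Q.emeasure_eq_measure L(1))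
  next
    show "range (\<lambda>_::nat. laplace_box []) \<subseteq> (laplace_box ` lists (Cc_nonneg \<times> UNIV) :: 'a measure set set)"
      by auto
    show "(\<Union>i::nat. laplace_box []) = (discrete_radon_measures :: 'a measure set)" by (simp add: nil)
  qed (auto simp: s sets_discrete_radon_space laplace_box_def)
qed

section \<open>From Fourier to Laplace transforms\<close>

lemma has_field_derivative_integral_dominated:
  fixes k :: "complex \<Rightarrow> 'b \<Rightarrow> complex"
  assumes r: "r > 0" and int: "\<And>z. z \<in> ball z0 r \<Longrightarrow> integrable M (k z)"
    and der: "\<And>\<omega>. \<omega> \<in> space M \<Longrightarrow> ((\<lambda>z. k z \<omega>) has_field_derivative k' \<omega>) (at z0)"
    and k': "k' \<in> borel_measurable M" and B: "integrable M B"
    and bound: "\<And>z \<omega>. z \<in> ball z0 r \<Longrightarrow> \<omega> \<in> space M \<Longrightarrow> norm (k z \<omega> - k z0 \<omega>) \<le> B \<omega> * norm (z - z0)"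
  shows "((\<lambda>z. \<integral>\<omega>. k z \<omega> \<partial>M) has_field_derivative (\<integral>\<omega>. k' \<omega> \<partial>M)) (at z0)"
  unfolding has_field_derivative_iff tendsto_at_iff_sequentially comp_def
proof (intro allI impI)
  fix X :: "nat \<Rightarrow> complex" assume X: "\<forall>i. X i \<in> UNIV - {z0}" and lim: "X \<longlonglongrightarrow> z0"
  obtain N where N: "\<And>n. n \<ge> N \<Longrightarrow> X n \<in> ball z0 r"
    using lim r unfolding lim_sequentially by (force simp: dist_commute)
  have "(\<lambda>n. \<integral>\<omega>. (k (X (n + N)) \<omega> - k z0 \<omega>) / (X (n + N) - z0) \<partial>M) \<longlonglongrightarrow> (\<integral>\<omega>. k' \<omega> \<partial>M)"
  proof (rule integral_dominated_convergence[where w=B])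
    fix n
    have Xn: "X (n + N) \<in> ball z0 r" using N by simp
    have [measurable]: "k (X (n+N)) \<in> borel_measurable M" "k z0 \<in> borel_measurable M"
      using int[OF Xn] int[of z0] r by auto
    show "(\<lambda>\<omega>. (k (X (n + N)) \<omega> - k z0 \<omega>) / (X (n + N) - z0)) \<in> borel_measurable M" by measurable
    show "AE \<omega> in M. norm ((k (X (n + N)) \<omega> - k z0 \<omega>) / (X (n + N) - z0)) \<le> B \<omega>"
      using bound[OF Xn] X by (intro AE_I2) (auto simp: norm_divide divide_le_eq)
  next
    show "AE \<omega> in M. (\<lambda>n. (k (X (n + N)) \<omega> - k z0 \<omega>) / (X (n + N) - z0)) \<longlonglongrightarrow> k' \<omega>"
    proof (rule AE_I2)
      fix \<omega> assume "\<omega> \<in> space M"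
      from der[OF this] X lim have "(\<lambda>n. (k (X n) \<omega> - k z0 \<omega>) / (X n - z0)) \<longlonglongrightarrow> k' \<omega>"
        unfolding has_field_derivative_iff tendsto_at_iff_sequentially comp_def by blast
      then show "(\<lambda>n. (k (X (n + N)) \<omega> - k z0 \<omega>) / (X (n + N) - z0)) \<longlonglongrightarrow> k' \<omega>" by (rule LIMSEQ_ignore_initial_segment)
    qed
  qed (fact k' B)+
  moreover have "(\<integral>\<omega>. (k (X (n + N)) \<omega> - k z0 \<omega>) / (X (n + N) - z0) \<partial>M) =
      ((\<integral>\<omega>. k (X (n + N)) \<omega> \<partial>M) - (\<integral>\<omega>. k z0 \<omega> \<partial>M)) / (X (n + N) - z0)" for n
    using int[OF N[of "n+N"]] int[of z0] r by simp
  ultimately have "(\<lambda>n. ((\<integral>\<omega>. k (X (n + N)) \<omega> \<partial>M) - (\<integral>\<omega>. k z0 \<omega> \<partial>M)) / (X (n + N) - z0)) \<longlonglongrightarrow> (\<integral>\<omega>. k' \<omega> \<partial>M)"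
    by (simp only:)
  then show "(\<lambda>n. ((\<integral>\<omega>. k (X n) \<omega> \<partial>M) - (\<integral>\<omega>. k z0 \<omega> \<partial>M)) / (X n - z0)) \<longlonglongrightarrow> (\<integral>\<omega>. k' \<omega> \<partial>M)"
    by (rule LIMSEQ_offset[where k=N])
qed

text \<open>On the half-plane \<open>Im w \<ge> c\<close> the derivative of \<open>exp (\<i> w y)\<close> is at most \<open>y exp (- c y)\<close>. With \<open>c = 0\<close> this controls
increments up to the real axis; with \<open>c > 0\<close> the bound is dominated by \<open>min y 1\<close> and allows differentiation under
the integral.\<close>

lemma norm_exp_ii_diff_le:
  fixes y c :: real
  assumes y: "y \<ge> 0" and z: "Im z \<ge> c" "Im z0 \<ge> c"
  shows "norm (exp (\<i> * z * of_real y) - exp (\<i> * z0 * of_real y)) \<le> y * exp (- c * y) * norm (z - z0)"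
proof (rule field_differentiable_bound[where S="{w. Im w \<ge> c}"])
  show "convex {w. Im w \<ge> c}" by (rule convex_halfspace_Im_ge)
  fix w assume w: "w \<in> {w. Im w \<ge> c}"
  show "((\<lambda>w. exp (\<i> * w * of_real y)) has_field_derivative (\<i> * of_real y * exp (\<i> * w * of_real y))) (at w within {w. Im w \<ge> c})"
    by (auto intro!: derivative_eq_intros)
  have "norm (\<i> * of_real y * exp (\<i> * w * of_real y)) = y * exp (- Im w * y)"
    using y by (simp add: norm_mult)
  also have "\<dots> \<le> y * exp (- c * y)" using w y by (intro mult_left_mono) (auto intro: mult_right_mono)
  finally show "norm (\<i> * of_real y * exp (\<i> * w * of_real y)) \<le> y * exp (- c * y)" .
qed (use z in auto)

context
  fixes M :: "'b measure" and Y :: "'b \<Rightarrow> real"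
  assumes Y[measurable]: "Y \<in> borel_measurable M" and Y0: "\<And>\<omega>. \<omega> \<in> space M \<Longrightarrow> Y \<omega> \<ge> 0"
    and I: "integrable M (\<lambda>\<omega>. min (Y \<omega>) 1)"
begin

lemma norm_exp_ii_minus_one_le:
  assumes "Im z \<ge> 0" "\<omega> \<in> space M"
  shows "norm (exp (\<i> * z * of_real (Y \<omega>)) - 1) \<le> (2 + norm z) * min (Y \<omega>) 1"
proof (cases "Y \<omega> \<le> 1")
  case True
  have "norm (exp (\<i> * z * of_real (Y \<omega>)) - 1) \<le> norm z * Y \<omega>"
    using norm_exp_ii_diff_le[OF Y0[OF assms(2)], of 0 z 0] assms by (simp add: mult.commute)
  also have "\<dots> \<le> (2 + norm z) * Y \<omega>" using Y0[OF assms(2)] by (simp add: mult_right_mono)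
  finally show ?thesis using True by simp
next
  case False
  have "norm (exp (\<i> * z * of_real (Y \<omega>))) \<le> 1"
    using assms Y0[OF assms(2)] by simp
  then have "norm (exp (\<i> * z * of_real (Y \<omega>)) - 1) \<le> 2"
    using norm_triangle_ineq4[of "exp (\<i> * z * of_real (Y \<omega>))" 1] unfolding norm_one by linarith
  then show ?thesis using False by (simp add: min_def add_increasing2)
qed

lemma integrable_exp_ii_minus_one: "Im z \<ge> 0 \<Longrightarrow> integrable M (\<lambda>\<omega>. exp (\<i> * z * of_real (Y \<omega>)) - 1)"
  by (rule Bochner_Integration.integrable_bound[OF integrable_mult_right[OF I, of "2 + norm z"]])
    (auto intro!: AE_I2 order_trans[OF norm_exp_ii_minus_one_le])

lemma continuous_on_exp_ii_integral:
  "continuous_on {z. Im z \<ge> 0} (\<lambda>z. \<integral>\<omega>. (exp (\<i> * z * of_real (Y \<omega>)) - 1) \<partial>M)"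
  unfolding continuous_on_sequentially comp_def
proof (safe)
  fix X z assume z: "Im z \<ge> 0" and X: "\<forall>n. X n \<in> {z. Im z \<ge> 0}" and lim: "X \<longlonglongrightarrow> z"
  obtain R where R: "\<And>n. norm (X n) \<le> R"
    using convergent_imp_Bseq[OF convergentI[OF lim]] by (auto simp: Bseq_def)
  show "(\<lambda>n. \<integral>\<omega>. (exp (\<i> * X n * of_real (Y \<omega>)) - 1) \<partial>M) \<longlonglongrightarrow> (\<integral>\<omega>. (exp (\<i> * z * of_real (Y \<omega>)) - 1) \<partial>M)"
  proof (rule integral_dominated_convergence[where w="\<lambda>\<omega>. (2 + R) * min (Y \<omega>) 1"])
    show "integrable M (\<lambda>\<omega>. (2 + R) * min (Y \<omega>) 1)" using I by simp
    show "AE \<omega> in M. (\<lambda>n. exp (\<i> * X n * of_real (Y \<omega>)) - 1) \<longlonglongrightarrow> exp (\<i> * z * of_real (Y \<omega>)) - 1"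
      by (intro AE_I2 tendsto_intros lim)
    show "AE \<omega> in M. norm (exp (\<i> * X n * of_real (Y \<omega>)) - 1) \<le> (2 + R) * min (Y \<omega>) 1" for n
    proof (rule AE_I2)
      fix \<omega> assume w: "\<omega> \<in> space M"
      have "norm (exp (\<i> * X n * of_real (Y \<omega>)) - 1) \<le> (2 + norm (X n)) * min (Y \<omega>) 1"
        using X by (intro norm_exp_ii_minus_one_le w) auto
      also have "\<dots> \<le> (2 + R) * min (Y \<omega>) 1" using Y0[OF w] R by (intro mult_right_mono) auto
      finally show "norm (exp (\<i> * X n * of_real (Y \<omega>)) - 1) \<le> (2 + R) * min (Y \<omega>) 1" .
    qed
  qed measurable
qed

lemma holomorphic_on_exp_ii_integral:
  "(\<lambda>z. \<integral>\<omega>. (exp (\<i> * z * of_real (Y \<omega>)) - 1) \<partial>M) holomorphic_on {z. Im z > 0}"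
  unfolding holomorphic_on_def
proof (rule ballI)
  fix z0 assume "z0 \<in> {z. Im z > 0}"
  then have z0: "Im z0 > 0" by simp
  define c where "c = Im z0 / 2"
  have c: "c > 0" using z0 by (simp add: c_def)
  have ball: "Im z \<ge> c" if "z \<in> ball z0 c" for z
    using that abs_Im_le_cmod[of "z0 - z"] by (auto simp: dist_norm c_def abs_le_iff)
  define C where "C = max 1 (1 / c)"
  have bd: "y * exp (- c * y) \<le> C * min y 1" if y: "y \<ge> 0" for y :: real
  proof (cases "y \<le> 1")
    case True
    have "exp (- c * y) \<le> 1" using c y by simp
    then have "y * exp (- c * y) \<le> y * 1" using y by (intro mult_left_mono)
    also have "\<dots> \<le> y * C" using y by (intro mult_left_mono) (simp_all add: C_def)
    finally show ?thesis using True by (simp add: mult.commute)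
  next
    case False
    have "c * y \<le> exp (c * y)" using exp_ge_add_one_self[of "c*y"] by linarith
    then have "y * exp (- c * y) \<le> 1 / c" using c by (simp add: exp_minus field_simps)
    then show ?thesis using False by (simp add: C_def)
  qed
  have "((\<lambda>z. \<integral>\<omega>. (exp (\<i> * z * of_real (Y \<omega>)) - 1) \<partial>M) has_field_derivative
      (\<integral>\<omega>. \<i> * of_real (Y \<omega>) * exp (\<i> * z0 * of_real (Y \<omega>)) \<partial>M)) (at z0)"
  proof (rule has_field_derivative_integral_dominated[where r=c and B="\<lambda>\<omega>. C * min (Y \<omega>) 1"])
    show "integrable M (\<lambda>\<omega>. exp (\<i> * z * of_real (Y \<omega>)) - 1)" if "z \<in> ball z0 c" for z
      using ball[OF that] c by (intro integrable_exp_ii_minus_one) simp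
    show "((\<lambda>z. exp (\<i> * z * of_real (Y \<omega>)) - 1) has_field_derivative \<i> * of_real (Y \<omega>) * exp (\<i> * z0 * of_real (Y \<omega>))) (at z0)" for \<omega>
      by (auto intro!: derivative_eq_intros)
    show "integrable M (\<lambda>\<omega>. C * min (Y \<omega>) 1)" using I by simp
    fix z \<omega> assume z: "z \<in> ball z0 c" and w: "\<omega> \<in> space M"
    have "norm (exp (\<i> * z * of_real (Y \<omega>)) - 1 - (exp (\<i> * z0 * of_real (Y \<omega>)) - 1)) =
      norm (exp (\<i> * z * of_real (Y \<omega>)) - exp (\<i> * z0 * of_real (Y \<omega>)))" by simp
    also have "\<dots> \<le> Y \<omega> * exp (- c * Y \<omega>) * norm (z - z0)"
      using ball[OF z] z0 by (intro norm_exp_ii_diff_le Y0[OF w]) (auto simp: c_def)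
    also have "\<dots> \<le> C * min (Y \<omega>) 1 * norm (z - z0)"
      using bd[OF Y0[OF w]] by (intro mult_right_mono) auto
    finally show "norm (exp (\<i> * z * of_real (Y \<omega>)) - 1 - (exp (\<i> * z0 * of_real (Y \<omega>)) - 1)) \<le> C * min (Y \<omega>) 1 * norm (z - z0)" .
  qed (use c in measurable)
  then show "(\<lambda>z. \<integral>\<omega>. (exp (\<i> * z * of_real (Y \<omega>)) - 1) \<partial>M) field_differentiable at z0 within {z. Im z > 0}"
    by (meson field_differentiable_at_within field_differentiable_def)
qed

end

text \<open>Replace \<open>t\<close> by a complex \<open>z\<close>. Both sides of the Fourier identity are holomorphic in the open upper half-plane and
continuous up to the real axis, where they agree. By Schwarz reflection their difference extends to an entire
function that vanishes on the real axis, hence everywhere, in particular at \<open>z = \<i>\<close>. No moment of \<open>V\<close> is assumed, so the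
identity could not be expanded at \<open>0\<close> instead.\<close>

lemma laplace_of_fourier:
  fixes X :: "'b \<Rightarrow> real" and V :: "'c \<Rightarrow> real"
  assumes P: "prob_space P"
    and X[measurable]: "X \<in> borel_measurable P" and X0: "\<And>\<omega>. \<omega> \<in> space P \<Longrightarrow> X \<omega> \<ge> 0"
    and V[measurable]: "V \<in> borel_measurable m" and V0: "\<And>\<omega>. \<omega> \<in> space m \<Longrightarrow> V \<omega> \<ge> 0"
    and I: "integrable m (\<lambda>\<omega>. min (V \<omega>) 1)"
    and fourier: "\<And>t. (\<integral>\<omega>. exp (\<i> * of_real (t * X \<omega>)) \<partial>P) = exp (\<integral>\<omega>. (exp (\<i> * of_real (t * V \<omega>)) - 1) \<partial>m)"
  shows "(\<integral>\<omega>. exp (- X \<omega>) \<partial>P) = exp (- (\<integral>\<omega>. (1 - exp (- V \<omega>)) \<partial>m))"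
proof -
  interpret P: prob_space P by fact
  have IP: "integrable P (\<lambda>\<omega>. min (X \<omega>) 1)"
    using X0 by (intro P.integrable_const_bound[where B=1]) (auto intro!: AE_I2)
  define F where "F z = (\<integral>\<omega>. (exp (\<i> * z * of_real (X \<omega>)) - 1) \<partial>P)" for z
  define G where "G z = (\<integral>\<omega>. (exp (\<i> * z * of_real (V \<omega>)) - 1) \<partial>m)" for z
  define D where "D z = 1 + F z - exp (G z)" for z
  have F: "(\<integral>\<omega>. exp (\<i> * z * of_real (X \<omega>)) \<partial>P) = 1 + F z" if "Im z \<ge> 0" for z
  proof -
    have "(\<integral>\<omega>. exp (\<i> * z * of_real (X \<omega>)) \<partial>P) = (\<integral>\<omega>. (exp (\<i> * z * of_real (X \<omega>)) - 1) + 1 \<partial>P)" by simp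
    also have "\<dots> = F z + 1"
      unfolding F_def by (subst Bochner_Integration.integral_add[OF integrable_exp_ii_minus_one[OF X X0 IP that]]) (auto simp: P.prob_space)
    finally show ?thesis by simp
  qed
  have Dreal: "D z = 0" if "z \<in> \<real>" for z :: complex
  proof -
    obtain t where t: "z = of_real t" using \<open>z \<in> \<real>\<close> by (auto elim: Reals_cases)
    have "1 + F z = (\<integral>\<omega>. exp (\<i> * z * of_real (X \<omega>)) \<partial>P)" using F[of z] t by simp
    also have "\<dots> = exp (G z)" using fourier[of t] by (simp add: t G_def mult.assoc)
    finally show ?thesis by (simp add: D_def)
  qed
  have "(\<lambda>z. if 0 \<le> Im z then D z else cnj (D (cnj z))) holomorphic_on UNIV"
  proof (rule Schwarz_reflection)
    show "D holomorphic_on UNIV \<inter> {z. 0 < Im z}"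
      unfolding D_def F_def G_def
      by (auto intro!: holomorphic_intros holomorphic_on_exp_ii_integral[OF X X0 IP] holomorphic_on_exp_ii_integral[OF V V0 I])
    show "continuous_on (UNIV \<inter> {z. 0 \<le> Im z}) D"
      unfolding D_def F_def G_def
      by (auto intro!: continuous_intros continuous_on_exp_ii_integral[OF X X0 IP] continuous_on_exp_ii_integral[OF V V0 I])
  qed (auto simp: Dreal)
  then have "(if 0 \<le> Im \<i> then D \<i> else cnj (D (cnj \<i>))) = 0"
  proof (rule analytic_continuation[where U="\<real>" and \<xi>=0])
    show "(0::complex) islimpt \<real>"
      unfolding islimpt_approachable
    proof (intro allI impI)
      fix e :: real assume "e > 0"
      then show "\<exists>x'\<in>\<real>. x' \<noteq> (0::complex) \<and> dist x' 0 < e"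
        by (intro bexI[of _ "of_real (e/2)"]) (auto simp: dist_norm)
    qed
  qed (auto simp: Dreal complex_is_Real_iff)
  then have "1 + F \<i> = exp (G \<i>)" by (simp add: D_def)
  then have "(\<integral>\<omega>. exp (\<i> * \<i> * of_real (X \<omega>)) \<partial>P) = exp (G \<i>)" using F[of \<i>] by simp
  moreover have "exp (\<i> * \<i> * of_real x) = complex_of_real (exp (- x))" for x by (simp flip: exp_of_real)
  ultimately have "(\<integral>\<omega>. complex_of_real (exp (- X \<omega>)) \<partial>P) = exp (\<integral>\<omega>. (complex_of_real (exp (- V \<omega>)) - 1) \<partial>m)"
    by (simp add: G_def)
  also have "(\<lambda>\<omega>. complex_of_real (exp (- V \<omega>)) - 1) = (\<lambda>\<omega>. complex_of_real (- (1 - exp (- V \<omega>))))"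
    by auto
  finally have "complex_of_real (\<integral>\<omega>. exp (- X \<omega>) \<partial>P) = complex_of_real (exp (- (\<integral>\<omega>. (1 - exp (- V \<omega>)) \<partial>m)))"
    unfolding integral_complex_of_real by (simp only: exp_of_real Bochner_Integration.integral_minus)
  then show ?thesis by (simp only: of_real_eq_iff)
qed

section \<open>Measurability of masses and integrals\<close>

abbreviation K where "K \<equiv> discrete_radon_space"

lemma discrete_radon_spaceD:
  assumes "\<eta> \<in> space K"
  shows "\<eta> \<in> discrete_radon_measures" "\<eta> \<in> radon_measures" "sets \<eta> = sets borel" "space \<eta> = UNIV"
    "bounded A \<Longrightarrow> emeasure \<eta> A < \<infinity>"
proof -
  show 1: "\<eta> \<in> discrete_radon_measures" using assms by (simp add: space_discrete_radon_space)
  then show 2: "\<eta> \<in> radon_measures" by (rule discrete_radonD)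
  show "sets \<eta> = sets borel" "space \<eta> = UNIV" "bounded A \<Longrightarrow> emeasure \<eta> A < \<infinity>"
    using radon_measuresD[OF 2] by auto
qed

lemma bounded_open_approx:
  fixes A :: "'a::euclidean_space set"
  assumes "open A" "bounded A"
  obtains f :: "nat \<Rightarrow> 'a \<Rightarrow> real" where "\<And>k. f k \<in> Cc_nonneg" "\<And>k x. f k x \<le> 1"
    "\<And>x. incseq (\<lambda>k. f k x)" "\<And>x. (SUP k. ennreal (f k x)) = indicator A x"
proof
  define f :: "nat \<Rightarrow> 'a \<Rightarrow> real" where "f k x = min 1 (real k * infdist x (- A))" for k x
  have "A \<noteq> UNIV" using assms(2) not_bounded_UNIV by metis
  then have ne: "- A \<noteq> {}" by auto
  have out: "f k x = 0" if "x \<notin> A" for k x using that by (simp add: f_def)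
  show "f k \<in> Cc_nonneg" for k
    unfolding Cc_nonneg_def Cc_iff
  proof (intro CollectI conjI allI)
    show "continuous_on UNIV (f k)" unfolding f_def[abs_def] by (intro continuous_intros)
    show "bounded {x. f k x \<noteq> 0}" using out by (intro bounded_subset[OF assms(2)]) auto
    show "0 \<le> f k x" for x by (simp add: f_def infdist_nonneg)
  qed
  show "f k x \<le> 1" for k x by (simp add: f_def)
  show "incseq (\<lambda>k. f k x)" for x
    unfolding f_def incseq_def by (intro allI impI min.mono order_refl mult_right_mono) (auto simp: infdist_nonneg)
  show "(SUP k. ennreal (f k x)) = indicator A x" for x
  proof (cases "x \<in> A")
    case True
    then have d: "infdist x (- A) > 0" using assms(1) ne by (intro infdist_pos_not_in_closed) auto
    obtain k where "real k * infdist x (- A) > 1" using ex_less_of_nat_mult[OF d] by blast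
    then have "f k x = 1" by (simp add: f_def)
    then have "ennreal 1 \<le> (SUP k. ennreal (f k x))" by (intro SUP_upper2[of k]) auto
    moreover have "(SUP k. ennreal (f k x)) \<le> ennreal 1" by (intro SUP_least ennreal_leI) (simp add: f_def)
    ultimately show ?thesis using True by (simp add: antisym)
  next
    case False then show ?thesis by (simp add: out)
  qed
qed

text \<open>Masses of bounded open sets are monotone limits of the functionals that generate the \<open>\<sigma>\<close>-algebra.\<close>

lemma emeasure_bounded_open_SUP:
  assumes \<eta>: "\<eta> \<in> radon_measures"
    and f: "\<And>k. f k \<in> Cc_nonneg" "\<And>x. incseq (\<lambda>k. f k x)" "\<And>x. (SUP k. ennreal (f k x)) = indicator A x"
    and A: "A \<in> sets borel"
  shows "emeasure \<eta> A = (SUP k. ennreal (\<integral>x. f k x \<partial>\<eta>))"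
proof -
  note [simp] = radon_measuresD(1,2)[OF \<eta>]
  have m: "f k \<in> borel_measurable \<eta>" for k
    using Cc_borel_measurable[OF Cc_nonnegD(1)[OF f(1)]] by (simp cong: measurable_cong_sets)
  have "emeasure \<eta> A = (\<integral>\<^sup>+x. indicator A x \<partial>\<eta>)" using A by simp
  also have "\<dots> = (\<integral>\<^sup>+x. (SUP k. ennreal (f k x)) \<partial>\<eta>)" by (simp add: f(3))
  also have "\<dots> = (SUP k. \<integral>\<^sup>+x. ennreal (f k x) \<partial>\<eta>)"
    using f(2) m by (intro nn_integral_monotone_convergence_SUP) (auto simp: incseq_def le_fun_def intro!: ennreal_leI)
  finally show ?thesis by (simp add: Cc_nonneg_nn_integral[OF \<eta> f(1)])
qed

lemma emeasure_ball_measurable: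
  fixes A :: "'a::euclidean_space set"
  assumes "A \<in> sets borel"
  shows "(\<lambda>\<eta>. emeasure \<eta> (A \<inter> ball 0 (real n))) \<in> borel_measurable K"
proof -
  have op: "(\<lambda>\<eta>. emeasure \<eta> A) \<in> borel_measurable K" if A: "open A" "bounded A" for A :: "'a set"
  proof -
    obtain f :: "nat \<Rightarrow> 'a \<Rightarrow> real" where f: "\<And>k. f k \<in> Cc_nonneg" "\<And>k x. f k x \<le> 1"
      "\<And>x. incseq (\<lambda>k. f k x)" "\<And>x. (SUP k. ennreal (f k x)) = indicator A x"
      using bounded_open_approx[OF A] by blast
    have [measurable]: "(\<lambda>\<eta>. \<integral>x. f k x \<partial>\<eta>) \<in> borel_measurable K" for k
      using f(1) by (intro integral_measurable_discrete Cc_nonnegD)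
    have "(\<lambda>\<eta>. SUP k. ennreal (\<integral>x. f k x \<partial>\<eta>)) \<in> borel_measurable K" by measurable
    then show ?thesis
      by (rule measurable_cong[THEN iffD1, rotated])
        (intro emeasure_bounded_open_SUP[symmetric] discrete_radon_spaceD f borel_open A)
  qed
  note [simp] = discrete_radon_spaceD(3,4)
  have sb: "sets borel = sigma_sets UNIV {S::'a set. open S}" by (simp add: borel_def)
  have st: "Int_stable {S::'a set. open S}" "{S::'a set. open S} \<subseteq> Pow UNIV" by (auto simp: Int_stable_def)
  have "A \<in> sigma_sets UNIV {S::'a set. open S}" using assms sb by simp
  with st show ?thesis
  proof (induction A rule: sigma_sets_induct_disjoint)
    case (basic A)
    then show ?case by (intro op) auto
  next
    case (compl A)
    have "(\<lambda>\<eta>. emeasure \<eta> (ball 0 (real n)) - emeasure \<eta> (A \<inter> ball 0 (real n))) \<in> borel_measurable K"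
    proof -
      have [measurable]: "(\<lambda>\<eta>. emeasure \<eta> (ball 0 (real n) :: 'a set)) \<in> borel_measurable K" by (intro op) auto
      note compl(2)[measurable]
      show ?thesis by measurable
    qed
    moreover have "emeasure \<eta> (ball 0 (real n)) - emeasure \<eta> (A \<inter> ball 0 (real n)) = emeasure \<eta> ((UNIV - A) \<inter> ball 0 (real n))"
      if \<eta>: "\<eta> \<in> space K" for \<eta>
    proof -
      have "A \<in> sets borel" using compl(1) sb by simp
      then show ?thesis
        using \<eta> discrete_radon_spaceD(5)[OF \<eta> bounded_subset[OF bounded_ball Int_lower2], of A 0 "real n"]
        by (subst emeasure_Diff[symmetric]) (auto intro!: arg_cong[where f="emeasure \<eta>"])
    qed
    ultimately show ?case by (simp cong: measurable_cong)
  next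
    case (union A)
    have [measurable]: "(\<lambda>\<eta>. emeasure \<eta> (A i \<inter> ball 0 (real n))) \<in> borel_measurable K" for i by (rule union)
    have "(\<lambda>\<eta>. \<Sum>i. emeasure \<eta> (A i \<inter> ball 0 (real n))) \<in> borel_measurable K" by measurable
    moreover have "(\<Sum>i. emeasure \<eta> (A i \<inter> ball 0 (real n))) = emeasure \<eta> ((\<Union>i. A i) \<inter> ball 0 (real n))"
      if \<eta>: "\<eta> \<in> space K" for \<eta>
    proof -
      have "range A \<subseteq> sets borel" using union(2) sb by simp
      then show ?thesis using \<eta> union(1)
        by (subst suminf_emeasure) (auto simp: disjoint_family_on_def)
    qed
    ultimately show ?case by (simp cong: measurable_cong)
  qed auto
qed

text \<open>Radon measures are only locally finite, while the step to complements in a \<open>\<pi>\<close>-\<open>\<lambda>\<close> argument subtracts masses. The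
argument is therefore carried out inside a ball, whose radius is sent to infinity afterwards.\<close>

lemma kernel_measurable:
  fixes \<kappa> :: "'b \<Rightarrow> 'a::euclidean_space measure"
  assumes \<kappa>[measurable]: "\<kappa> \<in> measurable \<Omega> K"
    and F: "F \<in> borel_measurable (\<Omega> \<Otimes>\<^sub>M borel)"
  shows "(\<lambda>\<omega>. \<integral>\<^sup>+y. F (\<omega>, y) \<partial>\<kappa> \<omega>) \<in> borel_measurable \<Omega>"
proof -
  have \<kappa>s: "\<kappa> \<omega> \<in> space K" if "\<omega> \<in> space \<Omega>" for \<omega> using measurable_space[OF \<kappa> that] .
  note [simp] = discrete_radon_spaceD(3,4)[OF \<kappa>s]
  have sec: "Pair \<omega> -` E \<in> sets borel" if "E \<in> sets (\<Omega> \<Otimes>\<^sub>M borel)" for E :: "('b \<times> 'a) set" and \<omega>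
    using that by (rule sets_Pair1)
  \<comment> \<open>Intersecting with a ball keeps the masses finite, as needed for complements.\<close>
  have slice: "(\<lambda>\<omega>. emeasure (\<kappa> \<omega>) (Pair \<omega> -` E \<inter> ball 0 (real n))) \<in> borel_measurable \<Omega>"
    if "E \<in> sets (\<Omega> \<Otimes>\<^sub>M borel)" for E n
    using Int_stable_pair_measure_generator pair_measure_closed that unfolding sets_pair_measure
  proof (induction E rule: sigma_sets_induct_disjoint)
    case (basic E)
    then obtain a and b :: "'a set" where E: "E = a \<times> b" "a \<in> sets \<Omega>" "b \<in> sets borel" by auto
    have [measurable]: "(\<lambda>\<omega>. emeasure (\<kappa> \<omega>) (b \<inter> ball 0 (real n))) \<in> borel_measurable \<Omega>"
      using measurable_compose[OF \<kappa> emeasure_ball_measurable[OF E(3)]] .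
    have "(\<lambda>\<omega>. emeasure (\<kappa> \<omega>) (b \<inter> ball 0 (real n)) * indicator a \<omega>) \<in> borel_measurable \<Omega>" using E(2) by measurable
    moreover have "emeasure (\<kappa> \<omega>) (b \<inter> ball 0 (real n)) * indicator a \<omega> = emeasure (\<kappa> \<omega>) (Pair \<omega> -` E \<inter> ball 0 (real n))" for \<omega>
      by (auto simp: E(1) indicator_def)
    ultimately show ?case by simp
  next
    case (compl E)
    note compl(2)[measurable]
    have [measurable]: "(\<lambda>\<omega>. emeasure (\<kappa> \<omega>) (ball 0 (real n))) \<in> borel_measurable \<Omega>"
      using measurable_compose[OF \<kappa> emeasure_ball_measurable[of UNIV n]] by simp
    have "(\<lambda>\<omega>. emeasure (\<kappa> \<omega>) (ball 0 (real n)) - emeasure (\<kappa> \<omega>) (Pair \<omega> -` E \<inter> ball 0 (real n))) \<in> borel_measurable \<Omega>"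
      by measurable
    moreover have "emeasure (\<kappa> \<omega>) (ball 0 (real n)) - emeasure (\<kappa> \<omega>) (Pair \<omega> -` E \<inter> ball 0 (real n)) =
        emeasure (\<kappa> \<omega>) (Pair \<omega> -` (space \<Omega> \<times> space borel - E) \<inter> ball 0 (real n))"
      if \<omega>: "\<omega> \<in> space \<Omega>" for \<omega>
    proof -
      have "E \<in> sets (\<Omega> \<Otimes>\<^sub>M borel)" using compl(1) by (simp add: sets_pair_measure)
      note sec[OF this, of \<omega>]
      then show ?thesis
        using \<omega> discrete_radon_spaceD(5)[OF \<kappa>s[OF \<omega>] bounded_subset[OF bounded_ball Int_lower2], of "Pair \<omega> -` E" 0 "real n"]
        by (subst emeasure_Diff[symmetric]) (auto intro!: arg_cong[where f="emeasure (\<kappa> \<omega>)"])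
    qed
    ultimately show ?case by (simp cong: measurable_cong)
  next
    case (union E)
    have [measurable]: "(\<lambda>\<omega>. emeasure (\<kappa> \<omega>) (Pair \<omega> -` E i \<inter> ball 0 (real n))) \<in> borel_measurable \<Omega>" for i by (rule union)
    have "(\<lambda>\<omega>. \<Sum>i. emeasure (\<kappa> \<omega>) (Pair \<omega> -` E i \<inter> ball 0 (real n))) \<in> borel_measurable \<Omega>" by measurable
    moreover have "(\<Sum>i. emeasure (\<kappa> \<omega>) (Pair \<omega> -` E i \<inter> ball 0 (real n))) = emeasure (\<kappa> \<omega>) (Pair \<omega> -` (\<Union>i. E i) \<inter> ball 0 (real n))"
      if \<omega>: "\<omega> \<in> space \<Omega>" for \<omega>
    proof -
      have "E i \<in> sets (\<Omega> \<Otimes>\<^sub>M borel)" for i using union(2) by (auto simp: sets_pair_measure)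
      then have "Pair \<omega> -` E i \<in> sets borel" for i by (rule sec)
      moreover have "(\<Union>i. Pair \<omega> -` E i \<inter> ball 0 (real n)) = Pair \<omega> -` (\<Union>i. E i) \<inter> ball 0 (real n)" by auto
      moreover have "disjoint_family (\<lambda>i. Pair \<omega> -` E i \<inter> ball 0 (real n))"
        using union(1) unfolding disjoint_family_on_def by blast
      ultimately show ?thesis using \<omega>
        by (subst suminf_emeasure) auto
    qed
    ultimately show ?case by (simp cong: measurable_cong)
  qed auto
  have ind: "(\<lambda>\<omega>. emeasure (\<kappa> \<omega>) (Pair \<omega> -` E)) \<in> borel_measurable \<Omega>" if E: "E \<in> sets (\<Omega> \<Otimes>\<^sub>M borel)" for E
  proof -
    note slice[OF E, measurable]
    have "(\<lambda>\<omega>. SUP n. emeasure (\<kappa> \<omega>) (Pair \<omega> -` E \<inter> ball 0 (real n))) \<in> borel_measurable \<Omega>" by measurable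
    moreover have "(SUP n. emeasure (\<kappa> \<omega>) (Pair \<omega> -` E \<inter> ball 0 (real n))) = emeasure (\<kappa> \<omega>) (Pair \<omega> -` E)"
      if \<omega>: "\<omega> \<in> space \<Omega>" for \<omega>
    proof -
      have "(\<Union>n. Pair \<omega> -` E \<inter> ball 0 (real n)) = Pair \<omega> -` E"
        using reals_Archimedean2 by auto
      then show ?thesis
        using sec[OF E, of \<omega>] \<omega> by (subst SUP_emeasure_incseq) (auto simp: incseq_def)
    qed
    ultimately show ?thesis by (simp cong: measurable_cong)
  qed
  show ?thesis
    using F
  proof (induction rule: borel_measurable_induct)
    case (cong f g)
    have "(\<integral>\<^sup>+y. f (\<omega>, y) \<partial>\<kappa> \<omega>) = (\<integral>\<^sup>+y. g (\<omega>, y) \<partial>\<kappa> \<omega>)" if "\<omega> \<in> space \<Omega>" for \<omega>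
      using that cong(3) by (intro nn_integral_cong) (auto simp: space_pair_measure)
    then show ?case using cong(4) by (simp cong: measurable_cong)
  next
    case (set E)
    have "(\<integral>\<^sup>+y. indicator E (\<omega>, y) \<partial>\<kappa> \<omega>) = emeasure (\<kappa> \<omega>) (Pair \<omega> -` E)" if "\<omega> \<in> space \<Omega>" for \<omega>
    proof -
      have "(\<integral>\<^sup>+y. indicator E (\<omega>, y) \<partial>\<kappa> \<omega>) = (\<integral>\<^sup>+y. indicator (Pair \<omega> -` E) y \<partial>\<kappa> \<omega>)"
        by (intro nn_integral_cong) (auto simp: indicator_def)
      then show ?thesis using sec[OF set, of \<omega>] that by simp
    qed
    then show ?case using ind[OF set] by (simp cong: measurable_cong)
  next
    case (mult u c)
    note mult(4)[measurable]
    have "(\<lambda>\<omega>. c * (\<integral>\<^sup>+y. u (\<omega>, y) \<partial>\<kappa> \<omega>)) \<in> borel_measurable \<Omega>" by measurable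
    moreover have "(\<integral>\<^sup>+y. c * u (\<omega>, y) \<partial>\<kappa> \<omega>) = c * (\<integral>\<^sup>+y. u (\<omega>, y) \<partial>\<kappa> \<omega>)" if "\<omega> \<in> space \<Omega>" for \<omega>
      using that measurable_Pair2[OF mult(2), of \<omega>] by (intro nn_integral_cmult) (simp cong: measurable_cong_sets)
    ultimately show ?case by (simp cong: measurable_cong)
  next
    case (add u v)
    note add.IH[measurable]
    have "(\<lambda>\<omega>. (\<integral>\<^sup>+y. v (\<omega>, y) \<partial>\<kappa> \<omega>) + (\<integral>\<^sup>+y. u (\<omega>, y) \<partial>\<kappa> \<omega>)) \<in> borel_measurable \<Omega>" by measurable
    moreover have "(\<integral>\<^sup>+y. v (\<omega>, y) + u (\<omega>, y) \<partial>\<kappa> \<omega>) = (\<integral>\<^sup>+y. v (\<omega>, y) \<partial>\<kappa> \<omega>) + (\<integral>\<^sup>+y. u (\<omega>, y) \<partial>\<kappa> \<omega>)"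
      if "\<omega> \<in> space \<Omega>" for \<omega>
      using that measurable_Pair2[OF add.hyps(1), of \<omega>] measurable_Pair2[OF add.hyps(3), of \<omega>]
      by (intro nn_integral_add) (simp_all cong: measurable_cong_sets)
    ultimately show ?case by (simp cong: measurable_cong)
  next
    case (seq U)
    note seq.IH[measurable]
    have "(\<lambda>\<omega>. SUP i. \<integral>\<^sup>+y. U i (\<omega>, y) \<partial>\<kappa> \<omega>) \<in> borel_measurable \<Omega>" by measurable
    moreover have "(\<integral>\<^sup>+y. (SUP i. U i) (\<omega>, y) \<partial>\<kappa> \<omega>) = (SUP i. \<integral>\<^sup>+y. U i (\<omega>, y) \<partial>\<kappa> \<omega>)"
      if "\<omega> \<in> space \<Omega>" for \<omega>
      unfolding SUP_apply
      using that measurable_Pair2[OF seq.hyps(1), of \<omega>] seq.hyps(3)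
      by (intro nn_integral_monotone_convergence_SUP) (auto simp: incseq_def le_fun_def cong: measurable_cong_sets)
    ultimately show ?case by (simp cong: measurable_cong)
  qed
qed


section \<open>Atoms of discrete Radon measures\<close>

definition atoms :: "'a::euclidean_space measure \<Rightarrow> 'a set" where
  "atoms \<eta> = {x. emeasure \<eta> {x} \<noteq> 0}"

definition atom_sum :: "('a::euclidean_space \<times> real \<Rightarrow> ennreal) \<Rightarrow> 'a measure \<Rightarrow> ennreal" where
  "atom_sum k \<eta> = (\<integral>\<^sup>+x. k (x, measure \<eta> {x}) \<partial>count_space (atoms \<eta>))"

lemma emeasure_atom:
  assumes "\<eta> \<in> space K"
  shows "emeasure \<eta> {x} = ennreal (measure \<eta> {x})" "x \<in> atoms \<eta> \<longleftrightarrow> measure \<eta> {x} > 0"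
proof -
  have "emeasure \<eta> {x} \<noteq> \<infinity>" using discrete_radon_spaceD(5)[OF assms, of "{x}"] by auto
  then show "emeasure \<eta> {x} = ennreal (measure \<eta> {x})" by (simp add: emeasure_eq_ennreal_measure)
  then show "x \<in> atoms \<eta> \<longleftrightarrow> measure \<eta> {x} > 0"
    by (simp add: atoms_def zero_less_measure_iff)
qed

text \<open>The representation that defines a discrete Radon measure is unique: \<open>S\<close> is the set of atoms and \<open>s x\<close> is the mass of
\<open>x\<close>. This makes it possible to speak of the atoms of \<open>\<eta>\<close> in a measurable way.\<close>

lemma discrete_radon_atoms:
  assumes \<eta>: "\<eta> \<in> space K"
  shows "countable (atoms \<eta>)"
    "F \<in> borel_measurable borel \<Longrightarrow> (\<integral>\<^sup>+x. F x \<partial>\<eta>) = (\<integral>\<^sup>+x. emeasure \<eta> {x} * F x \<partial>count_space (atoms \<eta>))"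
proof -
  obtain S and s :: "'a \<Rightarrow> real" where S: "countable S" "\<And>x. x \<in> S \<Longrightarrow> s x > 0"
    "\<And>A. A \<in> sets borel \<Longrightarrow> emeasure \<eta> A = (\<integral>\<^sup>+x. ennreal (s x) * indicator A x \<partial>count_space S)"
    using discrete_radon_spaceD(1)[OF \<eta>] unfolding discrete_radon_measures_def by blast
  have at: "emeasure \<eta> {x} = (if x \<in> S then ennreal (s x) else 0)" for x
  proof -
    have "emeasure \<eta> {x} = (\<integral>\<^sup>+y. ennreal (s y) * indicator {x} y \<partial>count_space S)" by (rule S(3)) simp
    also have "\<dots> = (\<integral>\<^sup>+y. ennreal (s x) * indicator {x} y \<partial>count_space S)"
      by (intro nn_integral_cong) (auto simp: indicator_def)
    also have "\<dots> = ennreal (s x) * emeasure (count_space S) ({x} \<inter> S)"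
      by (subst nn_integral_cmult) (auto simp: nn_integral_indicator[symmetric] indicator_def intro!: nn_integral_cong arg_cong2[where f="(*)"] simp del: nn_integral_indicator)
    finally show ?thesis by (auto simp: emeasure_count_space)
  qed
  have "x \<in> S \<Longrightarrow> ennreal (s x) \<noteq> 0" for x using S(2)[of x] by (simp add: ennreal_eq_0_iff)
  then have SA: "atoms \<eta> = S" unfolding atoms_def at by auto
  then show "countable (atoms \<eta>)" using S(1) by simp
  let ?N = "distr (density (count_space S) (\<lambda>x. emeasure \<eta> {x})) borel id"
  have "\<eta> = ?N"
  proof (rule measure_eqI)
    fix A assume A: "A \<in> sets \<eta>"
    then have Ab: "A \<in> sets borel" by (simp add: discrete_radon_spaceD(3)[OF \<eta>])
    have "emeasure ?N A = (\<integral>\<^sup>+x. emeasure \<eta> {x} * indicator (A \<inter> S) x \<partial>count_space S)"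
      using Ab by (simp add: emeasure_distr emeasure_density)
    also have "\<dots> = (\<integral>\<^sup>+x. ennreal (s x) * indicator A x \<partial>count_space S)"
      by (intro nn_integral_cong) (auto simp: at indicator_def)
    finally show "emeasure \<eta> A = emeasure ?N A" using S(3)[OF Ab] by simp
  qed (simp add: discrete_radon_spaceD(3)[OF \<eta>])
  moreover assume "F \<in> borel_measurable borel"
  ultimately have "(\<integral>\<^sup>+x. F x \<partial>\<eta>) = (\<integral>\<^sup>+x. F x \<partial>?N)" by simp
  also have "\<dots> = (\<integral>\<^sup>+x. emeasure \<eta> {x} * F x \<partial>count_space (atoms \<eta>))"
    using \<open>F \<in> _\<close> by (simp add: nn_integral_distr nn_integral_density SA)
  finally show "(\<integral>\<^sup>+x. F x \<partial>\<eta>) = (\<integral>\<^sup>+x. emeasure \<eta> {x} * F x \<partial>count_space (atoms \<eta>))" .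
qed

lemma emeasure_atom_measurable[measurable]:
  "(\<lambda>p. emeasure (snd p) {fst p}) \<in> borel_measurable (borel \<Otimes>\<^sub>M (K :: 'a::euclidean_space measure measure))"
proof -
  have "(\<lambda>p. \<integral>\<^sup>+y. indicator {q. dist (fst (fst q)) (snd q) = 0} (p, y) \<partial>snd p) \<in>
      borel_measurable (borel \<Otimes>\<^sub>M (K :: 'a measure measure))"
    by (rule kernel_measurable) measurable
  moreover have "(\<integral>\<^sup>+y. indicator {q. dist (fst (fst q)) (snd q) = 0} (p, y) \<partial>snd p) = emeasure (snd p) {fst p}"
    if p: "p \<in> space (borel \<Otimes>\<^sub>M (K :: 'a measure measure))" for p
  proof -
    have k: "snd p \<in> space K" using p by (auto simp: space_pair_measure)
    have "(\<integral>\<^sup>+y. indicator {q. dist (fst (fst q)) (snd q) = 0} (p, y) \<partial>snd p) = (\<integral>\<^sup>+y. indicator {fst p} y \<partial>snd p)"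
      by (intro nn_integral_cong) (auto simp: indicator_def)
    then show ?thesis using discrete_radon_spaceD(3)[OF k] by simp
  qed
  ultimately show ?thesis by (simp cong: measurable_cong)
qed

lemma measure_atom_measurable[measurable]:
  "(\<lambda>p. measure (snd p) {fst p}) \<in> borel_measurable (borel \<Otimes>\<^sub>M (K :: 'a::euclidean_space measure measure))"
  unfolding measure_def by measurable

text \<open>An atom together with its mass. The default \<open>1\<close> at points without mass keeps the value in \<open>half_space\<close>, so that
functions that are measurable only there can be composed with \<open>mark\<close>.\<close>

definition mark :: "'a::euclidean_space \<times> 'a measure \<Rightarrow> 'a \<times> real" where
  "mark p = (fst p, if measure (snd p) {fst p} > 0 then measure (snd p) {fst p} else 1)"

lemma mark_measurable[measurable]: "mark \<in> measurable (borel \<Otimes>\<^sub>M K) half_space"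
  unfolding mark_def[abs_def] half_space_def
  by (intro measurable_Pair measurable_restrict_space2) auto

text \<open>Dividing by the mass of the atom turns a sum over atoms into an integral against \<open>\<eta>\<close>, for which measurability in
\<open>\<eta>\<close> is already known.\<close>

lemma atom_sum_eq_integral:
  assumes \<eta>: "\<eta> \<in> space K" and k: "k \<in> borel_measurable half_space"
  shows "atom_sum k \<eta> = (\<integral>\<^sup>+x. k (mark (x, \<eta>)) / emeasure \<eta> {x} \<partial>\<eta>)"
proof -
  have m1: "(\<lambda>x. k (mark (x, \<eta>))) \<in> borel_measurable borel"
    by (rule measurable_compose[OF measurable_compose[OF measurable_Pair2'[OF \<eta>] mark_measurable] k])
  have "(\<lambda>x. emeasure (snd (x, \<eta>)) {fst (x, \<eta>)}) \<in> borel_measurable borel"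
    by (rule measurable_compose[OF measurable_Pair2'[OF \<eta>] emeasure_atom_measurable])
  then have m2: "(\<lambda>x. k (mark (x, \<eta>)) / emeasure \<eta> {x}) \<in> borel_measurable borel"
    using m1 by simp
  show ?thesis
    unfolding discrete_radon_atoms(2)[OF \<eta> m2] atom_sum_def
  proof (rule nn_integral_cong)
    fix x assume "x \<in> space (count_space (atoms \<eta>))"
    then have "measure \<eta> {x} > 0" using emeasure_atom(2)[OF \<eta>, of x] by simp
    then show "k (x, measure \<eta> {x}) = emeasure \<eta> {x} * (k (mark (x, \<eta>)) / emeasure \<eta> {x})"
      by (simp add: mark_def emeasure_atom(1)[OF \<eta>] ennreal_times_divide ennreal_mult_divide_eq mult.commute[of "ennreal _"])
  qed
qed

lemma atom_sum_measurable:
  assumes k[measurable]: "k \<in> borel_measurable half_space"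
  shows "atom_sum k \<in> borel_measurable (K :: 'a::euclidean_space measure measure)"
proof -
  have "(\<lambda>\<eta>. \<integral>\<^sup>+x. (\<lambda>q. k (mark (snd q, fst q)) / emeasure (fst q) {snd q}) (\<eta>, x) \<partial>\<eta>) \<in> borel_measurable (K :: 'a measure measure)"
  proof (rule kernel_measurable)
    have [measurable]: "(\<lambda>q. (snd q, fst q)) \<in> measurable (K \<Otimes>\<^sub>M borel) (borel \<Otimes>\<^sub>M (K :: 'a measure measure))" by measurable
    have "(\<lambda>q. emeasure (snd (snd q, fst q)) {fst (snd q, fst q)}) \<in> borel_measurable (K \<Otimes>\<^sub>M (borel :: 'a measure))"
      by (rule measurable_compose[OF _ emeasure_atom_measurable]) measurable
    then have [measurable]: "(\<lambda>q. emeasure (fst q) {snd q}) \<in> borel_measurable (K \<Otimes>\<^sub>M (borel :: 'a measure))" by simp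
    show "(\<lambda>q. k (mark (snd q, fst q)) / emeasure (fst q) {snd q}) \<in> borel_measurable (K \<Otimes>\<^sub>M (borel :: 'a measure))" by measurable
  qed measurable
  then show ?thesis by (simp add: atom_sum_eq_integral[OF _ k] cong: measurable_cong)
qed


section \<open>Insertion of an atom\<close>

definition add_atom :: "'a::euclidean_space \<times> real \<Rightarrow> 'a measure \<Rightarrow> 'a measure" where
  "add_atom z \<eta> = measure_of UNIV (sets borel) (\<lambda>A. emeasure \<eta> A + ennreal (snd z) * indicator A (fst z))"

lemma sets_add_atom[simp]: "sets (add_atom z \<eta>) = sets borel"
  using sets.sigma_sets_eq[of borel] by (simp add: add_atom_def)

lemma emeasure_add_atom:
  assumes \<eta>: "\<eta> \<in> space K" and A: "A \<in> sets borel"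
  shows "emeasure (add_atom z \<eta>) A = emeasure \<eta> A + ennreal (snd z) * indicator A (fst z)"
  unfolding add_atom_def
proof (rule emeasure_measure_of_sigma)
  show "sigma_algebra UNIV (sets (borel :: 'a measure))" using sets.sigma_algebra_axioms[of "borel :: 'a measure"] by simp
  show "positive (sets borel) (\<lambda>A. emeasure \<eta> A + ennreal (snd z) * indicator A (fst z))" by (simp add: positive_def)
  show "countably_additive (sets borel) (\<lambda>A. emeasure \<eta> A + ennreal (snd z) * indicator A (fst z))"
  proof (rule countably_additiveI)
    fix A :: "nat \<Rightarrow> 'a set" assume A: "range A \<subseteq> sets borel" "disjoint_family A" "(\<Union>i. A i) \<in> sets borel"
    have i: "indicator B (fst z) = emeasure (return borel (fst z)) B" if "B \<in> sets borel" for B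
      using that by simp
    have "(\<Sum>i. emeasure \<eta> (A i) + ennreal (snd z) * indicator (A i) (fst z)) =
      (\<Sum>i. emeasure \<eta> (A i)) + ennreal (snd z) * (\<Sum>i. indicator (A i) (fst z))"
      by (simp add: suminf_add[symmetric] ennreal_suminf_cmult)
    also have "(\<Sum>i. emeasure \<eta> (A i)) = emeasure \<eta> (\<Union>i. A i)"
      using A discrete_radon_spaceD(3)[OF \<eta>] by (intro suminf_emeasure) auto
    also have "(\<Sum>i. indicator (A i) (fst z)) = (\<Sum>i. emeasure (return borel (fst z)) (A i))"
      using A by (intro suminf_cong i) auto
    also have "\<dots> = emeasure (return borel (fst z)) (\<Union>i. A i)"
      using A by (intro suminf_emeasure) auto
    also have "\<dots> = indicator (\<Union>i. A i) (fst z)" using A(3) by (rule i[symmetric])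
    finally show "(\<Sum>i. emeasure \<eta> (A i) + ennreal (snd z) * indicator (A i) (fst z)) =
       emeasure \<eta> (\<Union> (range A)) + ennreal (snd z) * indicator (\<Union> (range A)) (fst z)" .
  qed
qed (fact A)

lemma half_space_measurable[measurable]:
  "fst \<in> measurable half_space borel" "snd \<in> measurable half_space borel"
  using measurable_snd[of borel "restrict_space borel {0::real<..}"]
  by (auto simp: half_space_def measurable_restrict_space2_iff)

lemma space_half_space: "space half_space = UNIV \<times> {0<..}"
  by (simp add: half_space_def space_pair_measure space_restrict_space)

lemma add_atom_in_K:
  assumes \<eta>: "\<eta> \<in> space K" and z: "snd z > 0"
  shows "add_atom z \<eta> \<in> space K"
  unfolding space_discrete_radon_space discrete_radon_measures_def
proof (intro CollectI conjI)
  show "add_atom z \<eta> \<in> radon_measures"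
    unfolding radon_measures_def
  proof (safe)
    fix C :: "'a set" assume "compact C"
    then show "emeasure (add_atom z \<eta>) C < \<infinity>"
      using discrete_radon_spaceD(5)[OF \<eta>, of C] compact_imp_bounded
      by (subst emeasure_add_atom[OF \<eta>]) (auto simp: compact_imp_closed less_top[symmetric] ennreal_mult_eq_top_iff indicator_def)
  qed simp_all
  let ?S = "insert (fst z) (atoms \<eta>)"
  let ?s = "\<lambda>x. measure \<eta> {x} + (if x = fst z then snd z else 0)"
  show "\<exists>S s. countable S \<and> (\<forall>x\<in>S. s x > 0) \<and> (\<forall>A\<in>sets borel.
      emeasure (add_atom z \<eta>) A = (\<integral>\<^sup>+x. ennreal (s x) * indicator A x \<partial>count_space S))"
  proof (rule exI[of _ ?S], rule exI[of _ ?s], intro conjI ballI)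
    show "countable ?S" using discrete_radon_atoms(1)[OF \<eta>] by simp
    fix x assume "x \<in> ?S"
    then show "?s x > 0" using z emeasure_atom(2)[OF \<eta>, of x] by (auto simp: add_nonneg_pos)
  next
    fix A :: "'a set" assume A: "A \<in> sets borel"
    have sub: "(\<integral>\<^sup>+x. f x \<partial>count_space T) = (\<integral>\<^sup>+x. f x \<partial>count_space ?S)"
      if "T \<subseteq> ?S" "\<And>x. x \<notin> T \<Longrightarrow> f x = 0" for f :: "'a \<Rightarrow> ennreal" and T
      using that by (intro nn_integral_count_space_eq) auto
    have "emeasure \<eta> A = (\<integral>\<^sup>+x. indicator A x \<partial>\<eta>)" using A discrete_radon_spaceD(3)[OF \<eta>] by simp
    also have "\<dots> = (\<integral>\<^sup>+x. emeasure \<eta> {x} * indicator A x \<partial>count_space (atoms \<eta>))"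
      using A by (intro discrete_radon_atoms(2)[OF \<eta>]) simp
    also have "\<dots> = (\<integral>\<^sup>+x. emeasure \<eta> {x} * indicator A x \<partial>count_space ?S)"
      by (rule sub) (auto simp: atoms_def)
    finally have 1: "emeasure \<eta> A = (\<integral>\<^sup>+x. emeasure \<eta> {x} * indicator A x \<partial>count_space ?S)" .
    have "(\<integral>\<^sup>+x. ennreal (if x = fst z then snd z else 0) * indicator A x \<partial>count_space ?S) =
        (\<integral>\<^sup>+x. ennreal (if x = fst z then snd z else 0) * indicator A x \<partial>count_space {fst z})"
      by (rule sub[symmetric]) auto
    also have "\<dots> = ennreal (snd z) * indicator A (fst z)"
      by (cases "fst z \<in> A") (simp_all add: nn_integral_count_space_finite)
    finally have 2: "(\<integral>\<^sup>+x. ennreal (if x = fst z then snd z else 0) * indicator A x \<partial>count_space ?S) =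
        ennreal (snd z) * indicator A (fst z)" .
    have "(\<integral>\<^sup>+x. ennreal (?s x) * indicator A x \<partial>count_space ?S) =
      (\<integral>\<^sup>+x. emeasure \<eta> {x} * indicator A x + ennreal (if x = fst z then snd z else 0) * indicator A x \<partial>count_space ?S)"
      using z by (intro nn_integral_cong) (auto simp: emeasure_atom(1)[OF \<eta>] ennreal_plus distrib_right)
    also have "\<dots> = emeasure (add_atom z \<eta>) A"
      by (subst nn_integral_add) (simp_all add: 2 1[symmetric] emeasure_add_atom[OF \<eta> A])
    finally show "emeasure (add_atom z \<eta>) A = (\<integral>\<^sup>+x. ennreal (?s x) * indicator A x \<partial>count_space ?S)" by simp
  qed
qed

lemma nn_integral_add_atom:
  assumes \<eta>: "\<eta> \<in> space K" and F: "F \<in> borel_measurable borel"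
  shows "(\<integral>\<^sup>+x. F x \<partial>add_atom z \<eta>) = (\<integral>\<^sup>+x. F x \<partial>\<eta>) + ennreal (snd z) * F (fst z)"
  using F
proof (induction rule: borel_measurable_induct)
  case (cong f g) then show ?case by (metis (no_types, lifting) UNIV_I ext space_borel)
next
  case (set A) then show ?case using emeasure_add_atom[OF \<eta> set] discrete_radon_spaceD(3)[OF \<eta>] by simp
next
  case (mult u c)
  have "u \<in> borel_measurable (add_atom z \<eta>)" "u \<in> borel_measurable \<eta>"
    using mult(2) discrete_radon_spaceD(3)[OF \<eta>] by (simp_all cong: measurable_cong_sets)
  then show ?case using mult(4) by (simp add: nn_integral_cmult distrib_left mult_ac)
next
  case (add u v)
  have "u \<in> borel_measurable (add_atom z \<eta>)" "u \<in> borel_measurable \<eta>" "v \<in> borel_measurable (add_atom z \<eta>)" "v \<in> borel_measurable \<eta>"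
    using add.hyps discrete_radon_spaceD(3)[OF \<eta>] by (simp_all cong: measurable_cong_sets)
  then show ?case using add.IH by (simp add: nn_integral_add distrib_left add_ac)
next
  case (seq U)
  have m: "U i \<in> borel_measurable (add_atom z \<eta>)" "U i \<in> borel_measurable \<eta>" for i
    using seq.hyps(1)[of i] discrete_radon_spaceD(3)[OF \<eta>] by (simp_all cong: measurable_cong_sets)
  have "(\<integral>\<^sup>+x. (SUP i. U i) x \<partial>add_atom z \<eta>) = (SUP i. \<integral>\<^sup>+x. U i x \<partial>add_atom z \<eta>)"
    unfolding SUP_apply using seq.hyps(3) m by (intro nn_integral_monotone_convergence_SUP)
  also have "\<dots> = (SUP i. (\<integral>\<^sup>+x. U i x \<partial>\<eta>) + ennreal (snd z) * U i (fst z))" by (simp add: seq.IH)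
  also have "\<dots> = (SUP i. \<integral>\<^sup>+x. U i x \<partial>\<eta>) + (SUP i. ennreal (snd z) * U i (fst z))"
    using seq.hyps(3) by (intro ennreal_SUP_add) (auto simp: incseq_def le_fun_def intro!: nn_integral_mono mult_left_mono)
  also have "(SUP i. \<integral>\<^sup>+x. U i x \<partial>\<eta>) = (\<integral>\<^sup>+x. (SUP i. U i) x \<partial>\<eta>)"
    unfolding SUP_apply using seq.hyps(3) m by (intro nn_integral_monotone_convergence_SUP[symmetric])
  also have "(SUP i. ennreal (snd z) * U i (fst z)) = ennreal (snd z) * (SUP i. U i) (fst z)"
    by (simp add: SUP_mult_left_ennreal image_comp comp_def)
  finally show ?case .
qed

lemma integral_add_atom:
  assumes \<eta>: "\<eta> \<in> space K" and z: "snd z > 0" and f: "f \<in> Cc_nonneg"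
  shows "(\<integral>x. f x \<partial>add_atom z \<eta>) = (\<integral>x. f x \<partial>\<eta>) + snd z * f (fst z)"
proof -
  have fb: "(\<lambda>x. ennreal (f x)) \<in> borel_measurable borel"
    using Cc_borel_measurable[OF Cc_nonnegD(1)[OF f]] by simp
  have "ennreal (\<integral>x. f x \<partial>add_atom z \<eta>) = (\<integral>\<^sup>+x. ennreal (f x) \<partial>add_atom z \<eta>)"
    by (intro Cc_nonneg_nn_integral[symmetric] f discrete_radon_spaceD(2) add_atom_in_K \<eta> z)
  also have "\<dots> = ennreal (\<integral>x. f x \<partial>\<eta>) + ennreal (snd z) * ennreal (f (fst z))"
    by (simp add: nn_integral_add_atom[OF \<eta> fb] Cc_nonneg_nn_integral[OF discrete_radon_spaceD(2)[OF \<eta>] f])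
  also have "\<dots> = ennreal ((\<integral>x. f x \<partial>\<eta>) + snd z * f (fst z))"
    using z Cc_nonnegD(2)[OF f] Cc_nonneg_integral_nonneg[OF f] by (simp add: ennreal_plus ennreal_mult)
  finally show ?thesis
    using z Cc_nonnegD(2)[OF f] Cc_nonneg_integral_nonneg[OF f] by (subst (asm) ennreal_inj) (auto intro!: add_nonneg_nonneg)
qed

lemma measure_add_atom:
  assumes \<eta>: "\<eta> \<in> space K" and z: "snd z > 0"
  shows "measure (add_atom z \<eta>) {y} = measure \<eta> {y} + (if y = fst z then snd z else 0)"
proof -
  have "ennreal (measure (add_atom z \<eta>) {y}) = ennreal (measure \<eta> {y}) + ennreal (snd z) * indicator {y} (fst z)"
    using emeasure_add_atom[OF \<eta>, of "{y}" z] emeasure_atom(1)[OF \<eta>] emeasure_atom(1)[OF add_atom_in_K[OF \<eta> z]] by simp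
  also have "\<dots> = ennreal (measure \<eta> {y} + (if y = fst z then snd z else 0))"
    using z by (auto simp: indicator_def ennreal_plus)
  finally show ?thesis using z by (subst (asm) ennreal_inj) (auto intro!: add_nonneg_nonneg)
qed

lemma add_atom_measurable[measurable]:
  "(\<lambda>p. add_atom (fst p) (snd p)) \<in> measurable (half_space \<Otimes>\<^sub>M (K :: 'a::euclidean_space measure measure)) K"
proof (rule measurable_discrete_radon_space)
  have sp: "snd (fst p) > 0 \<and> snd p \<in> space K" if "p \<in> space (half_space \<Otimes>\<^sub>M (K :: 'a measure measure))" for p
    using that by (auto simp: space_pair_measure space_half_space)
  show "add_atom (fst p) (snd p) \<in> discrete_radon_measures" if "p \<in> space (half_space \<Otimes>\<^sub>M (K :: 'a measure measure))" for p
    using add_atom_in_K sp[OF that] by (metis space_discrete_radon_space)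
  fix f :: "'a \<Rightarrow> real" assume f: "f \<in> Cc_nonneg"
  have [measurable]: "(\<lambda>\<eta>. \<integral>x. f x \<partial>\<eta>) \<in> borel_measurable K" "f \<in> borel_measurable borel"
    using f by (auto intro!: integral_measurable_discrete Cc_borel_measurable Cc_nonnegD)
  have "(\<lambda>p. (\<integral>x. f x \<partial>snd p) + snd (fst p) * f (fst (fst p))) \<in> borel_measurable (half_space \<Otimes>\<^sub>M K)" by measurable
  then show "(\<lambda>p. \<integral>x. f x \<partial>add_atom (fst p) (snd p)) \<in> borel_measurable (half_space \<Otimes>\<^sub>M K)"
    by (rule measurable_cong[THEN iffD1, rotated]) (rule integral_add_atom[symmetric], use sp f in auto)
qed

section \<open>The Laplace functional of a completely random measure\<close>

text \<open>The extension by continuity to \<open>u = 0\<close> lets difference quotients of exponentials be written as products without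
division by zero.\<close>

definition exp_quotient :: "real \<Rightarrow> real" where
  "exp_quotient u = (if u = 0 then 1 else (1 - exp (- u)) / u)"

lemma exp_quotient_eq: "u * exp_quotient u = 1 - exp (- u)"
  by (simp add: exp_quotient_def)

lemma exp_quotient_bounds: "0 \<le> u \<Longrightarrow> 0 \<le> exp_quotient u \<and> exp_quotient u \<le> 1"
  using exp_ge_add_one_self[of "-u"] by (auto simp: exp_quotient_def divide_le_eq)

lemma exp_quotient_tendsto: "u \<longlonglongrightarrow> 0 \<Longrightarrow> (\<lambda>n. exp_quotient (u n)) \<longlonglongrightarrow> 1"
proof -
  have "((\<lambda>u. 1 - exp (- u)) has_field_derivative 1) (at (0::real))"
    by (auto intro!: derivative_eq_intros)
  then have "((\<lambda>u. (1 - exp (- u)) / u) \<longlongrightarrow> 1) (at (0::real))"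
    by (simp add: has_field_derivative_iff)
  moreover have "eventually (\<lambda>u. (1 - exp (- u)) / u = exp_quotient u) (at 0)"
    by (simp add: eventually_at_filter exp_quotient_def)
  ultimately have "(exp_quotient \<longlongrightarrow> 1) (at 0)" by (simp add: tendsto_cong)
  then have "(exp_quotient \<longlongrightarrow> exp_quotient 0) (at 0)" by (simp add: exp_quotient_def[of 0])
  then have "isCont exp_quotient 0" by (simp add: isCont_def)
  moreover assume "u \<longlonglongrightarrow> 0"
  ultimately have "(\<lambda>n. exp_quotient (u n)) \<longlonglongrightarrow> exp_quotient 0" by (rule isCont_tendsto_compose)
  then show ?thesis by (simp add: exp_quotient_def)
qed

lemma mult_exp_minus_le: "0 \<le> x \<Longrightarrow> x * exp (- x) \<le> min x (1::real)"
proof -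
  assume x: "0 \<le> x"
  have "x \<le> exp x" using exp_ge_add_one_self[of x] by linarith
  then have "x * exp (- x) \<le> 1" by (simp add: exp_minus divide_simps)
  moreover have "x * exp (- x) \<le> x * 1" using x by (intro mult_left_mono) auto
  ultimately show ?thesis by simp
qed

lemma sets_borel_bounded_open: "sets (borel :: 'a::euclidean_space measure) = sigma_sets UNIV {S. open S \<and> bounded S}"
proof
  have "S \<in> sigma_sets UNIV {S. open S \<and> bounded S}" if "open S" for S :: "'a set"
  proof -
    have eq: "S = (\<Union>n::nat. S \<inter> ball 0 (real n))" using reals_Archimedean2 by auto
    have "S \<inter> ball 0 (real n) \<in> sigma_sets UNIV {S. open S \<and> bounded S}" for n
      using that by (intro sigma_sets.Basic) auto
    then have "(\<Union>n::nat. S \<inter> ball 0 (real n)) \<in> sigma_sets UNIV {S. open S \<and> bounded S}"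
      by (rule sigma_sets.Union)
    then show ?thesis using eq by (rule ssubst[rotated])
  qed
  then show "sets (borel :: 'a measure) \<subseteq> sigma_sets UNIV {S. open S \<and> bounded S}"
    unfolding borel_def by (subst sets_measure_of) (auto intro!: sigma_sets_mono)
  show "sigma_sets UNIV {S. open S \<and> bounded S} \<subseteq> sets (borel :: 'a measure)"
    by (subst space_borel[symmetric], rule sets.sigma_sets_subset) auto
qed

lemma ball_sets_borel[measurable]: "ball x r \<in> sets (borel :: 'a::euclidean_space measure)"
  by simp

text \<open>An intensity and the law of a completely random measure with that intensity. The same facts are needed for \<open>m\<close>
and for its image under a diffeomorphism.\<close>

locale crm =
  fixes m :: "('a::euclidean_space \<times> real) measure" and P :: "'a measure measure"
  assumes sets_m[measurable_cong]: "sets m = sets half_space"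
    and null_fibres: "\<And>x. emeasure m ({x} \<times> {0<..}) = 0"
    and integrability: "\<And>A. A \<in> sets borel \<Longrightarrow> compact (closure A) \<Longrightarrow>
          (\<integral>\<^sup>+z\<in>A \<times> {0<..}. ennreal (min (snd z) 1) \<partial>m) < \<infinity>"
    and crm: "completely_random_measure m P"
begin

sublocale prob_space P using crm by (simp add: completely_random_measure_def)

lemma sets_P[measurable_cong]: "sets P = sets K"
  using crm by (simp add: completely_random_measure_def)

lemma space_P: "space P = space K" by (rule sets_eq_imp_space_eq[OF sets_P])

lemma m_measurable[measurable]: "fst \<in> measurable m borel" "snd \<in> measurable m borel"
  by (simp_all add: measurable_cong_sets[OF sets_m refl])

lemma space_m: "space m = UNIV \<times> {0<..}"
  using sets_eq_imp_space_eq[OF sets_m] by (simp add: space_half_space)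

lemma mark_pos: "z \<in> space m \<Longrightarrow> snd z > 0" by (auto simp: space_m)

lemma finite_small_mass: "(\<integral>\<^sup>+z. indicator (ball 0 R) (fst z) * ennreal (min (snd z) 1) \<partial>m) < \<infinity>"
proof -
  have "(\<integral>\<^sup>+z. indicator (ball 0 R) (fst z) * ennreal (min (snd z) 1) \<partial>m) =
     (\<integral>\<^sup>+z\<in>ball 0 R \<times> {0<..}. ennreal (min (snd z) 1) \<partial>m)"
    by (intro nn_integral_cong) (auto simp: space_m indicator_def)
  also have "\<dots> < \<infinity>" by (rule integrability) auto
  finally show ?thesis .
qed

lemma integrable_small_mass: "integrable m (\<lambda>z. C * (indicator (ball 0 R) (fst z) * min (snd z) 1))"
proof (rule integrable_mult_right, rule integrableI_nonneg)
  show "AE z in m. 0 \<le> indicator (ball 0 R) (fst z) * min (snd z) 1"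
    by (intro AE_I2) (auto dest: mark_pos)
  have "(\<integral>\<^sup>+z. ennreal (indicator (ball 0 R) (fst z) * min (snd z) 1) \<partial>m) =
      (\<integral>\<^sup>+z. indicator (ball 0 R) (fst z) * ennreal (min (snd z) 1) \<partial>m)"
    by (intro nn_integral_cong) (auto simp: indicator_def)
  then show "(\<integral>\<^sup>+z. ennreal (indicator (ball 0 R) (fst z) * min (snd z) 1) \<partial>m) < \<infinity>"
    using finite_small_mass by simp
qed measurable

lemma Cc_measurable_m: "f \<in> Cc \<Longrightarrow> (\<lambda>z. f (fst z)) \<in> borel_measurable m"
  using Cc_borel_measurable by measurable

lemma Cc_integrable_min:
  assumes f: "f \<in> Cc_nonneg"
  shows "integrable m (\<lambda>z. min (snd z * f (fst z)) 1)"
proof -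
  note [measurable] = Cc_measurable_m[OF Cc_nonnegD(1)[OF f]]
  obtain B where B: "B > 0" "\<And>x. \<bar>f x\<bar> \<le> B" using Cc_bounded[OF Cc_nonnegD(1)[OF f]] by metis
  obtain R where R: "R > 0" "\<And>x. f x \<noteq> 0 \<Longrightarrow> norm x < R" using Cc_support[OF Cc_nonnegD(1)[OF f]] by metis
  show ?thesis
  proof (rule Bochner_Integration.integrable_bound[OF integrable_small_mass[of "B+1" R]])
    show "AE z in m. norm (min (snd z * f (fst z)) 1) \<le> norm ((B+1) * (indicator (ball 0 R) (fst z) * min (snd z) 1))"
    proof (rule AE_I2)
      fix z assume "z \<in> space m"
      then have s: "snd z > 0" by (rule mark_pos)
      show "norm (min (snd z * f (fst z)) 1) \<le> norm ((B+1) * (indicator (ball 0 R) (fst z) * min (snd z) 1))"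
      proof (cases "f (fst z) = 0")
        case False
        have f0: "0 \<le> f (fst z)" using Cc_nonnegD(2)[OF f] .
        have "snd z * f (fst z) \<le> snd z * (B+1)" using s B(2)[of "fst z"] by (intro mult_left_mono) auto
        then have "min (snd z * f (fst z)) 1 \<le> (B+1) * min (snd z) 1"
        proof (cases "snd z \<le> 1")
          case True
          then show ?thesis using \<open>snd z * f (fst z) \<le> snd z * (B+1)\<close> by (simp add: min.coboundedI1 mult.commute)
        next
          case False
          then show ?thesis using B(1) by (simp add: min.coboundedI2)
        qed
        moreover have "0 \<le> min (snd z * f (fst z)) 1" using s f0 by simp
        ultimately show ?thesis using R(2)[OF False] s B(1) by (simp add: abs_mult)
      qed simp
    qed
  qed measurable
qed

lemma integral_measurable_P: "f \<in> Cc \<Longrightarrow> (\<lambda>\<eta>. \<integral>x. f x \<partial>\<eta>) \<in> borel_measurable P"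
  using integral_measurable_discrete by measurable

text \<open>Laplace functionals are multiplicative, positive and bounded, hence better suited for
differentiation and for computations with extended nonnegative integrals than the Fourier transform.\<close>

theorem laplace:
  assumes g: "g \<in> Cc_nonneg"
  shows "(\<integral>\<eta>. exp (- (\<integral>x. g x \<partial>\<eta>)) \<partial>P) = exp (- (\<integral>z. (1 - exp (- (snd z * g (fst z)))) \<partial>m))"
proof (rule laplace_of_fourier)
  show "prob_space P" by (rule prob_space_axioms)
  show "(\<lambda>\<eta>. \<integral>x. g x \<partial>\<eta>) \<in> borel_measurable P" by (rule integral_measurable_P[OF Cc_nonnegD(1)[OF g]])
  show "0 \<le> (\<integral>x. g x \<partial>\<eta>)" for \<eta> by (rule Cc_nonneg_integral_nonneg[OF g])
  show "(\<lambda>z. snd z * g (fst z)) \<in> borel_measurable m"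
    using Cc_measurable_m[OF Cc_nonnegD(1)[OF g]] by measurable
  show "z \<in> space m \<Longrightarrow> 0 \<le> snd z * g (fst z)" for z
    using mark_pos[of z] Cc_nonnegD(2)[OF g] by simp
  show "integrable m (\<lambda>z. min (snd z * g (fst z)) 1)" by (rule Cc_integrable_min[OF g])
  fix t :: real
  have "(\<lambda>x. t * g x) \<in> Cc" using Cc_nonnegD(1)[OF g] by (rule Cc_cmult)
  then have "(\<integral>\<eta>. exp (\<i> * complex_of_real (\<integral>x. t * g x \<partial>\<eta>)) \<partial>P) =
        exp (\<integral>z. (exp (\<i> * complex_of_real (snd z * (t * g (fst z)))) - 1) \<partial>m)"
    by (rule crm[unfolded completely_random_measure_def, THEN conjunct2, THEN conjunct2, rule_format])
  then show "(\<integral>\<eta>. exp (\<i> * complex_of_real (t * (\<integral>x. g x \<partial>\<eta>))) \<partial>P) =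
      exp (\<integral>z. (exp (\<i> * complex_of_real (t * (snd z * g (fst z)))) - 1) \<partial>m)"
    by (simp add: mult.left_commute)
qed

text \<open>Sets of finite intensity that exhaust \<open>space m\<close>: the integrability condition allows infinitely many marks near \<open>s = 0\<close>.\<close>

definition cell :: "nat \<Rightarrow> ('a \<times> real) set" where
  "cell n = {z \<in> space m. norm (fst z) < real n \<and> 1 / real n \<le> snd z}"

lemma cell_sets[measurable]: "cell n \<in> sets m"
  unfolding cell_def by measurable

lemma cell_mono: "n \<le> k \<Longrightarrow> cell n \<subseteq> cell k"
proof (cases "n = 0")
  case False
  assume "n \<le> k"
  then have "1 / real k \<le> 1 / real n" using False by (simp add: frac_le)
  then show ?thesis using \<open>n \<le> k\<close> by (force simp: cell_def)
qed (auto simp: cell_def)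

lemma UN_cell: "(\<Union>n. cell n) = space m"
proof -
  have "\<exists>n. z \<in> cell n" if z: "z \<in> space m" for z
  proof -
    obtain n where n: "real n > max (norm (fst z)) (1 / snd z)" using reals_Archimedean2 by blast
    have s: "snd z > 0" by (rule mark_pos[OF z])
    have "1 / snd z < real n" using n by simp
    then have "1 < real n * snd z" using s by (simp add: divide_less_eq)
    moreover have "0 < real n" using \<open>1 / snd z < real n\<close> s by (meson divide_pos_pos less_trans zero_less_one)
    ultimately have "1 / real n \<le> snd z" by (simp add: divide_le_eq mult.commute)
    then show ?thesis using n z by (auto simp: cell_def)
  qed
  then show ?thesis by (auto simp: cell_def)
qed

lemma emeasure_cell: "emeasure m (cell n) < \<infinity>"
proof -
  have "emeasure m (cell n) = (\<integral>\<^sup>+z. indicator (cell n) z \<partial>m)" by simp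
  also have "\<dots> \<le> (\<integral>\<^sup>+z. ennreal (real n + 1) * (indicator (ball 0 (real n)) (fst z) * ennreal (min (snd z) 1)) \<partial>m)"
  proof (rule nn_integral_mono)
    fix z assume z: "z \<in> space m"
    show "indicator (cell n) z \<le> ennreal (real n + 1) * (indicator (ball 0 (real n)) (fst z) * ennreal (min (snd z) 1))"
    proof (cases "z \<in> cell n")
      case True
      then have c: "norm (fst z) < real n" "1 / real n \<le> snd z" by (auto simp: cell_def)
      then have n: "real n > 0" using norm_ge_zero[of "fst z"] by linarith
      have "1 \<le> (real n + 1) * min (snd z) 1"
      proof (cases "snd z \<le> 1")
        case True
        have "1 = real n * (1 / real n)" using n by simp
        also have "\<dots> \<le> (real n + 1) * snd z" using c n by (intro mult_mono) auto
        finally show ?thesis using True by simp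
      qed (simp add: min_def)
      then have "1 \<le> ennreal ((real n + 1) * min (snd z) 1)" by simp
      also have "\<dots> = ennreal (real n + 1) * ennreal (min (snd z) 1)" using mark_pos[OF z] by (intro ennreal_mult) auto
      finally show ?thesis using True c by simp
    next
      case False then show ?thesis by simp
    qed
  qed
  also have "\<dots> = ennreal (real n + 1) * (\<integral>\<^sup>+z. (indicator (ball 0 (real n)) (fst z) * ennreal (min (snd z) 1)) \<partial>m)"
    by (rule nn_integral_cmult) measurable
  also have "\<dots> < \<infinity>" using finite_small_mass[of "real n"] by (simp add: ennreal_mult_less_top)
  finally show ?thesis .
qed

sublocale m: sigma_finite_measure m
proof
  show "\<exists>A. countable A \<and> A \<subseteq> sets m \<and> \<Union> A = space m \<and> (\<forall>a\<in>A. emeasure m a \<noteq> \<infinity>)"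
    by (rule exI[of _ "range cell"]) (use UN_cell emeasure_cell in \<open>auto simp: less_top\<close>)
qed

sublocale mP: pair_sigma_finite m P ..

section \<open>The Mecke formula\<close>

text \<open>This is the derivative of the Laplace functional at \<open>g\<close> in the direction \<open>f\<close>. The expectation of \<open>\<integral>f d\<eta>\<close> may be infinite;
because of \<open>f \<le> g\<close> the factor \<open>exp (- \<integral>g d\<eta>)\<close> makes the product bounded and allows dominated convergence.\<close>

lemma mecke_laplace:
  assumes f: "f \<in> Cc_nonneg" and g: "g \<in> Cc_nonneg" and fg: "\<And>x. f x \<le> g x"
  shows "(\<integral>\<^sup>+\<eta>. ennreal ((\<integral>x. f x \<partial>\<eta>) * exp (- (\<integral>x. g x \<partial>\<eta>))) \<partial>P) =
    (\<integral>\<^sup>+z. ennreal (snd z * f (fst z) * exp (- (snd z * g (fst z)))) \<partial>m) * (\<integral>\<^sup>+\<eta>. ennreal (exp (- (\<integral>x. g x \<partial>\<eta>))) \<partial>P)"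
proof -
  define Y where "Y \<eta> = (\<integral>x. f x \<partial>\<eta>)" for \<eta>
  define W where "W \<eta> = (\<integral>x. g x \<partial>\<eta>)" for \<eta>
  define a where "a z = snd z * f (fst z)" for z :: "'a \<times> real"
  define b where "b z = snd z * g (fst z)" for z :: "'a \<times> real"
  define t where "t n = 1 / real (Suc n)" for n
  have t: "t n > 0" "t \<longlonglongrightarrow> 0" for n unfolding t_def by (simp, rule LIMSEQ_inverse_real_of_nat[unfolded inverse_eq_divide])
  have [measurable]: "Y \<in> borel_measurable P" "W \<in> borel_measurable P"
    unfolding Y_def W_def using f g by (auto intro!: integral_measurable_P Cc_nonnegD)
  have [measurable]: "a \<in> borel_measurable m" "b \<in> borel_measurable m"
    unfolding a_def[abs_def] b_def[abs_def] using Cc_measurable_m[OF Cc_nonnegD(1)[OF f]] Cc_measurable_m[OF Cc_nonnegD(1)[OF g]]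
    by measurable
  have Y0: "0 \<le> Y \<eta>" "0 \<le> W \<eta>" for \<eta> unfolding Y_def W_def by (auto intro!: Cc_nonneg_integral_nonneg f g)
  have YW: "Y \<eta> \<le> W \<eta>" if "\<eta> \<in> space P" for \<eta>
    unfolding Y_def W_def using that f g fg discrete_radon_spaceD(2)[of \<eta>]
    by (intro integral_mono Cc_integrable) (auto simp: space_P Cc_nonneg_def)
  have a0: "0 \<le> a z" "0 \<le> b z" "a z \<le> b z" if "z \<in> space m" for z
    unfolding a_def b_def using mark_pos[OF that] Cc_nonnegD(2)[OF f] Cc_nonnegD(2)[OF g] fg by (auto intro!: mult_left_mono)
  have intb: "integrable m (\<lambda>z. 1 - exp (- b z))"
  proof (rule Bochner_Integration.integrable_bound[OF Cc_integrable_min[OF g]])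
    show "AE z in m. norm (1 - exp (- b z)) \<le> norm (min (snd z * g (fst z)) 1)"
    proof (rule AE_I2)
      fix z assume z: "z \<in> space m"
      show "norm (1 - exp (- b z)) \<le> norm (min (snd z * g (fst z)) 1)"
        using a0[OF z] exp_ge_add_one_self[of "- b z"] by (simp add: b_def[symmetric])
    qed
  qed measurable
  have intab: "integrable m (\<lambda>z. a z * exp (- b z))"
  proof (rule Bochner_Integration.integrable_bound[OF Cc_integrable_min[OF f]])
    show "AE z in m. norm (a z * exp (- b z)) \<le> norm (min (snd z * f (fst z)) 1)"
    proof (rule AE_I2)
      fix z assume z: "z \<in> space m"
      have "a z * exp (- b z) \<le> a z * exp (- a z)" using a0[OF z] by (intro mult_left_mono) auto
      also have "\<dots> \<le> min (a z) 1" by (rule mult_exp_minus_le[OF a0(1)[OF z]])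
      finally show "norm (a z * exp (- b z)) \<le> norm (min (snd z * f (fst z)) 1)"
        using a0[OF z] by (simp add: a_def[symmetric] b_def)
    qed
  qed measurable
  define L where "L = (\<integral>\<eta>. exp (- W \<eta>) \<partial>P)"
  have bd: "norm (exp (- W \<eta>)) \<le> 1" "norm (exp (- (W \<eta> + t n * Y \<eta>))) \<le> 1" for \<eta> n
  proof -
    have "0 \<le> t n * Y \<eta>" using Y0[of \<eta>] t(1)[of n] by simp
    then have "0 \<le> W \<eta> + t n * Y \<eta>" using Y0(2)[of \<eta>] by linarith
    then show "norm (exp (- W \<eta>)) \<le> 1" "norm (exp (- (W \<eta> + t n * Y \<eta>))) \<le> 1" using Y0(2)[of \<eta>] by simp_all
  qed
  have gn: "(\<lambda>x. g x + t n * f x) \<in> Cc_nonneg" for n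
    using f g t(1)[of n] by (intro Cc_nonneg_add Cc_nonneg_cmult) auto
  define u where "u n = (\<integral>z. exp (- b z) * (1 - exp (- (t n * a z))) \<partial>m)" for n
  have factor: "exp (- b z) * (1 - exp (- (t n * a z))) = t n * (a z * exp (- b z) * exp_quotient (t n * a z))" for n z
    unfolding exp_quotient_eq[symmetric] by (simp only: mult_ac)
  have qb: "0 \<le> exp_quotient (t n * a z)" "exp_quotient (t n * a z) \<le> 1" if "z \<in> space m" for n z
    using exp_quotient_bounds[of "t n * a z"] a0(1)[OF that] t(1)[of n] by auto
  have [measurable]: "exp_quotient \<in> borel_measurable borel" unfolding exp_quotient_def[abs_def] by measurable
  \<comment> \<open>The increment \<open>u n\<close> of the exponent, divided by the step \<open>t n\<close>, converges by dominated convergence.\<close>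
  have lim1: "(\<lambda>n. u n / t n) \<longlonglongrightarrow> (\<integral>z. a z * exp (- b z) \<partial>m)"
  proof -
    have "u n / t n = (\<integral>z. a z * exp (- b z) * exp_quotient (t n * a z) \<partial>m)" for n
      unfolding u_def factor using t(1)[of n] by simp
    moreover have "(\<lambda>n. \<integral>z. a z * exp (- b z) * exp_quotient (t n * a z) \<partial>m) \<longlonglongrightarrow> (\<integral>z. a z * exp (- b z) \<partial>m)"
    proof (rule integral_dominated_convergence[where w="\<lambda>z. a z * exp (- b z)"])
      show "AE z in m. (\<lambda>n. a z * exp (- b z) * exp_quotient (t n * a z)) \<longlonglongrightarrow> a z * exp (- b z)"
        using t(2) by (intro AE_I2) (auto intro!: tendsto_eq_intros exp_quotient_tendsto)
      show "AE z in m. norm (a z * exp (- b z) * exp_quotient (t n * a z)) \<le> a z * exp (- b z)" for n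
        using a0 qb by (intro AE_I2) (auto simp: abs_mult intro!: mult_left_le)
    qed (use intab in auto)
    ultimately show ?thesis by simp
  qed
  have u0: "u \<longlonglongrightarrow> 0"
    using tendsto_mult[OF lim1 t(2)] t(1) by (simp add: less_imp_neq[symmetric])
  have Ln: "(\<integral>\<eta>. exp (- (W \<eta> + t n * Y \<eta>)) \<partial>P) = L * exp (- u n)" for n
  proof -
    have "(\<integral>\<eta>. exp (- (W \<eta> + t n * Y \<eta>)) \<partial>P) = (\<integral>\<eta>. exp (- (\<integral>x. g x + t n * f x \<partial>\<eta>)) \<partial>P)"
    proof (rule Bochner_Integration.integral_cong[OF refl])
      fix \<eta> assume "\<eta> \<in> space P"
      then have "\<eta> \<in> radon_measures" using discrete_radon_spaceD(2) by (simp add: space_P)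
      then show "exp (- (W \<eta> + t n * Y \<eta>)) = exp (- (\<integral>x. g x + t n * f x \<partial>\<eta>))"
        using f g by (simp add: W_def Y_def Cc_integrable Cc_nonnegD)
    qed
    also have "\<dots> = exp (- (\<integral>z. (1 - exp (- (snd z * (g (fst z) + t n * f (fst z))))) \<partial>m))"
      by (rule laplace[OF gn])
    also have "(\<integral>z. (1 - exp (- (snd z * (g (fst z) + t n * f (fst z))))) \<partial>m) =
      (\<integral>z. (1 - exp (- b z)) + exp (- b z) * (1 - exp (- (t n * a z))) \<partial>m)"
      by (intro Bochner_Integration.integral_cong refl) (simp add: a_def b_def algebra_simps mult_exp_exp)
    also have "\<dots> = (\<integral>z. (1 - exp (- b z)) \<partial>m) + u n"
      unfolding u_def
    proof (rule Bochner_Integration.integral_add[OF intb], rule Bochner_Integration.integrable_bound)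
      show "integrable m (\<lambda>z. t n * (a z * exp (- b z)))" using intab by simp
      show "AE z in m. norm (exp (- b z) * (1 - exp (- (t n * a z)))) \<le> norm (t n * (a z * exp (- b z)))"
        unfolding factor using a0 qb t(1)[of n] by (intro AE_I2) (auto simp: abs_mult intro!: mult_left_mono mult_left_le)
    qed measurable
    also have "exp (- ((\<integral>z. (1 - exp (- b z)) \<partial>m) + u n)) = L * exp (- u n)"
      using laplace[OF g] by (simp add: L_def W_def b_def exp_diff exp_minus divide_inverse)
    finally show ?thesis .
  qed
  have lim2: "(\<lambda>n. (L - L * exp (- u n)) / t n) \<longlonglongrightarrow> L * (\<integral>z. a z * exp (- b z) \<partial>m)"
  proof -
    have "(\<lambda>n. L * (u n / t n * exp_quotient (u n))) \<longlonglongrightarrow> L * ((\<integral>z. a z * exp (- b z) \<partial>m) * 1)"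
      by (intro tendsto_intros lim1 exp_quotient_tendsto u0)
    moreover have "L * (u n / t n * exp_quotient (u n)) = (L - L * exp (- u n)) / t n" for n
    proof -
      have "L * (u n / t n * exp_quotient (u n)) = L * (u n * exp_quotient (u n)) / t n" by simp
      then show ?thesis unfolding exp_quotient_eq by (simp add: right_diff_distrib)
    qed
    ultimately show ?thesis by (simp only: mult_1_right)
  qed
  have WE: "W \<eta> * exp (- W \<eta>) \<le> 1" for \<eta> using mult_exp_minus_le[OF Y0(2)[of \<eta>]] by simp
  have lim3: "(\<lambda>n. (L - L * exp (- u n)) / t n) \<longlonglongrightarrow> (\<integral>\<eta>. Y \<eta> * exp (- W \<eta>) \<partial>P)"
  proof -
    have "(L - L * exp (- u n)) / t n = (\<integral>\<eta>. Y \<eta> * exp (- W \<eta>) * exp_quotient (t n * Y \<eta>) \<partial>P)" for n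
    proof -
      have "L - L * exp (- u n) = (\<integral>\<eta>. exp (- W \<eta>) - exp (- (W \<eta> + t n * Y \<eta>)) \<partial>P)"
      proof -
        have i: "integrable P (\<lambda>\<eta>. exp (- W \<eta>))" "integrable P (\<lambda>\<eta>. exp (- (W \<eta> + t n * Y \<eta>)))"
          by (rule integrable_const_bound[where B=1], rule AE_I2, rule bd, measurable)+
        show ?thesis unfolding Bochner_Integration.integral_diff[OF i] Ln L_def[symmetric] ..
      qed
      also have "\<dots> = (\<integral>\<eta>. t n * (Y \<eta> * exp (- W \<eta>) * exp_quotient (t n * Y \<eta>)) \<partial>P)"
      proof (intro Bochner_Integration.integral_cong refl)
        fix \<eta>
        have "exp (- W \<eta>) * (t n * Y \<eta> * exp_quotient (t n * Y \<eta>)) = exp (- W \<eta>) * (1 - exp (- (t n * Y \<eta>)))"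
          by (simp only: exp_quotient_eq)
        then show "exp (- W \<eta>) - exp (- (W \<eta> + t n * Y \<eta>)) = t n * (Y \<eta> * exp (- W \<eta>) * exp_quotient (t n * Y \<eta>))"
          by (simp add: algebra_simps mult_exp_exp)
      qed
      finally show ?thesis using t(1)[of n] by simp
    qed
    moreover have "(\<lambda>n. \<integral>\<eta>. Y \<eta> * exp (- W \<eta>) * exp_quotient (t n * Y \<eta>) \<partial>P) \<longlonglongrightarrow> (\<integral>\<eta>. Y \<eta> * exp (- W \<eta>) \<partial>P)"
    proof (rule integral_dominated_convergence[where w="\<lambda>_. 1"])
      show "AE \<eta> in P. (\<lambda>n. Y \<eta> * exp (- W \<eta>) * exp_quotient (t n * Y \<eta>)) \<longlonglongrightarrow> Y \<eta> * exp (- W \<eta>)"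
        using t(2) by (intro AE_I2) (auto intro!: tendsto_eq_intros exp_quotient_tendsto)
      show "AE \<eta> in P. norm (Y \<eta> * exp (- W \<eta>) * exp_quotient (t n * Y \<eta>)) \<le> 1" for n
      proof (rule AE_I2)
        fix \<eta> assume e: "\<eta> \<in> space P"
        have q: "0 \<le> exp_quotient (t n * Y \<eta>) \<and> exp_quotient (t n * Y \<eta>) \<le> 1"
          using Y0(1)[of \<eta>] t(1)[of n] by (intro exp_quotient_bounds) auto
        have "Y \<eta> * exp (- W \<eta>) \<le> W \<eta> * exp (- W \<eta>)" using YW[OF e] by (intro mult_right_mono) auto
        then have "Y \<eta> * exp (- W \<eta>) \<le> 1" using WE[of \<eta>] by linarith
        then show "norm (Y \<eta> * exp (- W \<eta>) * exp_quotient (t n * Y \<eta>)) \<le> 1"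
          using q Y0(1)[of \<eta>] by (simp add: abs_mult mult_le_one)
      qed
    qed auto
    ultimately show ?thesis by simp
  qed
  have eq: "(\<integral>\<eta>. Y \<eta> * exp (- W \<eta>) \<partial>P) = L * (\<integral>z. a z * exp (- b z) \<partial>m)"
    by (rule LIMSEQ_unique[OF lim3 lim2])
  have iYW: "integrable P (\<lambda>\<eta>. Y \<eta> * exp (- W \<eta>))"
  proof (rule integrable_const_bound[where B=1])
    show "AE \<eta> in P. norm (Y \<eta> * exp (- W \<eta>)) \<le> 1"
    proof (rule AE_I2)
      fix \<eta> assume e: "\<eta> \<in> space P"
      have "Y \<eta> * exp (- W \<eta>) \<le> W \<eta> * exp (- W \<eta>)" using YW[OF e] by (intro mult_right_mono) auto
      then have "Y \<eta> * exp (- W \<eta>) \<le> 1" using WE[of \<eta>] by linarith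
      then show "norm (Y \<eta> * exp (- W \<eta>)) \<le> 1" using Y0(1)[of \<eta>] by (simp add: abs_mult)
    qed
  qed measurable
  have iW: "integrable P (\<lambda>\<eta>. exp (- W \<eta>))"
    using bd(1) by (intro integrable_const_bound[where B=1]) (auto simp del: norm_exp_eq_Re intro!: AE_I2)
  have L0: "L \<ge> 0" unfolding L_def by (intro Bochner_Integration.integral_nonneg) auto
  have "(\<integral>\<^sup>+\<eta>. ennreal (Y \<eta> * exp (- W \<eta>)) \<partial>P) = ennreal (\<integral>\<eta>. Y \<eta> * exp (- W \<eta>) \<partial>P)"
    using Y0 by (intro nn_integral_eq_integral iYW) auto
  also have "\<dots> = ennreal (\<integral>z. a z * exp (- b z) \<partial>m) * ennreal L"
    unfolding eq using L0 a0 by (subst mult.commute, subst ennreal_mult) (auto intro!: integral_nonneg_AE AE_I2)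
  also have "ennreal (\<integral>z. a z * exp (- b z) \<partial>m) = (\<integral>\<^sup>+z. ennreal (a z * exp (- b z)) \<partial>m)"
    using a0 by (intro nn_integral_eq_integral[symmetric] intab) (auto intro!: AE_I2)
  also have "ennreal L = (\<integral>\<^sup>+\<eta>. ennreal (exp (- W \<eta>)) \<partial>P)"
    unfolding L_def by (intro nn_integral_eq_integral[symmetric] iW) auto
  finally show ?thesis by (simp add: Y_def W_def a_def b_def)
qed

end

lemma indicator_UN_SUP: "indicator (\<Union>i. A i) x = (SUP i. indicator (A i) x :: ennreal)"
proof (cases "x \<in> (\<Union>i. A i)")
  case True
  then obtain i where i: "x \<in> A i" by auto
  have 1: "(1::ennreal) \<le> (SUP i. indicator (A i) x)"
    using i by (intro SUP_upper2[of i]) simp_all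
  have 2: "(SUP i. indicator (A i) x) \<le> (1::ennreal)"
    by (rule SUP_least) (simp add: indicator_def)
  have "indicator (\<Union>i. A i) x = (1::ennreal)" using True by (rule indicator_simps(1))
  then show ?thesis using antisym[OF 1 2] by (rule trans)
next
  case False
  then have "indicator (A i) x = (0::ennreal)" for i by (intro indicator_simps(2)) blast
  moreover have "indicator (\<Union>i. A i) x = (0::ennreal)" using False by (rule indicator_simps(2))
  ultimately show ?thesis by simp
qed

context crm
begin

lemma integral_K_measurable:
  "f \<in> Cc_nonneg \<Longrightarrow> (\<lambda>\<eta>. \<integral>x. f x \<partial>\<eta>) \<in> borel_measurable K"
  by (intro integral_measurable_discrete Cc_nonnegD)

lemma add_atom_measurable_mP[measurable]: "(\<lambda>p. add_atom (fst p) (snd p)) \<in> measurable (m \<Otimes>\<^sub>M P) K"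
  unfolding measurable_cong_sets[OF sets_pair_measure_cong[OF sets_m sets_P] refl] by (rule add_atom_measurable)

text \<open>Both sides are masses of \<open>D\<close> under finite measures. The previous lemma with \<open>g + h\<close> in place of \<open>g\<close> says that their
Laplace functionals agree at \<open>h\<close>, so the measures coincide.\<close>

lemma mecke_damped_event:
  assumes f: "f \<in> Cc_nonneg" and g: "g \<in> Cc_nonneg" and fg: "\<And>x. f x \<le> g x" and D: "D \<in> sets K"
  shows "(\<integral>\<^sup>+\<eta>. ennreal ((\<integral>x. f x \<partial>\<eta>) * exp (- (\<integral>x. g x \<partial>\<eta>))) * indicator D \<eta> \<partial>P) =
    (\<integral>\<^sup>+p. ennreal (snd (fst p) * f (fst (fst p)) * exp (- (\<integral>x. g x \<partial>add_atom (fst p) (snd p)))) * indicator D (add_atom (fst p) (snd p)) \<partial>(m \<Otimes>\<^sub>M P))"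
proof -
  define Y where "Y \<eta> = (\<integral>x. f x \<partial>\<eta>)" for \<eta>
  define W where "W \<eta> = (\<integral>x. g x \<partial>\<eta>)" for \<eta>
  define T where "T p = add_atom (fst p) (snd p)" for p :: "('a \<times> real) \<times> 'a measure"
  define v where "v p = snd (fst p) * f (fst (fst p)) * exp (- W (T p))" for p
  have YK[measurable]: "Y \<in> borel_measurable K" "W \<in> borel_measurable K"
    unfolding Y_def W_def by (intro integral_K_measurable f g)+
  have [measurable]: "Y \<in> borel_measurable P" "W \<in> borel_measurable P"
    using YK by (simp_all add: measurable_cong_sets[OF sets_P refl])
  have [measurable]: "T \<in> measurable (m \<Otimes>\<^sub>M P) K" unfolding T_def[abs_def] by (rule add_atom_measurable_mP)
  have [measurable]: "f \<in> borel_measurable borel" "g \<in> borel_measurable borel"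
    using Cc_borel_measurable f g by (auto simp: Cc_nonneg_def)
  have [measurable]: "v \<in> borel_measurable (m \<Otimes>\<^sub>M P)" unfolding v_def[abs_def] by measurable
  have Y0: "0 \<le> Y \<eta>" "0 \<le> W \<eta>" for \<eta> unfolding Y_def W_def by (auto intro!: Cc_nonneg_integral_nonneg f g)
  have sp: "snd (fst p) > 0 \<and> snd p \<in> space K" if "p \<in> space (m \<Otimes>\<^sub>M P)" for p
    using that mark_pos by (auto simp: space_pair_measure space_P)
  have v0: "0 \<le> v p" if "p \<in> space (m \<Otimes>\<^sub>M P)" for p
    using sp[OF that] Cc_nonnegD(2)[OF f] by (simp add: v_def)
  define N1 where "N1 = density P (\<lambda>\<eta>. ennreal (Y \<eta> * exp (- W \<eta>)))"
  define N2 where "N2 = distr (density (m \<Otimes>\<^sub>M P) (\<lambda>p. ennreal (v p))) K T"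
  have lap: "(\<integral>\<^sup>+\<eta>. ennreal (exp (- (\<integral>x. h x \<partial>\<eta>))) \<partial>N1) = (\<integral>\<^sup>+\<eta>. ennreal (exp (- (\<integral>x. h x \<partial>\<eta>))) \<partial>N2)"
    if h: "h \<in> Cc_nonneg" for h
  proof -
    define H where "H \<eta> = (\<integral>x. h x \<partial>\<eta>)" for \<eta>
    define V where "V \<eta> = (\<integral>x. g x + h x \<partial>\<eta>)" for \<eta>
    define a where "a z = snd z * f (fst z) * exp (- (snd z * (g (fst z) + h (fst z))))" for z :: "'a \<times> real"
    have gh: "(\<lambda>x. g x + h x) \<in> Cc_nonneg" by (intro Cc_nonneg_add g h)
    have hK[measurable]: "H \<in> borel_measurable K" "V \<in> borel_measurable K"
      unfolding H_def V_def by (intro integral_K_measurable h gh)+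
    have [measurable]: "H \<in> borel_measurable P" "V \<in> borel_measurable P"
      using hK by (simp_all add: measurable_cong_sets[OF sets_P refl])
    have [measurable]: "h \<in> borel_measurable borel" using h Cc_borel_measurable by (auto simp: Cc_nonneg_def)
    have [measurable]: "a \<in> borel_measurable m" unfolding a_def[abs_def] by measurable
    have add: "V \<eta> = W \<eta> + H \<eta>" if "\<eta> \<in> space K" for \<eta>
      unfolding W_def V_def H_def using discrete_radon_spaceD(2)[OF that] g h by (simp add: Cc_integrable Cc_nonnegD)
    have "(\<integral>\<^sup>+\<eta>. ennreal (exp (- H \<eta>)) \<partial>N1) = (\<integral>\<^sup>+\<eta>. ennreal (Y \<eta> * exp (- W \<eta>)) * ennreal (exp (- H \<eta>)) \<partial>P)"
      unfolding N1_def by (rule nn_integral_density) measurable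
    also have "\<dots> = (\<integral>\<^sup>+\<eta>. ennreal (Y \<eta> * exp (- V \<eta>)) \<partial>P)"
    proof (rule nn_integral_cong)
      fix \<eta> assume "\<eta> \<in> space P"
      then have "V \<eta> = W \<eta> + H \<eta>" using add space_P by simp
      then show "ennreal (Y \<eta> * exp (- W \<eta>)) * ennreal (exp (- H \<eta>)) = ennreal (Y \<eta> * exp (- V \<eta>))"
        using Y0[of \<eta>] by (simp add: ennreal_mult[symmetric] mult_exp_exp mult.assoc)
    qed
    also have "\<dots> = (\<integral>\<^sup>+z. ennreal (a z) \<partial>m) * (\<integral>\<^sup>+\<eta>. ennreal (exp (- V \<eta>)) \<partial>P)"
      unfolding Y_def V_def a_def
      by (rule mecke_laplace[OF f gh]) (use fg Cc_nonnegD(2)[OF h] in \<open>simp add: add_increasing2\<close>)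
    also have "\<dots> = (\<integral>\<^sup>+z. \<integral>\<^sup>+\<eta>. ennreal (a z) * ennreal (exp (- V \<eta>)) \<partial>P \<partial>m)"
      by (simp add: nn_integral_cmult nn_integral_multc)
    also have "\<dots> = (\<integral>\<^sup>+p. ennreal (a (fst p)) * ennreal (exp (- V (snd p))) \<partial>(m \<Otimes>\<^sub>M P))"
    proof -
      have "(\<lambda>p. ennreal (a (fst p)) * ennreal (exp (- V (snd p)))) \<in> borel_measurable (m \<Otimes>\<^sub>M P)" by measurable
      from nn_integral_fst[OF this] show ?thesis by simp
    qed
    also have "\<dots> = (\<integral>\<^sup>+p. ennreal (v p) * ennreal (exp (- H (T p))) \<partial>(m \<Otimes>\<^sub>M P))"
    proof (rule nn_integral_cong)
      fix p assume p: "p \<in> space (m \<Otimes>\<^sub>M P)"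
      obtain z \<eta> where pz: "p = (z, \<eta>)" by (cases p)
      have s: "snd z > 0" "\<eta> \<in> space K" using sp[OF p] pz by auto
      have W: "W (T p) = W \<eta> + snd z * g (fst z)" and H: "H (T p) = H \<eta> + snd z * h (fst z)"
        unfolding W_def H_def T_def pz using integral_add_atom[OF s(2,1)] g h by simp_all
      have c: "exp (- (snd z * (g (fst z) + h (fst z)))) * exp (- V \<eta>) = exp (- W (T p)) * exp (- H (T p))"
        unfolding mult_exp_exp W H add[OF s(2)] by (simp add: algebra_simps)
      have e: "a (fst p) * exp (- V (snd p)) = v p * exp (- H (T p))"
        using c by (simp add: a_def v_def mult.assoc pz)
      show "ennreal (a (fst p)) * ennreal (exp (- V (snd p))) = ennreal (v p) * ennreal (exp (- H (T p)))"
        using e by (simp only: ennreal_mult''[symmetric] exp_ge_zero)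
    qed
    also have "\<dots> = (\<integral>\<^sup>+p. ennreal (exp (- H (T p))) \<partial>density (m \<Otimes>\<^sub>M P) (\<lambda>p. ennreal (v p)))"
      by (rule nn_integral_density[symmetric]) measurable
    also have "\<dots> = (\<integral>\<^sup>+\<eta>. ennreal (exp (- H \<eta>)) \<partial>N2)"
      unfolding N2_def by (rule nn_integral_distr[symmetric]) measurable
    finally show ?thesis by (simp add: H_def)
  qed
  have sN: "sets N1 = sets K" "sets N2 = sets K" by (simp_all add: N1_def N2_def sets_P)
  have "emeasure N1 (space N1) = (\<integral>\<^sup>+\<eta>. ennreal (exp (- (\<integral>x. 0 \<partial>\<eta>))) \<partial>N1)" by simp
  also have "(\<integral>\<^sup>+\<eta>. ennreal (exp (- (\<integral>x. 0 \<partial>\<eta>))) \<partial>N1) = (\<integral>\<^sup>+\<eta>. ennreal (Y \<eta> * exp (- W \<eta>)) \<partial>P)"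
    unfolding N1_def by (subst nn_integral_density) simp_all
  also have "\<dots> \<le> (\<integral>\<^sup>+\<eta>. 1 \<partial>P)"
  proof (rule nn_integral_mono)
    fix \<eta> assume "\<eta> \<in> space P"
    then have r: "\<eta> \<in> radon_measures" using space_P discrete_radon_spaceD(2) by simp
    have "Y \<eta> \<le> W \<eta>" unfolding Y_def W_def using r f g fg by (intro integral_mono Cc_integrable) (auto simp: Cc_nonneg_def)
    then have "Y \<eta> * exp (- W \<eta>) \<le> W \<eta> * exp (- W \<eta>)" by (intro mult_right_mono) auto
    moreover have "W \<eta> * exp (- W \<eta>) \<le> 1" using mult_exp_minus_le[OF Y0(2)[of \<eta>]] by simp
    ultimately have "Y \<eta> * exp (- W \<eta>) \<le> 1" by linarith
    then show "ennreal (Y \<eta> * exp (- W \<eta>)) \<le> 1" by simp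
  qed
  also have "\<dots> = 1" by (simp add: emeasure_space_1)
  finally have t1: "emeasure N1 (space N1) \<le> 1" .
  have "emeasure N2 (space N2) = (\<integral>\<^sup>+\<eta>. ennreal (exp (- (\<integral>x. 0 \<partial>\<eta>))) \<partial>N2)" by simp
  also have "\<dots> = (\<integral>\<^sup>+\<eta>. ennreal (exp (- (\<integral>x. 0 \<partial>\<eta>))) \<partial>N1)" by (rule lap[symmetric, OF Cc_nonneg_zero])
  also have "\<dots> = emeasure N1 (space N1)" by simp
  finally have t2: "emeasure N2 (space N2) \<le> 1" using t1 by simp
  have "N1 = N2"
  proof (rule laplace_functional_unique[OF _ _ sN])
    show "finite_measure N1" "finite_measure N2"
      using t1 t2 by (auto intro!: finite_measureI simp: top_unique)
    fix h :: "'a \<Rightarrow> real" assume h: "h \<in> Cc_nonneg"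
    have hK[measurable]: "(\<lambda>\<eta>. \<integral>x. h x \<partial>\<eta>) \<in> borel_measurable K" by (rule integral_K_measurable[OF h])
    have [measurable]: "(\<lambda>\<eta>. \<integral>x. h x \<partial>\<eta>) \<in> borel_measurable N1" "(\<lambda>\<eta>. \<integral>x. h x \<partial>\<eta>) \<in> borel_measurable N2"
      using hK by (simp_all add: measurable_cong_sets[OF sN(1) refl] measurable_cong_sets[OF sN(2) refl])
    show "(\<integral>\<eta>. exp (- (\<integral>x. h x \<partial>\<eta>)) \<partial>N1) = (\<integral>\<eta>. exp (- (\<integral>x. h x \<partial>\<eta>)) \<partial>N2)"
      using lap[OF h] by (subst (1 2) integral_eq_nn_integral) auto
  qed
  then have "emeasure N1 D = emeasure N2 D" by simp
  moreover have "emeasure N1 D = (\<integral>\<^sup>+\<eta>. ennreal (Y \<eta> * exp (- W \<eta>)) * indicator D \<eta> \<partial>P)"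
    unfolding N1_def using D by (intro emeasure_density) (auto simp: sets_P)
  moreover have "emeasure N2 D = (\<integral>\<^sup>+p. indicator D (T p) \<partial>density (m \<Otimes>\<^sub>M P) (\<lambda>p. ennreal (v p)))"
  proof -
    have "emeasure N2 D = (\<integral>\<^sup>+\<eta>. indicator D \<eta> \<partial>N2)" using D sN by simp
    also have "\<dots> = (\<integral>\<^sup>+p. indicator D (T p) \<partial>density (m \<Otimes>\<^sub>M P) (\<lambda>p. ennreal (v p)))"
      unfolding N2_def using D by (intro nn_integral_distr) auto
    finally show ?thesis .
  qed
  moreover have "\<dots> = (\<integral>\<^sup>+p. ennreal (v p) * indicator D (T p) \<partial>(m \<Otimes>\<^sub>M P))"
    using D by (intro nn_integral_density) auto
  ultimately show ?thesis by (simp add: Y_def W_def v_def T_def)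
qed


lemma section_measurable:
  assumes F: "F \<in> borel_measurable (borel \<Otimes>\<^sub>M K)" and \<eta>: "\<eta> \<in> space K"
  shows "(\<lambda>x. F (x, \<eta>)) \<in> borel_measurable borel" "(\<lambda>x. F (x, \<eta>)) \<in> borel_measurable \<eta>"
proof -
  show 1: "(\<lambda>x. F (x, \<eta>)) \<in> borel_measurable borel"
    by (rule measurable_compose[OF measurable_Pair2'[OF \<eta>] F])
  then show "(\<lambda>x. F (x, \<eta>)) \<in> borel_measurable \<eta>"
    by (simp add: measurable_cong_sets[OF discrete_radon_spaceD(3)[OF \<eta>] refl])
qed

lemma inner_integral_measurable:
  fixes F :: "'a \<times> 'a measure \<Rightarrow> ennreal"
  assumes F: "F \<in> borel_measurable (borel \<Otimes>\<^sub>M K)"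
  shows "(\<lambda>\<eta>. \<integral>\<^sup>+x. F (x, \<eta>) \<partial>\<eta>) \<in> borel_measurable K"
proof -
  have 1: "(\<lambda>q. F (snd q, fst q)) \<in> borel_measurable (K \<Otimes>\<^sub>M borel)"
    by (rule measurable_compose[OF measurable_Pair[OF measurable_snd measurable_fst] F])
  have "(\<lambda>\<eta>. \<integral>\<^sup>+x. (\<lambda>q. F (snd q, fst q)) (\<eta>, x) \<partial>(\<lambda>\<eta>. \<eta>) \<eta>) \<in> borel_measurable K"
    by (rule kernel_measurable[OF measurable_ident_sets[OF refl] 1])
  then show ?thesis by simp
qed

lemma shift_measurable: "(\<lambda>p. (fst (fst p), add_atom (fst p) (snd p))) \<in> measurable (m \<Otimes>\<^sub>M P) (borel \<Otimes>\<^sub>M K)"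
  by (rule measurable_Pair[OF measurable_compose[OF measurable_fst m_measurable(1)] add_atom_measurable_mP])

text \<open>Both sides are additive in \<open>F\<close> and continuous along increasing sequences. It is therefore enough to consider
products of a test function of the location and an event, which is the previous lemma; boxes, measurable sets and
nonnegative functions follow in this order.\<close>

lemma mecke_damped:
  fixes F :: "'a \<times> 'a measure \<Rightarrow> ennreal"
  assumes g: "g \<in> Cc_nonneg" and F: "F \<in> borel_measurable (borel \<Otimes>\<^sub>M K)"
  shows "(\<integral>\<^sup>+\<eta>. ennreal (exp (- (\<integral>x. g x \<partial>\<eta>))) * (\<integral>\<^sup>+x. ennreal (g x) * F (x, \<eta>) \<partial>\<eta>) \<partial>P) =
    (\<integral>\<^sup>+p. ennreal (snd (fst p) * g (fst (fst p)) * exp (- (\<integral>x. g x \<partial>add_atom (fst p) (snd p)))) *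
       F (fst (fst p), add_atom (fst p) (snd p)) \<partial>(m \<Otimes>\<^sub>M P))"
proof -
  define W where "W \<eta> = ennreal (exp (- (\<integral>x. g x \<partial>\<eta>)))" for \<eta>
  define T where "T p = (fst (fst p), add_atom (fst p) (snd p))" for p :: "('a \<times> real) \<times> 'a measure"
  define w where "w p = ennreal (snd (fst p) * g (fst (fst p)) * exp (- (\<integral>x. g x \<partial>add_atom (fst p) (snd p))))"
    for p :: "('a \<times> real) \<times> 'a measure"
  define J where "J F \<eta> = (\<integral>\<^sup>+x. ennreal (g x) * F (x, \<eta>) \<partial>\<eta>)" for F :: "'a \<times> 'a measure \<Rightarrow> ennreal" and \<eta>
  define C1 where "C1 F = (\<integral>\<^sup>+\<eta>. W \<eta> * J F \<eta> \<partial>P)" for F :: "'a \<times> 'a measure \<Rightarrow> ennreal"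
  define C2 where "C2 F = (\<integral>\<^sup>+p. w p * F (T p) \<partial>(m \<Otimes>\<^sub>M P))" for F :: "'a \<times> 'a measure \<Rightarrow> ennreal"
  have [measurable]: "g \<in> borel_measurable borel" using g Cc_borel_measurable by (auto simp: Cc_nonneg_def)
  have IK: "(\<lambda>\<eta>. \<integral>x. g x \<partial>\<eta>) \<in> borel_measurable K" by (rule integral_K_measurable[OF g])
  then have [measurable]: "W \<in> borel_measurable P" unfolding W_def[abs_def] by (simp add: measurable_cong_sets[OF sets_P refl])
  have T[measurable]: "T \<in> measurable (m \<Otimes>\<^sub>M P) (borel \<Otimes>\<^sub>M K)" unfolding T_def[abs_def] by (rule shift_measurable)
  have "(\<lambda>p. \<integral>x. g x \<partial>add_atom (fst p) (snd p)) \<in> borel_measurable (m \<Otimes>\<^sub>M P)"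
    by (rule measurable_compose[OF add_atom_measurable_mP IK])
  then have [measurable]: "w \<in> borel_measurable (m \<Otimes>\<^sub>M P)" unfolding w_def[abs_def] by measurable
  have spP: "\<eta> \<in> space P \<Longrightarrow> \<eta> \<in> space K" for \<eta> by (simp add: space_P)
  have Jm[measurable]: "J F \<in> borel_measurable P" if [measurable]: "F \<in> borel_measurable (borel \<Otimes>\<^sub>M K)" for F
  proof -
    have "(\<lambda>q. ennreal (g (fst q)) * F q) \<in> borel_measurable (borel \<Otimes>\<^sub>M K)" by measurable
    from inner_integral_measurable[OF this] show ?thesis
      by (simp add: J_def[abs_def] measurable_cong_sets[OF sets_P refl])
  qed
  have gm[measurable]: "(\<lambda>x. ennreal (g x)) \<in> borel_measurable \<eta>" if "\<eta> \<in> space K" for \<eta>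
    by (simp add: measurable_cong_sets[OF discrete_radon_spaceD(3)[OF that] refl])
  have sm: "(\<lambda>x. F (x, \<eta>)) \<in> borel_measurable \<eta>"
    if "F \<in> borel_measurable (borel \<Otimes>\<^sub>M K)" "\<eta> \<in> space P" for F :: "'a \<times> 'a measure \<Rightarrow> ennreal" and \<eta>
    using that spP by (intro section_measurable(2))
  have C_add: "C1 (\<lambda>q. F q + G q) = C1 F + C1 G" "C2 (\<lambda>q. F q + G q) = C2 F + C2 G"
    if [measurable]: "F \<in> borel_measurable (borel \<Otimes>\<^sub>M K)" "G \<in> borel_measurable (borel \<Otimes>\<^sub>M K)" for F G
  proof -
    have "J (\<lambda>q. F q + G q) \<eta> = J F \<eta> + J G \<eta>" if "\<eta> \<in> space P" for \<eta>
      unfolding J_def distrib_left using gm[OF spP[OF that]] sm[OF _ that] \<open>F \<in> _\<close> \<open>G \<in> _\<close>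
      by (intro nn_integral_add borel_measurable_times) auto
    then have "C1 (\<lambda>q. F q + G q) = (\<integral>\<^sup>+\<eta>. W \<eta> * J F \<eta> + W \<eta> * J G \<eta> \<partial>P)"
      unfolding C1_def by (intro nn_integral_cong) (simp add: distrib_left)
    also have "\<dots> = C1 F + C1 G" unfolding C1_def by (rule nn_integral_add) measurable
    finally show "C1 (\<lambda>q. F q + G q) = C1 F + C1 G" .
    show "C2 (\<lambda>q. F q + G q) = C2 F + C2 G"
      unfolding C2_def distrib_left by (rule nn_integral_add) measurable
  qed
  have C_cmult: "C1 (\<lambda>q. c * F q) = c * C1 F" "C2 (\<lambda>q. c * F q) = c * C2 F"
    if [measurable]: "F \<in> borel_measurable (borel \<Otimes>\<^sub>M K)" for F c
  proof -
    have "J (\<lambda>q. c * F q) \<eta> = c * J F \<eta>" if "\<eta> \<in> space P" for \<eta>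
      unfolding J_def mult.left_commute[of _ c]
      using gm[OF spP[OF that]] sm[OF _ that] \<open>F \<in> _\<close>
      by (intro nn_integral_cmult borel_measurable_times) auto
    then have "C1 (\<lambda>q. c * F q) = (\<integral>\<^sup>+\<eta>. c * (W \<eta> * J F \<eta>) \<partial>P)"
      unfolding C1_def by (intro nn_integral_cong) (simp add: mult.left_commute)
    also have "\<dots> = c * C1 F" unfolding C1_def by (rule nn_integral_cmult) measurable
    finally show "C1 (\<lambda>q. c * F q) = c * C1 F" .
    show "C2 (\<lambda>q. c * F q) = c * C2 F"
      unfolding C2_def mult.left_commute[of _ c] by (rule nn_integral_cmult) measurable
  qed
  have C_SUP: "C1 (\<lambda>q. SUP i. F i q) = (SUP i. C1 (F i))" "C2 (\<lambda>q. SUP i. F i q) = (SUP i. C2 (F i))"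
    if [measurable]: "\<And>i. F i \<in> borel_measurable (borel \<Otimes>\<^sub>M K)" and inc: "\<And>q. incseq (\<lambda>i. F i q)" for F :: "nat \<Rightarrow> _"
  proof -
    have F: "F i \<in> borel_measurable (borel \<Otimes>\<^sub>M K)" for i by fact
    have "J (\<lambda>q. SUP i. F i q) \<eta> = (SUP i. J (F i) \<eta>)" if "\<eta> \<in> space P" for \<eta>
      unfolding J_def SUP_mult_left_ennreal
      using gm[OF spP[OF that]] sm[OF F that] inc
      by (intro nn_integral_monotone_convergence_SUP borel_measurable_times)
        (auto simp: incseq_def le_fun_def intro!: mult_left_mono)
    then have "C1 (\<lambda>q. SUP i. F i q) = (\<integral>\<^sup>+\<eta>. (SUP i. W \<eta> * J (F i) \<eta>) \<partial>P)"
      unfolding C1_def by (intro nn_integral_cong) (simp add: SUP_mult_left_ennreal)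
    also have "\<dots> = (SUP i. C1 (F i))" unfolding C1_def
    proof (rule nn_integral_monotone_convergence_SUP)
      have "J (F i) \<eta> \<le> J (F j) \<eta>" if "i \<le> j" for i j \<eta>
        unfolding J_def using inc that by (auto simp: incseq_def intro!: nn_integral_mono mult_left_mono)
      then show "incseq (\<lambda>i \<eta>. W \<eta> * J (F i) \<eta>)" by (auto simp: incseq_def le_fun_def intro!: mult_left_mono)
    qed measurable
    finally show "C1 (\<lambda>q. SUP i. F i q) = (SUP i. C1 (F i))" .
    show "C2 (\<lambda>q. SUP i. F i q) = (SUP i. C2 (F i))"
      unfolding C2_def SUP_mult_left_ennreal
    proof (rule nn_integral_monotone_convergence_SUP)
      show "incseq (\<lambda>i p. w p * F i (T p))"
        using incseqD[OF inc] by (intro monoI le_funI mult_left_mono) auto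
    qed measurable
  qed
  have Q_SUP: "C1 (\<lambda>q. SUP i. F i q) = C2 (\<lambda>q. SUP i. F i q)"
    if "\<And>i. F i \<in> borel_measurable (borel \<Otimes>\<^sub>M K)" "\<And>q. incseq (\<lambda>i. F i q)" "\<And>i. C1 (F i) = C2 (F i)" for F :: "nat \<Rightarrow> _"
    using C_SUP[OF that(1,2)] that(3) by simp
  have Q_add: "C1 (\<lambda>q. F q + G q) = C2 (\<lambda>q. F q + G q)"
    if "F \<in> borel_measurable (borel \<Otimes>\<^sub>M K)" "G \<in> borel_measurable (borel \<Otimes>\<^sub>M K)" "C1 F = C2 F" "C1 G = C2 G" for F G
    using C_add[OF that(1,2)] that(3,4) by simp
  \<comment> \<open>For a test function times an event, both functionals are sides of the previous lemma.\<close>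
  have smooth: "C1 (\<lambda>q. ennreal (u (fst q)) * indicator D (snd q)) = C2 (\<lambda>q. ennreal (u (fst q)) * indicator D (snd q))"
    if u: "u \<in> Cc" "\<And>x. 0 \<le> u x \<and> u x \<le> 1" and D: "D \<in> sets K" for u D
  proof -
    have f: "(\<lambda>x. u x * g x) \<in> Cc_nonneg"
      using Cc_mult[of g u] u g by (auto simp: Cc_nonneg_def Cc_iff)
    have le: "u x * g x \<le> g x" for x using u(2)[of x] Cc_nonnegD(2)[OF g, of x] by (simp add: mult_left_le_one_le)
    have "C1 (\<lambda>q. ennreal (u (fst q)) * indicator D (snd q)) =
       (\<integral>\<^sup>+\<eta>. ennreal ((\<integral>x. u x * g x \<partial>\<eta>) * exp (- (\<integral>x. g x \<partial>\<eta>))) * indicator D \<eta> \<partial>P)"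
      unfolding C1_def
    proof (rule nn_integral_cong)
      fix \<eta> assume "\<eta> \<in> space P"
      then have \<eta>: "\<eta> \<in> space K" by (rule spP)
      have um: "(\<lambda>x. ennreal (u x * g x)) \<in> borel_measurable \<eta>"
        using Cc_borel_measurable[OF Cc_nonnegD(1)[OF f]] by (simp add: measurable_cong_sets[OF discrete_radon_spaceD(3)[OF \<eta>] refl])
      have "J (\<lambda>q. ennreal (u (fst q)) * indicator D (snd q)) \<eta> = (\<integral>\<^sup>+x. ennreal (u x * g x) * indicator D \<eta> \<partial>\<eta>)"
        unfolding J_def using u(2) Cc_nonnegD(2)[OF g] by (intro nn_integral_cong) (simp add: ennreal_mult mult_ac)
      also have "\<dots> = ennreal (\<integral>x. u x * g x \<partial>\<eta>) * indicator D \<eta>"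
        using um by (simp add: nn_integral_multc Cc_nonneg_nn_integral[OF discrete_radon_spaceD(2)[OF \<eta>] f])
      finally have j: "J (\<lambda>q. ennreal (u (fst q)) * indicator D (snd q)) \<eta> = ennreal (\<integral>x. u x * g x \<partial>\<eta>) * indicator D \<eta>" .
      show "W \<eta> * J (\<lambda>q. ennreal (u (fst q)) * indicator D (snd q)) \<eta> =
          ennreal ((\<integral>x. u x * g x \<partial>\<eta>) * exp (- (\<integral>x. g x \<partial>\<eta>))) * indicator D \<eta>"
        unfolding j W_def ennreal_mult''[OF exp_ge_zero] by (simp only: mult_ac)
    qed
    also have "\<dots> = (\<integral>\<^sup>+p. ennreal (snd (fst p) * (u (fst (fst p)) * g (fst (fst p))) * exp (- (\<integral>x. g x \<partial>add_atom (fst p) (snd p)))) *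
         indicator D (add_atom (fst p) (snd p)) \<partial>(m \<Otimes>\<^sub>M P))"
      by (rule mecke_damped_event[OF f g le D])
    also have "\<dots> = C2 (\<lambda>q. ennreal (u (fst q)) * indicator D (snd q))"
      unfolding C2_def
    proof (rule nn_integral_cong)
      fix p :: "('a \<times> real) \<times> 'a measure"
      have "ennreal (snd (fst p) * (u (fst (fst p)) * g (fst (fst p))) * exp (- (\<integral>x. g x \<partial>add_atom (fst p) (snd p)))) =
        ennreal (snd (fst p) * g (fst (fst p)) * exp (- (\<integral>x. g x \<partial>add_atom (fst p) (snd p))) * u (fst (fst p)))"
        by (simp add: mult_ac)
      also have "\<dots> = w p * ennreal (u (fst (fst p)))" unfolding w_def using u(2) by (intro ennreal_mult'') simp
      finally show "ennreal (snd (fst p) * (u (fst (fst p)) * g (fst (fst p))) * exp (- (\<integral>x. g x \<partial>add_atom (fst p) (snd p)))) *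
         indicator D (add_atom (fst p) (snd p)) = w p * (ennreal (u (fst (T p))) * indicator D (snd (T p)))"
        by (simp add: T_def mult.assoc)
    qed
    finally show ?thesis .
  qed
  define \<Omega> where "\<Omega> = (UNIV :: 'a set) \<times> space (K :: 'a measure measure)"
  have box: "C1 (indicator (A \<times> D)) = C2 (indicator (A \<times> D))" if A: "open A" "bounded A" and D[measurable]: "D \<in> sets K" for A D
  proof -
    obtain u :: "nat \<Rightarrow> 'a \<Rightarrow> real" where u: "\<And>k. u k \<in> Cc_nonneg" "\<And>k x. u k x \<le> 1"
      "\<And>x. incseq (\<lambda>k. u k x)" "\<And>x. (SUP k. ennreal (u k x)) = indicator A x"
      using bounded_open_approx[OF A] by blast
    have [measurable]: "u k \<in> borel_measurable borel" for k
      using u(1) Cc_borel_measurable by (auto simp: Cc_nonneg_def)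
    have eq: "indicator (A \<times> D) = (\<lambda>q. SUP k. ennreal (u k (fst q)) * indicator D (snd q))"
      by (auto simp: fun_eq_iff SUP_mult_right_ennreal[symmetric] u(4) indicator_times)
    have inc: "incseq (\<lambda>k. ennreal (u k (fst q)) * indicator D (snd q))" for q
      using u(3) by (auto simp: incseq_def intro!: mult_right_mono ennreal_leI)
    have Qk: "C1 (\<lambda>q. ennreal (u k (fst q)) * indicator D (snd q)) = C2 (\<lambda>q. ennreal (u k (fst q)) * indicator D (snd q))" for k
      using u by (intro smooth D) (auto simp: Cc_nonneg_def)
    show ?thesis unfolding eq by (rule Q_SUP[OF _ inc Qk]) measurable
  qed
  have total: "C1 (indicator \<Omega>) = C2 (indicator \<Omega>)"
  proof -
    have U: "\<Omega> = (\<Union>k. ball 0 (real k) \<times> space K)"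
      unfolding \<Omega>_def using reals_Archimedean2 by auto
    have eq: "indicator \<Omega> = (\<lambda>q. SUP k. indicator (ball 0 (real k) \<times> space K) q :: ennreal)"
      unfolding U by (rule ext, rule indicator_UN_SUP)
    have inc: "incseq (\<lambda>k. indicator (ball 0 (real k) \<times> space K) q :: ennreal)" for q :: "'a \<times> 'a measure"
      by (auto simp: incseq_def indicator_def mem_Times_iff)
    show ?thesis unfolding eq by (rule Q_SUP[OF _ inc]) (measurable, simp add: box)
  qed
  have fin: "C1 (indicator \<Omega>) < top"
  proof -
    have "C1 (indicator \<Omega>) \<le> (\<integral>\<^sup>+\<eta>. 1 \<partial>P)"
      unfolding C1_def
    proof (rule nn_integral_mono)
      fix \<eta> assume "\<eta> \<in> space P"
      then have \<eta>: "\<eta> \<in> space K" by (rule spP)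
      have "J (indicator \<Omega>) \<eta> = (\<integral>\<^sup>+x. ennreal (g x) \<partial>\<eta>)"
        unfolding J_def using \<eta> by (intro nn_integral_cong) (simp add: \<Omega>_def)
      also have "\<dots> = ennreal (\<integral>x. g x \<partial>\<eta>)" by (rule Cc_nonneg_nn_integral[OF discrete_radon_spaceD(2)[OF \<eta>] g])
      finally have j: "J (indicator \<Omega>) \<eta> = ennreal (\<integral>x. g x \<partial>\<eta>)" .
      have "W \<eta> * J (indicator \<Omega>) \<eta> = ennreal ((\<integral>x. g x \<partial>\<eta>) * exp (- (\<integral>x. g x \<partial>\<eta>)))"
        unfolding j W_def ennreal_mult''[OF exp_ge_zero] by (simp only: mult_ac)
      also have "\<dots> \<le> ennreal 1"
        using mult_exp_minus_le[OF Cc_nonneg_integral_nonneg[OF g, of \<eta>]] by (intro ennreal_leI) simp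
      finally show "W \<eta> * J (indicator \<Omega>) \<eta> \<le> 1" by simp
    qed
    then show ?thesis by (simp add: emeasure_space_1 le_less_trans)
  qed
  let ?G = "{a \<times> b |a b. a \<in> {S::'a set. open S \<and> bounded S} \<and> b \<in> sets (K :: 'a measure measure)}"
  have sK: "sets (K :: 'a measure measure) = sets (sigma (space K) (sets K))"
    by (simp add: sets.sigma_sets_eq sets.space_closed)
  have sb: "sets (borel :: 'a measure) = sets (sigma UNIV {S. open S \<and> bounded S})"
    by (simp add: sets_borel_bounded_open)
  have UNb: "(UNIV :: 'a set) = (\<Union>n. ball 0 (real n))" using reals_Archimedean2 by auto
  have gen: "sets (borel \<Otimes>\<^sub>M (K :: 'a measure measure)) = sigma_sets \<Omega> ?G"
  proof -
    have "sets (borel \<Otimes>\<^sub>M (K :: 'a measure measure)) =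
        sets (sigma UNIV {S :: 'a set. open S \<and> bounded S} \<Otimes>\<^sub>M sigma (space K) (sets (K :: 'a measure measure)))"
      using sb sK by (rule sets_pair_measure_cong)
    also have "sigma UNIV {S :: 'a set. open S \<and> bounded S} \<Otimes>\<^sub>M sigma (space K) (sets (K :: 'a measure measure)) = sigma \<Omega> ?G"
      unfolding \<Omega>_def
    proof (rule sigma_prod)
      show "\<exists>E\<subseteq>{S :: 'a set. open S \<and> bounded S}. countable E \<and> UNIV = \<Union> E"
        using UNb by (intro exI[of _ "range (\<lambda>n. ball 0 (real n))"]) auto
      show "\<exists>E\<subseteq>sets (K :: 'a measure measure). countable E \<and> space K = \<Union> E"
        by (intro exI[of _ "{space K}"]) auto
    qed (auto dest: sets.sets_into_space)
    also have "sets (sigma \<Omega> ?G) = sigma_sets \<Omega> ?G"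
      by (rule sets_measure_of) (auto simp: \<Omega>_def dest: sets.sets_into_space)
    finally show ?thesis .
  qed
  have sets: "C1 (indicator E) = C2 (indicator E)" if E: "E \<in> sets (borel \<Otimes>\<^sub>M K)" for E
  proof -
    have st: "Int_stable ?G" "?G \<subseteq> Pow \<Omega>"
    proof -
      show "Int_stable ?G"
      proof (rule Int_stableI)
        fix A B assume "A \<in> ?G" "B \<in> ?G"
        then obtain a b c d where "A = a \<times> b" "B = c \<times> d" "open a" "bounded a" "open c" "b \<in> sets K" "d \<in> sets K" by auto
        then show "A \<inter> B \<in> ?G"
        proof -
          have "A \<inter> B = (a \<inter> c) \<times> (b \<inter> d)" using \<open>A = _\<close> \<open>B = _\<close> by (simp add: Times_Int_Times)
          moreover have "open (a \<inter> c)" "bounded (a \<inter> c)" "b \<inter> d \<in> sets K"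
            using \<open>open a\<close> \<open>open c\<close> bounded_subset[OF \<open>bounded a\<close> Int_lower1] \<open>b \<in> sets K\<close> \<open>d \<in> sets K\<close> by auto
          ultimately show ?thesis by blast
        qed
      qed
      show "?G \<subseteq> Pow \<Omega>" by (auto simp: \<Omega>_def dest: sets.sets_into_space)
    qed
    have "E \<in> sigma_sets \<Omega> ?G" using E gen by simp
    with st show ?thesis
    proof (induction E rule: sigma_sets_induct_disjoint)
      case (basic E) then show ?case using box by auto
    next
      case empty
      show ?case by (simp add: C1_def C2_def J_def)
    next
      case (compl E)
      have E[measurable]: "E \<in> sets (borel \<Otimes>\<^sub>M K)" using compl(1) gen by simp
      have \<Omega>m: "\<Omega> \<in> sets (borel \<Otimes>\<^sub>M (K :: 'a measure measure))" unfolding \<Omega>_def by measurable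
      have "E \<subseteq> \<Omega>" using sets.sets_into_space[OF E] by (simp add: \<Omega>_def space_pair_measure)
      then have eq: "(indicator \<Omega> :: _ \<Rightarrow> ennreal) = (\<lambda>q. indicator (\<Omega> - E) q + indicator E q)"
        by (auto simp: fun_eq_iff indicator_def)
      have im: "indicator (\<Omega> - E) \<in> borel_measurable (borel \<Otimes>\<^sub>M K)" "indicator E \<in> borel_measurable (borel \<Otimes>\<^sub>M K)"
        using \<Omega>m E by auto
      have "C1 (indicator (\<Omega> - E)) + C1 (indicator E) = C2 (indicator (\<Omega> - E)) + C2 (indicator E)"
        using total unfolding eq C_add[OF im] .
      moreover have "C1 (indicator E) \<noteq> top"
      proof -
        have "C1 (indicator (\<Omega> - E)) + C1 (indicator E) < top"
          using fin unfolding eq C_add[OF im] .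
        then show ?thesis by auto
      qed
      ultimately have "C1 (indicator E) + C1 (indicator (\<Omega> - E)) = C1 (indicator E) + C2 (indicator (\<Omega> - E))" "C1 (indicator E) \<noteq> top"
        using compl(2) by (simp_all add: add.commute)
      then show ?case using ennreal_add_left_cancel[of "C1 (indicator E)"] by auto
    next
      case (union E)
      have E[measurable]: "E i \<in> sets (borel \<Otimes>\<^sub>M K)" for i using union(2) gen by auto
      have part: "C1 (indicator (\<Union>i<n. E i)) = C2 (indicator (\<Union>i<n. E i))" for n
      proof (induction n)
        case 0 show ?case by (simp add: C1_def C2_def J_def)
      next
        case (Suc n)
        have "E n \<inter> E i = {}" if "i < n" for i using union(1) that unfolding disjoint_family_on_def by auto
        then have dj: "q \<in> (\<Union>i<n. E i) \<Longrightarrow> q \<notin> E n" for q by blast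
        have "(\<Union>i<Suc n. E i) = E n \<union> (\<Union>i<n. E i)" by (simp add: lessThan_Suc)
        then have eq: "(indicator (\<Union>i<Suc n. E i) :: _ \<Rightarrow> ennreal) = (\<lambda>q. indicator (\<Union>i<n. E i) q + indicator (E n) q)"
          using dj by (simp only:) (auto simp: fun_eq_iff indicator_def)
        show ?case unfolding eq by (rule Q_add[OF _ _ Suc union(3)]) measurable
      qed
      have U: "(\<Union>i. E i) = (\<Union>n. \<Union>i<n. E i)" by auto
      have eq: "(indicator (\<Union>i. E i) :: _ \<Rightarrow> ennreal) = (\<lambda>q. SUP n. indicator (\<Union>i<n. E i) q)"
        by (subst U, rule ext, rule indicator_UN_SUP)
      have inc: "incseq (\<lambda>n. indicator (\<Union>i<n. E i) q :: ennreal)" for q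
        by (auto simp: incseq_def indicator_def intro: less_le_trans)
      show ?case unfolding eq by (rule Q_SUP[OF _ inc part]) measurable
    qed
  qed
  have "C1 F = C2 F"
    using F
  proof (induction rule: borel_measurable_induct)
    case (cong f g)
    have "J f \<eta> = J g \<eta>" if "\<eta> \<in> space P" for \<eta>
      unfolding J_def using cong(3) spP[OF that] by (intro nn_integral_cong) (simp add: space_pair_measure)
    then have "C1 f = C1 g" unfolding C1_def by (intro nn_integral_cong) simp
    moreover have "C2 f = C2 g" unfolding C2_def using cong(3) measurable_space[OF T]
      by (intro nn_integral_cong) simp
    ultimately show ?case using cong(4) by simp
  next
    case (set A) then show ?case by (rule sets)
  next
    case (mult u c) then show ?case by (simp add: C_cmult)
  next
    case (add u v) then show ?case by (intro Q_add)
  next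
    case (seq U)
    have inc: "incseq (\<lambda>i. U i q)" for q using seq.hyps(3) unfolding incseq_def le_fun_def by blast
    have "C1 (\<lambda>q. SUP i. U i q) = C2 (\<lambda>q. SUP i. U i q)"
      by (rule Q_SUP[OF seq.hyps(1) inc seq.IH])
    moreover have "(SUP i. U i) = (\<lambda>q. SUP i. U i q)" by (auto simp: fun_eq_iff image_comp)
    ultimately show ?case by simp
  qed
  then show ?thesis by (simp add: C1_def C2_def J_def W_def w_def T_def)
qed


text \<open>The damping factor is a positive function of \<open>\<eta>\<close> and can be divided out, provided that the weight \<open>g\<close> does not vanish.
A weight that is positive exactly on a ball gives the formula for atoms in that ball.\<close>

lemma mecke_ball:
  fixes F :: "'a \<times> 'a measure \<Rightarrow> ennreal"
  assumes F: "F \<in> borel_measurable (borel \<Otimes>\<^sub>M K)"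
  shows "(\<integral>\<^sup>+\<eta>. (\<integral>\<^sup>+x. F (x, \<eta>) * indicator (ball 0 (real n)) x \<partial>\<eta>) \<partial>P) =
    (\<integral>\<^sup>+p. ennreal (snd (fst p)) * F (fst (fst p), add_atom (fst p) (snd p)) * indicator (ball 0 (real n)) (fst (fst p)) \<partial>(m \<Otimes>\<^sub>M P))"
proof -
  define W where "W \<eta> = (\<integral>x. cutoff n x \<partial>\<eta>)" for \<eta> :: "'a measure"
  define F' where "F' q = F q * (indicator (ball 0 (real n)) (fst q) * ennreal (exp (W (snd q)) / cutoff n (fst q)))" for q :: "'a \<times> 'a measure"
  have c: "cutoff n \<in> Cc_nonneg" by (rule cutoff_Cc_nonneg)
  have [measurable]: "cutoff n \<in> borel_measurable (borel :: 'a measure)" using Cc_borel_measurable[OF Cc_nonnegD(1)[OF c]] .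
  have [measurable]: "W \<in> borel_measurable K" unfolding W_def by (rule integral_K_measurable[OF c])
  have F'm: "F' \<in> borel_measurable (borel \<Otimes>\<^sub>M K)" unfolding F'_def[abs_def] using F by measurable
  have pos: "cutoff n x > 0" if "x \<in> ball 0 (real n)" for x :: 'a using that by (simp add: cutoff_def)
  have "(\<integral>\<^sup>+\<eta>. ennreal (exp (- W \<eta>)) * (\<integral>\<^sup>+x. ennreal (cutoff n x) * F' (x, \<eta>) \<partial>\<eta>) \<partial>P) =
    (\<integral>\<^sup>+p. ennreal (snd (fst p) * cutoff n (fst (fst p)) * exp (- W (add_atom (fst p) (snd p)))) *
       F' (fst (fst p), add_atom (fst p) (snd p)) \<partial>(m \<Otimes>\<^sub>M P))"
    unfolding W_def by (rule mecke_damped[OF c F'm])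
  also have "(\<integral>\<^sup>+\<eta>. ennreal (exp (- W \<eta>)) * (\<integral>\<^sup>+x. ennreal (cutoff n x) * F' (x, \<eta>) \<partial>\<eta>) \<partial>P) =
    (\<integral>\<^sup>+\<eta>. (\<integral>\<^sup>+x. F (x, \<eta>) * indicator (ball 0 (real n)) x \<partial>\<eta>) \<partial>P)"
  proof (rule nn_integral_cong)
    fix \<eta> assume "\<eta> \<in> space P"
    then have \<eta>: "\<eta> \<in> space K" by (simp add: space_P)
    have cm: "(\<lambda>x. ennreal (cutoff n x)) \<in> borel_measurable \<eta>"
      by (simp add: measurable_cong_sets[OF discrete_radon_spaceD(3)[OF \<eta>] refl])
    have "ennreal (exp (- W \<eta>)) * (\<integral>\<^sup>+x. ennreal (cutoff n x) * F' (x, \<eta>) \<partial>\<eta>) =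
      (\<integral>\<^sup>+x. ennreal (exp (- W \<eta>)) * (ennreal (cutoff n x) * F' (x, \<eta>)) \<partial>\<eta>)"
    proof (rule nn_integral_cmult[symmetric])
      note cm[measurable] section_measurable(2)[OF F'm \<eta>, measurable]
      show "(\<lambda>x. ennreal (cutoff n x) * F' (x, \<eta>)) \<in> borel_measurable \<eta>" by measurable
    qed
    also have "\<dots> = (\<integral>\<^sup>+x. F (x, \<eta>) * indicator (ball 0 (real n)) x \<partial>\<eta>)"
    proof (rule nn_integral_cong)
      fix x
      show "ennreal (exp (- W \<eta>)) * (ennreal (cutoff n x) * F' (x, \<eta>)) = F (x, \<eta>) * indicator (ball 0 (real n)) x"
      proof (cases "x \<in> ball 0 (real n)")
        case True
        have "ennreal (exp (- W \<eta>)) * (ennreal (cutoff n x) * ennreal (exp (W \<eta>) / cutoff n x)) = ennreal 1"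
          using pos[OF True] by (simp add: ennreal_mult[symmetric] mult_exp_exp)
        moreover have "ennreal (exp (- W \<eta>)) * (ennreal (cutoff n x) * (F (x, \<eta>) * ennreal (exp (W \<eta>) / cutoff n x))) =
            F (x, \<eta>) * (ennreal (exp (- W \<eta>)) * (ennreal (cutoff n x) * ennreal (exp (W \<eta>) / cutoff n x)))"
          by (simp only: mult_ac)
        ultimately show ?thesis using True by (simp add: F'_def)
      qed (simp add: F'_def)
    qed
    finally show "ennreal (exp (- W \<eta>)) * (\<integral>\<^sup>+x. ennreal (cutoff n x) * F' (x, \<eta>) \<partial>\<eta>) =
      (\<integral>\<^sup>+x. F (x, \<eta>) * indicator (ball 0 (real n)) x \<partial>\<eta>)" .
  qed
  also have "(\<integral>\<^sup>+p. ennreal (snd (fst p) * cutoff n (fst (fst p)) * exp (- W (add_atom (fst p) (snd p)))) *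
       F' (fst (fst p), add_atom (fst p) (snd p)) \<partial>(m \<Otimes>\<^sub>M P)) =
     (\<integral>\<^sup>+p. ennreal (snd (fst p)) * F (fst (fst p), add_atom (fst p) (snd p)) * indicator (ball 0 (real n)) (fst (fst p)) \<partial>(m \<Otimes>\<^sub>M P))"
  proof (rule nn_integral_cong)
    fix p assume "p \<in> space (m \<Otimes>\<^sub>M P)"
    then have s: "snd (fst p) > 0" using mark_pos by (auto simp: space_pair_measure)
    define x where "x = fst (fst p)"
    define V where "V = W (add_atom (fst p) (snd p))"
    define f where "f = F (x, add_atom (fst p) (snd p))"
    have "ennreal (snd (fst p) * cutoff n x * exp (- V)) * (f * (indicator (ball 0 (real n)) x * ennreal (exp V / cutoff n x))) =
       ennreal (snd (fst p)) * f * indicator (ball 0 (real n)) x"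
    proof (cases "x \<in> ball 0 (real n)")
      case True
      have "ennreal (snd (fst p) * cutoff n x * exp (- V)) * ennreal (exp V / cutoff n x) = ennreal (snd (fst p))"
        using pos[OF True] s by (simp add: ennreal_mult[symmetric] mult_exp_exp)
      then show ?thesis using True by (simp add: mult_ac)
    qed simp
    then show "ennreal (snd (fst p) * cutoff n (fst (fst p)) * exp (- W (add_atom (fst p) (snd p)))) *
       F' (fst (fst p), add_atom (fst p) (snd p)) =
      ennreal (snd (fst p)) * F (fst (fst p), add_atom (fst p) (snd p)) * indicator (ball 0 (real n)) (fst (fst p))"
      by (simp add: F'_def x_def V_def f_def)
  qed
  finally show ?thesis .
qed

lemma SUP_ball_indicator: "(SUP n. c * indicator (ball 0 (real n)) x) = (c :: ennreal)" for x :: 'a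
proof -
  have "(\<Union>n. ball (0::'a) (real n)) = UNIV" using reals_Archimedean2 by auto
  then have "(SUP n. indicator (ball 0 (real n)) x) = (1::ennreal)"
    using indicator_UN_SUP[of "\<lambda>n. ball (0::'a) (real n)" x] by simp
  then show ?thesis by (simp add: SUP_mult_left_ennreal[symmetric])
qed

lemma incseq_ball_indicator: "incseq (\<lambda>n. c * indicator (ball 0 (real n)) x :: ennreal)" for x :: 'a
  by (auto simp: incseq_def indicator_def intro!: mult_left_mono)

text \<open>Choosing a point of the random measure according to its mass has the same effect as inserting a new
atom \<open>(x, s)\<close> chosen from the intensity with weight \<open>s\<close>.\<close>

theorem mecke:
  fixes F :: "'a \<times> 'a measure \<Rightarrow> ennreal"
  assumes F: "F \<in> borel_measurable (borel \<Otimes>\<^sub>M K)"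
  shows "(\<integral>\<^sup>+\<eta>. (\<integral>\<^sup>+x. F (x, \<eta>) \<partial>\<eta>) \<partial>P) =
    (\<integral>\<^sup>+p. ennreal (snd (fst p)) * F (fst (fst p), add_atom (fst p) (snd p)) \<partial>(m \<Otimes>\<^sub>M P))"
proof -
  have Fn: "(\<lambda>q. F q * indicator (ball 0 (real n)) (fst q)) \<in> borel_measurable (borel \<Otimes>\<^sub>M K)" for n
    using F by measurable
  have [measurable]: "(\<lambda>\<eta>. \<integral>\<^sup>+x. F (x, \<eta>) * indicator (ball 0 (real n)) x \<partial>\<eta>) \<in> borel_measurable P" for n
    using inner_integral_measurable[OF Fn[of n]] by (simp add: measurable_cong_sets[OF sets_P refl])
  have [measurable]: "(\<lambda>p. F (fst (fst p), add_atom (fst p) (snd p))) \<in> borel_measurable (m \<Otimes>\<^sub>M P)"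
    by (rule measurable_compose[OF shift_measurable F])
  have "(\<integral>\<^sup>+\<eta>. (\<integral>\<^sup>+x. F (x, \<eta>) \<partial>\<eta>) \<partial>P) = (\<integral>\<^sup>+\<eta>. (SUP n. \<integral>\<^sup>+x. F (x, \<eta>) * indicator (ball 0 (real n)) x \<partial>\<eta>) \<partial>P)"
  proof (rule nn_integral_cong)
    fix \<eta> assume "\<eta> \<in> space P"
    then have \<eta>: "\<eta> \<in> space K" by (simp add: space_P)
    have "(\<integral>\<^sup>+x. F (x, \<eta>) \<partial>\<eta>) = (\<integral>\<^sup>+x. (SUP n. F (x, \<eta>) * indicator (ball 0 (real n)) x) \<partial>\<eta>)"
      by (simp only: SUP_ball_indicator)
    also have "\<dots> = (SUP n. \<integral>\<^sup>+x. F (x, \<eta>) * indicator (ball 0 (real n)) x \<partial>\<eta>)"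
    proof (rule nn_integral_monotone_convergence_SUP)
      show "incseq (\<lambda>n x. F (x, \<eta>) * indicator (ball 0 (real n)) x)"
        by (intro monoI le_funI incseqD[OF incseq_ball_indicator])
      show "(\<lambda>x. F (x, \<eta>) * indicator (ball 0 (real n)) x) \<in> borel_measurable \<eta>" for n
        using section_measurable(2)[OF Fn[of n] \<eta>] by simp
    qed
    finally show "(\<integral>\<^sup>+x. F (x, \<eta>) \<partial>\<eta>) = (SUP n. \<integral>\<^sup>+x. F (x, \<eta>) * indicator (ball 0 (real n)) x \<partial>\<eta>)" .
  qed
  also have "\<dots> = (SUP n. \<integral>\<^sup>+\<eta>. (\<integral>\<^sup>+x. F (x, \<eta>) * indicator (ball 0 (real n)) x \<partial>\<eta>) \<partial>P)"
    by (intro nn_integral_monotone_convergence_SUP monoI le_funI nn_integral_mono incseqD[OF incseq_ball_indicator]) measurable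
  also have "\<dots> = (SUP n. \<integral>\<^sup>+p. ennreal (snd (fst p)) * F (fst (fst p), add_atom (fst p) (snd p)) * indicator (ball 0 (real n)) (fst (fst p)) \<partial>(m \<Otimes>\<^sub>M P))"
    by (simp only: mecke_ball[OF F])
  also have "\<dots> = (\<integral>\<^sup>+p. (SUP n. ennreal (snd (fst p)) * F (fst (fst p), add_atom (fst p) (snd p)) * indicator (ball 0 (real n)) (fst (fst p))) \<partial>(m \<Otimes>\<^sub>M P))"
    by (intro nn_integral_monotone_convergence_SUP[symmetric] monoI le_funI nn_integral_mono incseqD[OF incseq_ball_indicator]) measurable
  also have "\<dots> = (\<integral>\<^sup>+p. ennreal (snd (fst p)) * F (fst (fst p), add_atom (fst p) (snd p)) \<partial>(m \<Otimes>\<^sub>M P))"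
    by (simp only: SUP_ball_indicator)
  finally show ?thesis .
qed

text \<open>By the Mecke formula the expected mass at \<open>x\<close> is the integral of \<open>s\<close> over the fibre above \<open>x\<close>, which is a null set.\<close>

lemma no_fixed_atom: "AE \<eta> in P. measure \<eta> {x} = 0"
proof -
  have F: "(\<lambda>q. indicator {x} (fst q)) \<in> borel_measurable (borel \<Otimes>\<^sub>M (K :: 'a measure measure))" by measurable
  have m0: "AE z in m. fst z \<noteq> x"
  proof (rule AE_I')
    show "{x} \<times> {0<..} \<in> null_sets m"
    proof (rule null_setsI[OF null_fibres])
      have "{z \<in> space m. fst z = x} \<in> sets m"
        using measurable_sets[OF m_measurable(1), of "{x}"] by (simp add: vimage_def Int_def conj_commute)
      moreover have "{z \<in> space m. fst z = x} = {x} \<times> {0<..}" by (auto simp: space_m)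
      ultimately show "{x} \<times> {0<..} \<in> sets m" by simp
    qed
    show "{z \<in> space m. \<not> fst z \<noteq> x} \<subseteq> {x} \<times> {0<..}" by (auto simp: space_m)
  qed
  have "(\<integral>\<^sup>+\<eta>. emeasure \<eta> {x} \<partial>P) = (\<integral>\<^sup>+\<eta>. (\<integral>\<^sup>+y. indicator {x} y \<partial>\<eta>) \<partial>P)"
    by (intro nn_integral_cong nn_integral_indicator[symmetric]) (simp add: space_P discrete_radon_spaceD(3))
  also have "\<dots> = (\<integral>\<^sup>+p. ennreal (snd (fst p)) * indicator {x} (fst (fst p)) \<partial>(m \<Otimes>\<^sub>M P))"
    using mecke[OF F] by simp
  also have "\<dots> = (\<integral>\<^sup>+z. \<integral>\<^sup>+\<eta>. ennreal (snd z) * indicator {x} (fst z) \<partial>P \<partial>m)"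
    by (subst nn_integral_fst[symmetric]) (auto intro!: borel_measurable_times measurable_compose[OF measurable_fst] simp: borel_measurable_indicator)
  also have "\<dots> = (\<integral>\<^sup>+z. 0 \<partial>m)"
  proof (rule nn_integral_cong_AE)
    show "AE z in m. (\<integral>\<^sup>+\<eta>. ennreal (snd z) * indicator {x} (fst z) \<partial>P) = 0"
      using m0 by eventually_elim simp
  qed
  finally have e0: "(\<integral>\<^sup>+\<eta>. emeasure \<eta> {x} \<partial>P) = 0" by simp
  have "(\<lambda>\<eta>. emeasure \<eta> {x}) \<in> borel_measurable K"
    using measurable_compose[OF measurable_Pair1'[of x borel K] emeasure_atom_measurable] by simp
  then have em: "(\<lambda>\<eta>. emeasure \<eta> {x}) \<in> borel_measurable P" by (simp add: measurable_cong_sets[OF sets_P refl])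
  from e0 have "AE \<eta> in P. emeasure \<eta> {x} = 0" using nn_integral_0_iff_AE[OF em] by simp
  then show ?thesis by eventually_elim (simp add: measure_def)
qed

lemma AE_new_atom: "AE p in m \<Otimes>\<^sub>M P. measure (snd p) {fst (fst p)} = 0"
proof (rule mP.AE_pair_measure)
  have "(\<lambda>p. (fst (fst p), snd p)) \<in> measurable (m \<Otimes>\<^sub>M P) (borel \<Otimes>\<^sub>M K)"
  proof (rule measurable_Pair)
    show "(\<lambda>p. fst (fst p)) \<in> measurable (m \<Otimes>\<^sub>M P) borel"
      by (rule measurable_compose[OF measurable_fst m_measurable(1)])
    show "snd \<in> measurable (m \<Otimes>\<^sub>M P) K"
      using measurable_snd[of m P] by (simp add: measurable_cong_sets[OF refl sets_P])
  qed
  from measurable_compose[OF this measure_atom_measurable]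
  have [measurable]: "(\<lambda>p. measure (snd p) {fst (fst p)}) \<in> borel_measurable (m \<Otimes>\<^sub>M P)" by simp
  show "{p \<in> space (m \<Otimes>\<^sub>M P). measure (snd p) {fst (fst p)} = 0} \<in> sets (m \<Otimes>\<^sub>M P)"
    by (rule borel_measurable_eq) measurable
  show "AE z in m. AE \<eta> in P. measure (snd (z, \<eta>)) {fst (fst (z, \<eta>))} = 0"
    unfolding fst_conv snd_conv by (rule AE_I2, rule no_fixed_atom)
qed

text \<open>The bias by the mass is removed by dividing by the mass of the atom. After insertion of \<open>(x, s)\<close> this mass is
exactly \<open>s\<close>, since \<open>x\<close> is almost surely not an atom before.\<close>

theorem mecke_atoms:
  assumes k: "k \<in> borel_measurable half_space" and G: "G \<in> borel_measurable K"
  shows "(\<integral>\<^sup>+\<eta>. atom_sum k \<eta> * G \<eta> \<partial>P) = (\<integral>\<^sup>+p. k (fst p) * G (add_atom (fst p) (snd p)) \<partial>(m \<Otimes>\<^sub>M P))"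
proof -
  define F where "F q = k (mark q) / emeasure (snd q) {fst q} * G (snd q)" for q :: "'a \<times> 'a measure"
  have [measurable]: "(\<lambda>q. k (mark q)) \<in> borel_measurable (borel \<Otimes>\<^sub>M K)" by (rule measurable_compose[OF mark_measurable k])
  have [measurable]: "(\<lambda>q. G (snd q)) \<in> borel_measurable (borel \<Otimes>\<^sub>M K)" by (rule measurable_compose[OF measurable_snd G])
  have F: "F \<in> borel_measurable (borel \<Otimes>\<^sub>M K)" unfolding F_def[abs_def] by measurable
  have Q: "(\<lambda>q. k (mark q) / emeasure (snd q) {fst q}) \<in> borel_measurable (borel \<Otimes>\<^sub>M K)" by measurable
  have "(\<integral>\<^sup>+\<eta>. atom_sum k \<eta> * G \<eta> \<partial>P) = (\<integral>\<^sup>+\<eta>. (\<integral>\<^sup>+x. F (x, \<eta>) \<partial>\<eta>) \<partial>P)"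
  proof (rule nn_integral_cong)
    fix \<eta> assume "\<eta> \<in> space P"
    then have \<eta>: "\<eta> \<in> space K" by (simp add: space_P)
    have "(\<integral>\<^sup>+x. F (x, \<eta>) \<partial>\<eta>) = (\<integral>\<^sup>+x. k (mark (x, \<eta>)) / emeasure \<eta> {x} \<partial>\<eta>) * G \<eta>"
      unfolding F_def using section_measurable(2)[OF Q \<eta>] by (simp add: nn_integral_multc)
    then show "atom_sum k \<eta> * G \<eta> = (\<integral>\<^sup>+x. F (x, \<eta>) \<partial>\<eta>)" by (simp add: atom_sum_eq_integral[OF \<eta> k])
  qed
  also have "\<dots> = (\<integral>\<^sup>+p. ennreal (snd (fst p)) * F (fst (fst p), add_atom (fst p) (snd p)) \<partial>(m \<Otimes>\<^sub>M P))"
    by (rule mecke[OF F])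
  also have "\<dots> = (\<integral>\<^sup>+p. k (fst p) * G (add_atom (fst p) (snd p)) \<partial>(m \<Otimes>\<^sub>M P))"
  proof (rule nn_integral_cong_AE)
    show "AE p in m \<Otimes>\<^sub>M P. ennreal (snd (fst p)) * F (fst (fst p), add_atom (fst p) (snd p)) = k (fst p) * G (add_atom (fst p) (snd p))"
      using AE_new_atom AE_space
    proof eventually_elim
      fix p assume a: "measure (snd p) {fst (fst p)} = 0" and p: "p \<in> space (m \<Otimes>\<^sub>M P)"
      have s: "snd (fst p) > 0" and \<eta>: "snd p \<in> space K" using p mark_pos by (auto simp: space_pair_measure space_P)
      have ms: "measure (add_atom (fst p) (snd p)) {fst (fst p)} = snd (fst p)"
        using measure_add_atom[OF \<eta> s] a by simp
      then have "emeasure (add_atom (fst p) (snd p)) {fst (fst p)} = ennreal (snd (fst p))"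
        using emeasure_atom(1)[OF add_atom_in_K[OF \<eta> s]] by simp
      moreover have "mark (fst (fst p), add_atom (fst p) (snd p)) = fst p" using ms s by (simp add: mark_def)
      ultimately have "F (fst (fst p), add_atom (fst p) (snd p)) = k (fst p) / ennreal (snd (fst p)) * G (add_atom (fst p) (snd p))"
        by (simp add: F_def)
      moreover have "ennreal (snd (fst p)) * (k (fst p) / ennreal (snd (fst p))) = k (fst p)"
        using s by (simp add: ennreal_times_divide ennreal_mult_divide_eq mult.commute[of "ennreal _"])
      ultimately show "ennreal (snd (fst p)) * F (fst (fst p), add_atom (fst p) (snd p)) = k (fst p) * G (add_atom (fst p) (snd p))"
        by (simp add: mult.assoc[symmetric])
    qed
  qed
  finally show ?thesis .
qed

end

section \<open>The exponential formula\<close>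

definition marked_atoms :: "('a::euclidean_space \<times> real) set \<Rightarrow> 'a measure \<Rightarrow> 'a set" where
  "marked_atoms B \<eta> = {x. 0 < measure \<eta> {x} \<and> (x, measure \<eta> {x}) \<in> B}"

text \<open>This plays the role of the exponential of the sum of \<open>ln w\<close> over the atoms with mark in \<open>B\<close>; as a product it is
multiplicative in \<open>w\<close> without side conditions. With infinitely many such atoms the product is \<open>1\<close> by convention, an event
of probability zero if \<open>B\<close> has finite intensity.\<close>

definition atom_prod :: "('a::euclidean_space \<times> real) set \<Rightarrow> ('a \<times> real \<Rightarrow> real) \<Rightarrow> 'a measure \<Rightarrow> real" where
  "atom_prod B w \<eta> = (\<Prod>x\<in>marked_atoms B \<eta>. w (x, measure \<eta> {x}))"

lemma marked_atoms_subset: "\<eta> \<in> space K \<Longrightarrow> marked_atoms B \<eta> \<subseteq> atoms \<eta>"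
  using emeasure_atom(2) by (auto simp: marked_atoms_def)

lemma atom_sum_indicator:
  assumes \<eta>: "\<eta> \<in> space K"
  shows "atom_sum (indicator B) \<eta> = (if finite (marked_atoms B \<eta>) then of_nat (card (marked_atoms B \<eta>)) else \<infinity>)"
proof -
  have "atom_sum (indicator B) \<eta> = (\<integral>\<^sup>+x. indicator (marked_atoms B \<eta>) x \<partial>count_space (atoms \<eta>))"
    unfolding atom_sum_def using emeasure_atom(2)[OF \<eta>]
    by (intro nn_integral_cong) (auto simp: marked_atoms_def indicator_def)
  also have "\<dots> = emeasure (count_space (atoms \<eta>)) (marked_atoms B \<eta>)"
    using marked_atoms_subset[OF \<eta>] by (intro nn_integral_indicator) simp
  finally show ?thesis using marked_atoms_subset[OF \<eta>] by (simp add: emeasure_count_space)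
qed

lemma atom_sum_finite:
  assumes \<eta>: "\<eta> \<in> space K" and fin: "finite (marked_atoms B \<eta>)" and k: "\<And>z. z \<notin> B \<Longrightarrow> k z = 0"
  shows "atom_sum k \<eta> = (\<Sum>x\<in>marked_atoms B \<eta>. k (x, measure \<eta> {x}))"
  unfolding atom_sum_def
proof (rule nn_integral_count_space'[OF fin _ marked_atoms_subset[OF \<eta>]])
  fix x assume "x \<in> atoms \<eta>" "x \<notin> marked_atoms B \<eta>"
  then show "k (x, measure \<eta> {x}) = 0"
    using k emeasure_atom(2)[OF \<eta>, of x] by (auto simp: marked_atoms_def)
qed

text \<open>The sums over atoms on the right are measurable in \<open>\<eta>\<close>, which transfers to the product on the left.\<close>

lemma atom_prod_eq_exp:
  assumes \<eta>: "\<eta> \<in> space K" and w: "\<And>z. w z > 0"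
  shows "atom_prod B w \<eta> = (if atom_sum (indicator B) \<eta> = \<infinity> then 1 else
    exp (enn2real (atom_sum (\<lambda>z. ennreal (ln (w z)) * indicator B z) \<eta>) - enn2real (atom_sum (\<lambda>z. ennreal (- ln (w z)) * indicator B z) \<eta>)))"
proof (cases "finite (marked_atoms B \<eta>)")
  case True
  have s: "enn2real (atom_sum (\<lambda>z. ennreal (h z) * indicator B z) \<eta>) = (\<Sum>x\<in>marked_atoms B \<eta>. max 0 (h (x, measure \<eta> {x})))" for h
  proof -
    have "atom_sum (\<lambda>z. ennreal (h z) * indicator B z) \<eta> = (\<Sum>x\<in>marked_atoms B \<eta>. ennreal (h (x, measure \<eta> {x})) * indicator B (x, measure \<eta> {x}))"
      by (rule atom_sum_finite[OF \<eta> True]) simp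
    also have "\<dots> = (\<Sum>x\<in>marked_atoms B \<eta>. ennreal (max 0 (h (x, measure \<eta> {x}))))"
      by (intro sum.cong refl) (auto simp: marked_atoms_def max_def ennreal_neg)
    also have "\<dots> = ennreal (\<Sum>x\<in>marked_atoms B \<eta>. max 0 (h (x, measure \<eta> {x})))" by (rule sum_ennreal) simp
    finally show ?thesis by (simp add: sum_nonneg)
  qed
  have "exp (\<Sum>x\<in>marked_atoms B \<eta>. max 0 (ln (w (x, measure \<eta> {x}))) - max 0 (- ln (w (x, measure \<eta> {x})))) =
    (\<Prod>x\<in>marked_atoms B \<eta>. exp (ln (w (x, measure \<eta> {x}))))"
    using True by (subst exp_sum) (auto intro!: prod.cong simp: max_def)
  also have "\<dots> = atom_prod B w \<eta>" unfolding atom_prod_def using w by (intro prod.cong refl) simp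
  finally show ?thesis using True by (simp add: s[of "\<lambda>z. ln (w z)"] s[of "\<lambda>z. - ln (w z)"] atom_sum_indicator[OF \<eta>] sum_subtractf)
next
  case False
  then show ?thesis by (simp add: atom_sum_indicator[OF \<eta>] atom_prod_def)
qed

lemma atom_prod_measurable:
  assumes w[measurable]: "w \<in> borel_measurable half_space" and B[measurable]: "B \<in> sets half_space" and pos: "\<And>z. w z > 0"
  shows "atom_prod B w \<in> borel_measurable K"
proof -
  have [measurable]: "atom_sum (indicator B) \<in> borel_measurable K" by (rule atom_sum_measurable) measurable
  have [measurable]: "atom_sum (\<lambda>z. ennreal (ln (w z)) * indicator B z) \<in> borel_measurable K" by (rule atom_sum_measurable) measurable
  have [measurable]: "atom_sum (\<lambda>z. ennreal (- ln (w z)) * indicator B z) \<in> borel_measurable K" by (rule atom_sum_measurable) measurable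
  have "(\<lambda>\<eta>. if atom_sum (indicator B) \<eta> = \<infinity> then 1 else
    exp (enn2real (atom_sum (\<lambda>z. ennreal (ln (w z)) * indicator B z) \<eta>) - enn2real (atom_sum (\<lambda>z. ennreal (- ln (w z)) * indicator B z) \<eta>)))
    \<in> borel_measurable K" by measurable
  then show ?thesis
    by (rule measurable_cong[THEN iffD2, rotated]) (rule atom_prod_eq_exp[OF _ pos])
qed

lemma atom_prod_pos: "(\<And>z. w z > 0) \<Longrightarrow> atom_prod B w \<eta> > 0"
  by (simp add: atom_prod_def prod_pos)

lemma marked_atoms_add:
  assumes \<eta>: "\<eta> \<in> space K" and z: "snd z > 0" "z \<in> B" "measure \<eta> {fst z} = 0"
  shows "marked_atoms B (add_atom z \<eta>) = insert (fst z) (marked_atoms B \<eta>)" "fst z \<notin> marked_atoms B \<eta>"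
    "finite (marked_atoms B \<eta>) \<Longrightarrow> atom_prod B w (add_atom z \<eta>) = w z * atom_prod B w \<eta>"
proof -
  have m: "measure (add_atom z \<eta>) {y} = (if y = fst z then snd z else measure \<eta> {y})" for y
    using measure_add_atom[OF \<eta> z(1), of y] z(3) by auto
  show 1: "marked_atoms B (add_atom z \<eta>) = insert (fst z) (marked_atoms B \<eta>)"
    using z by (auto simp: marked_atoms_def m)
  show 2: "fst z \<notin> marked_atoms B \<eta>" using z by (simp add: marked_atoms_def)
  assume "finite (marked_atoms B \<eta>)"
  then have "atom_prod B w (add_atom z \<eta>) = w (fst z, snd z) * (\<Prod>x\<in>marked_atoms B \<eta>. w (x, measure (add_atom z \<eta>) {x}))"
    unfolding atom_prod_def 1 using 2 by (simp add: m)
  also have "(\<Prod>x\<in>marked_atoms B \<eta>. w (x, measure (add_atom z \<eta>) {x})) = atom_prod B w \<eta>"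
    unfolding atom_prod_def using 2 by (intro prod.cong refl) (auto simp: m)
  finally show "atom_prod B w (add_atom z \<eta>) = w z * atom_prod B w \<eta>" by simp
qed

context crm
begin

lemma atom_sum_indicator_measurable:
  assumes "B \<in> sets m"
  shows "atom_sum (indicator B) \<in> borel_measurable P"
proof -
  have "indicator B \<in> borel_measurable half_space" using assms sets_m by (intro borel_measurable_indicator) simp
  from atom_sum_measurable[OF this] show ?thesis by (simp add: measurable_cong_sets[OF sets_P refl])
qed

lemma expectation_atom_count:
  assumes B: "B \<in> sets m"
  shows "(\<integral>\<^sup>+\<eta>. atom_sum (indicator B) \<eta> \<partial>P) = emeasure m B"
proof -
  have i: "indicator B \<in> borel_measurable half_space" using B sets_m by (intro borel_measurable_indicator) simp
  have "(\<integral>\<^sup>+\<eta>. atom_sum (indicator B) \<eta> \<partial>P) = (\<integral>\<^sup>+p. indicator B (fst p) \<partial>(m \<Otimes>\<^sub>M P))"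
    using mecke_atoms[OF i, of "\<lambda>_. 1"] by simp
  also have "\<dots> = (\<integral>\<^sup>+z. \<integral>\<^sup>+\<eta>. indicator B z \<partial>P \<partial>m)"
    by (subst nn_integral_fst[symmetric]) (use B in auto)
  also have "\<dots> = emeasure m B" using B by (simp add: emeasure_space_1)
  finally show ?thesis .
qed

lemma AE_finite_marked:
  assumes B: "B \<in> sets m" and fin: "emeasure m B < \<infinity>"
  shows "AE \<eta> in P. finite (marked_atoms B \<eta>)"
proof -
  have "AE \<eta> in P. atom_sum (indicator B) \<eta> \<noteq> \<infinity>"
    using fin expectation_atom_count[OF B] by (intro nn_integral_PInf_AE[OF atom_sum_indicator_measurable[OF B]]) simp
  then show ?thesis
    using AE_space
  proof eventually_elim
    fix \<eta> assume a: "atom_sum (indicator B) \<eta> \<noteq> \<infinity>" and "\<eta> \<in> space P"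
    then have "\<eta> \<in> space K" by (simp add: space_P)
    then show "finite (marked_atoms B \<eta>)" using a by (auto simp: atom_sum_indicator split: if_splits)
  qed
qed

text \<open>Let \<open>e j\<close> be the contribution of the configurations with exactly \<open>j\<close> atoms in \<open>B\<close>. Counting the atoms and removing
one of them by the Mecke formula gives \<open>(j + 1) e (j + 1) = a e j\<close>, the recursion of the Poisson weights \<open>a ^ j / j!\<close>.
The start \<open>e 0\<close> does not involve \<open>w\<close>.\<close>

lemma exponential_formula_aux:
  assumes B: "B \<in> sets m" and fin: "emeasure m B < \<infinity>"
    and w: "w \<in> borel_measurable m" "\<And>z. w z > 0" and f: "f \<in> Cc_nonneg"
    and a: "(\<integral>\<^sup>+z. indicator B z * ennreal (w z * exp (- (snd z * f (fst z)))) \<partial>m) = ennreal a" "a \<ge> 0"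
  shows "(\<integral>\<^sup>+\<eta>. ennreal (atom_prod B w \<eta> * exp (- (\<integral>x. f x \<partial>\<eta>))) \<partial>P) =
    ennreal (exp a) * (\<integral>\<^sup>+\<eta>. indicator {\<eta>. atom_sum (indicator B) \<eta> = 0} \<eta> * ennreal (exp (- (\<integral>x. f x \<partial>\<eta>))) \<partial>P)"
proof -
  define N where "N = (atom_sum (indicator B) :: 'a measure \<Rightarrow> ennreal)"
  define V where "V \<eta> = ennreal (atom_prod B w \<eta> * exp (- (\<integral>x. f x \<partial>\<eta>)))" for \<eta>
  define G where "G j \<eta> = indicator {\<eta>. N \<eta> = of_nat j} \<eta> * V \<eta>" for j \<eta>
  define e where "e j = (\<integral>\<^sup>+\<eta>. G j \<eta> \<partial>P)" for j
  have Bh: "B \<in> sets half_space" using B sets_m by simp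
  have i: "indicator B \<in> borel_measurable half_space" using Bh by (rule borel_measurable_indicator)
  have wh: "w \<in> borel_measurable half_space" using w(1) by (simp add: measurable_cong_sets[OF sets_m refl])
  have NK[measurable]: "N \<in> borel_measurable K" unfolding N_def by (rule atom_sum_measurable[OF i])
  have VK[measurable]: "V \<in> borel_measurable K"
    unfolding V_def[abs_def] using atom_prod_measurable[OF wh Bh w(2)] integral_K_measurable[OF f] by measurable
  have GK[measurable]: "G j \<in> borel_measurable K" for j unfolding G_def[abs_def] by measurable
  have [measurable]: "N \<in> borel_measurable P" "V \<in> borel_measurable P" "G j \<in> borel_measurable P" for j
    using NK VK GK by (simp_all add: measurable_cong_sets[OF sets_P refl])
  have [measurable]: "f \<in> borel_measurable borel" using f Cc_borel_measurable by (auto simp: Cc_nonneg_def)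
  note w(1)[measurable] B[measurable]
  \<comment> \<open>Multiplying by the number of atoms sums over the atoms; each of them is then removed.\<close>
  have rec: "of_nat (Suc j) * e (Suc j) = ennreal a * e j" for j
  proof -
    have "of_nat (Suc j) * e (Suc j) = (\<integral>\<^sup>+\<eta>. of_nat (Suc j) * G (Suc j) \<eta> \<partial>P)"
      unfolding e_def by (rule nn_integral_cmult[symmetric]) measurable
    also have "\<dots> = (\<integral>\<^sup>+\<eta>. N \<eta> * G (Suc j) \<eta> \<partial>P)"
      by (intro nn_integral_cong) (simp add: G_def indicator_def)
    also have "\<dots> = (\<integral>\<^sup>+p. indicator B (fst p) * G (Suc j) (add_atom (fst p) (snd p)) \<partial>(m \<Otimes>\<^sub>M P))"
      unfolding N_def by (rule mecke_atoms[OF i GK])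
    also have "\<dots> = (\<integral>\<^sup>+p. indicator B (fst p) * ennreal (w (fst p) * exp (- (snd (fst p) * f (fst (fst p))))) * G j (snd p) \<partial>(m \<Otimes>\<^sub>M P))"
    proof (rule nn_integral_cong_AE)
      show "AE p in m \<Otimes>\<^sub>M P. indicator B (fst p) * G (Suc j) (add_atom (fst p) (snd p)) =
          indicator B (fst p) * ennreal (w (fst p) * exp (- (snd (fst p) * f (fst (fst p))))) * G j (snd p)"
        using AE_new_atom AE_space
      proof eventually_elim
        fix p assume n: "measure (snd p) {fst (fst p)} = 0" and p: "p \<in> space (m \<Otimes>\<^sub>M P)"
        obtain z \<eta> where pz: "p = (z, \<eta>)" by (cases p)
        have s: "snd z > 0" and \<eta>: "\<eta> \<in> space K" using p mark_pos by (auto simp: space_pair_measure space_P pz)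
        have \<eta>': "add_atom z \<eta> \<in> space K" by (rule add_atom_in_K[OF \<eta> s])
        show "indicator B (fst p) * G (Suc j) (add_atom (fst p) (snd p)) =
          indicator B (fst p) * ennreal (w (fst p) * exp (- (snd (fst p) * f (fst (fst p))))) * G j (snd p)"
        proof (cases "z \<in> B")
          case True
          have n': "measure \<eta> {fst z} = 0" using n pz by simp
          note M = marked_atoms_add[OF \<eta> s True n']
          have N: "N (add_atom z \<eta>) = of_nat (Suc j) \<longleftrightarrow> N \<eta> = of_nat j"
            unfolding N_def atom_sum_indicator[OF \<eta>] atom_sum_indicator[OF \<eta>'] M(1) using M(2)
            by (auto simp: of_nat_eq_iff simp del: of_nat_Suc)
          show ?thesis
          proof (cases "N \<eta> = of_nat j")
            case Nj: True
            then have "finite (marked_atoms B \<eta>)" unfolding N_def atom_sum_indicator[OF \<eta>] by (auto split: if_splits)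
            from M(3)[OF this, of w] have "V (add_atom z \<eta>) = ennreal ((w z * exp (- (snd z * f (fst z)))) * (atom_prod B w \<eta> * exp (- (\<integral>x. f x \<partial>\<eta>))))"
              unfolding V_def integral_add_atom[OF \<eta> s f] by (simp add: exp_add exp_diff exp_minus field_simps)
            also have "\<dots> = ennreal (w z * exp (- (snd z * f (fst z)))) * V \<eta>"
              unfolding V_def using w(2)[of z] by (intro ennreal_mult') simp
            finally show ?thesis using Nj N True by (simp add: G_def pz)
          qed (use N True in \<open>simp add: G_def pz\<close>)
        qed (simp add: pz)
      qed
    qed
    also have "\<dots> = (\<integral>\<^sup>+z. \<integral>\<^sup>+\<eta>. indicator B z * ennreal (w z * exp (- (snd z * f (fst z)))) * G j \<eta> \<partial>P \<partial>m)"
    proof -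
      have "(\<lambda>p. indicator B (fst p) * ennreal (w (fst p) * exp (- (snd (fst p) * f (fst (fst p))))) * G j (snd p)) \<in> borel_measurable (m \<Otimes>\<^sub>M P)"
        using B w(1) by measurable
      from nn_integral_fst[OF this, symmetric] show ?thesis by simp
    qed
    also have "\<dots> = ennreal a * e j"
    proof -
      have "(\<integral>\<^sup>+\<eta>. c * G j \<eta> \<partial>P) = c * e j" for c unfolding e_def by (rule nn_integral_cmult) measurable
      moreover have "(\<integral>\<^sup>+z. indicator B z * ennreal (w z * exp (- (snd z * f (fst z)))) * e j \<partial>m) = ennreal a * e j"
      proof -
        have "(\<lambda>z. indicator B z * ennreal (w z * exp (- (snd z * f (fst z))))) \<in> borel_measurable m" by measurable
        from nn_integral_multc[OF this, of "e j"] show ?thesis by (simp only: a(1))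
      qed
      ultimately show ?thesis by simp
    qed
    finally show ?thesis .
  qed
  have ej: "e j = ennreal (a ^ j / fact j) * e 0" for j
  proof (induction j)
    case (Suc j)
    have "e (Suc j) = ennreal (1 / real (Suc j)) * (of_nat (Suc j) * e (Suc j))"
    proof -
      have "ennreal (1 / real (Suc j)) * of_nat (Suc j) = ennreal (1 / real (Suc j) * real (Suc j))"
        by (subst ennreal_mult'') (simp_all add: ennreal_of_nat_eq_real_of_nat del: of_nat_Suc)
      then show ?thesis by (simp add: mult.assoc[symmetric] del: of_nat_Suc)
    qed
    also have "\<dots> = ennreal (1 / real (Suc j)) * (ennreal a * (ennreal (a ^ j / fact j) * e 0))" unfolding rec Suc ..
    also have "\<dots> = ennreal (1 / real (Suc j) * (a * (a ^ j / fact j))) * e 0"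
    proof -
      have p: "0 \<le> 1 / real (Suc j)" by simp
      show ?thesis by (simp only: ennreal_mult'[OF p] ennreal_mult'[OF a(2)] mult.assoc)
    qed
    also have "1 / real (Suc j) * (a * (a ^ j / fact j)) = a ^ Suc j / fact (Suc j)" by simp
    finally show ?case .
  qed simp
  have "(\<integral>\<^sup>+\<eta>. V \<eta> \<partial>P) = (\<integral>\<^sup>+\<eta>. (\<Sum>j. G j \<eta>) \<partial>P)"
  proof (rule nn_integral_cong_AE)
    show "AE \<eta> in P. V \<eta> = (\<Sum>j. G j \<eta>)"
      using AE_finite_marked[OF B fin] AE_space
    proof eventually_elim
      fix \<eta> assume f: "finite (marked_atoms B \<eta>)" and "\<eta> \<in> space P"
      then have \<eta>: "\<eta> \<in> space K" by (simp add: space_P)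
      let ?c = "card (marked_atoms B \<eta>)"
      have "N \<eta> = of_nat ?c" unfolding N_def atom_sum_indicator[OF \<eta>] using f by simp
      then have G: "G j \<eta> = (if j = ?c then V \<eta> else 0)" for j by (auto simp: G_def)
      have "(\<Sum>j. G j \<eta>) = (\<Sum>j\<in>{?c}. G j \<eta>)" by (rule suminf_finite) (auto simp: G)
      then show "V \<eta> = (\<Sum>j. G j \<eta>)" by (simp add: G)
    qed
  qed
  also have "\<dots> = (\<Sum>j. e j)" unfolding e_def by (rule nn_integral_suminf) measurable
  also have "\<dots> = (\<Sum>j. ennreal (a ^ j / fact j) * e 0)" by (rule suminf_cong) (rule ej)
  also have "\<dots> = (\<Sum>j. ennreal (a ^ j / fact j)) * e 0" by (rule ennreal_suminf_multc)
  also have "(\<Sum>j. ennreal (a ^ j / fact j)) = ennreal (exp a)"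
  proof (rule suminf_ennreal_eq)
    show "(\<lambda>j. a ^ j / fact j) sums exp a" using exp_converges[of a] by (simp add: divide_inverse mult.commute)
  qed (use a(2) in simp)
  also have "e 0 = (\<integral>\<^sup>+\<eta>. indicator {\<eta>. atom_sum (indicator B) \<eta> = 0} \<eta> * ennreal (exp (- (\<integral>x. f x \<partial>\<eta>))) \<partial>P)"
    unfolding e_def
  proof (rule nn_integral_cong)
    fix \<eta> assume "\<eta> \<in> space P"
    then have \<eta>: "\<eta> \<in> space K" by (simp add: space_P)
    show "G 0 \<eta> = indicator {\<eta>. atom_sum (indicator B) \<eta> = 0} \<eta> * ennreal (exp (- (\<integral>x. f x \<partial>\<eta>)))"
    proof (cases "N \<eta> = 0")
      case True
      then have "marked_atoms B \<eta> = {}" unfolding N_def atom_sum_indicator[OF \<eta>] by (auto split: if_splits)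
      then show ?thesis using True by (simp add: G_def V_def atom_prod_def N_def)
    qed (simp add: G_def N_def)
  qed
  finally show ?thesis by (simp add: V_def)
qed

lemma laplace_nn:
  assumes g: "g \<in> Cc_nonneg"
  shows "(\<integral>\<^sup>+\<eta>. ennreal (exp (- (\<integral>x. g x \<partial>\<eta>))) \<partial>P) = ennreal (exp (- (\<integral>z. (1 - exp (- (snd z * g (fst z)))) \<partial>m)))"
proof -
  have "integrable P (\<lambda>\<eta>. exp (- (\<integral>x. g x \<partial>\<eta>)))"
    using integral_measurable_P[OF Cc_nonnegD(1)[OF g]] Cc_nonneg_integral_nonneg[OF g]
    by (intro integrable_const_bound[where B=1]) auto
  then show ?thesis using laplace[OF g] by (subst nn_integral_eq_integral) auto
qed

text \<open>The unknown start of the recursion is found by comparison with the case \<open>w = 1\<close>, in which the left-hand side is a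
Laplace functional.\<close>

theorem exponential_formula:
  assumes B: "B \<in> sets m" and fin: "emeasure m B < \<infinity>"
    and w: "w \<in> borel_measurable m" "\<And>z. w z > 0" "integrable m (\<lambda>z. indicator B z * w z)" and f: "f \<in> Cc_nonneg"
  shows "(\<integral>\<^sup>+\<eta>. ennreal (atom_prod B w \<eta> * exp (- (\<integral>x. f x \<partial>\<eta>))) \<partial>P) =
    ennreal (exp ((\<integral>z. indicator B z * (w z - 1) * exp (- (snd z * f (fst z))) \<partial>m) - (\<integral>z. (1 - exp (- (snd z * f (fst z)))) \<partial>m)))"
proof -
  have [measurable]: "f \<in> borel_measurable borel" using f Cc_borel_measurable by (auto simp: Cc_nonneg_def)
  note w(1)[measurable] B[measurable]
  define E where "E z = exp (- (snd z * f (fst z)))" for z :: "'a \<times> real"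
  have Em[measurable]: "E \<in> borel_measurable m" unfolding E_def[abs_def] by measurable
  have E1: "0 < E z" "z \<in> space m \<Longrightarrow> E z \<le> 1" for z
    using mark_pos[of z] Cc_nonnegD(2)[OF f, of "fst z"] by (auto simp: E_def)
  have int: "integrable m (\<lambda>z. indicator B z * v z * E z)"
    if v: "v \<in> borel_measurable m" "\<And>z. v z > 0" "integrable m (\<lambda>z. indicator B z * v z)" for v
  proof (rule Bochner_Integration.integrable_bound[OF v(3)])
    show "AE z in m. norm (indicator B z * v z * E z) \<le> norm (indicator B z * v z)"
      using E1 v(2) by (intro AE_I2) (auto simp: abs_mult indicator_def less_imp_le intro!: mult_left_le)
  qed (use v(1) in measurable)
  define J where "J v = (\<integral>z. indicator B z * v z * E z \<partial>m)" for v
  define e0 where "e0 = (\<integral>\<^sup>+\<eta>. indicator {\<eta>. atom_sum (indicator B) \<eta> = 0} \<eta> * ennreal (exp (- (\<integral>x. f x \<partial>\<eta>))) \<partial>P)"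
  have aux: "(\<integral>\<^sup>+\<eta>. ennreal (atom_prod B v \<eta> * exp (- (\<integral>x. f x \<partial>\<eta>))) \<partial>P) = ennreal (exp (J v)) * e0"
    if v: "v \<in> borel_measurable m" "\<And>z. v z > 0" "integrable m (\<lambda>z. indicator B z * v z)" for v
    unfolding e0_def
  proof (rule exponential_formula_aux[OF B fin v(1,2) f])
    have "(\<integral>\<^sup>+z. indicator B z * ennreal (v z * exp (- (snd z * f (fst z)))) \<partial>m) = (\<integral>\<^sup>+z. ennreal (indicator B z * v z * E z) \<partial>m)"
      by (intro nn_integral_cong) (auto simp: indicator_def E_def)
    also have "\<dots> = ennreal (J v)"
      unfolding J_def using v(2) E1(1) by (intro nn_integral_eq_integral int v) (auto simp: less_imp_le intro!: AE_I2)
    finally show "(\<integral>\<^sup>+z. indicator B z * ennreal (v z * exp (- (snd z * f (fst z)))) \<partial>m) = ennreal (J v)" .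
    show "0 \<le> J v" unfolding J_def using v(2) E1(1) by (intro Bochner_Integration.integral_nonneg) (auto simp: less_imp_le)
  qed
  have i1: "integrable m (\<lambda>z. indicator B z * 1 :: real)" using fin by (simp add: integrable_indicator_iff less_top)
  have "ennreal (exp (J (\<lambda>_. 1))) * e0 = ennreal (exp (- (\<integral>z. (1 - E z) \<partial>m)))"
    using aux[of "\<lambda>_. 1"] i1 laplace_nn[OF f] by (simp add: atom_prod_def E_def)
  then have "e0 = ennreal (exp (- J (\<lambda>_. 1))) * ennreal (exp (- (\<integral>z. (1 - E z) \<partial>m)))"
  proof -
    assume h: "ennreal (exp (J (\<lambda>_. 1))) * e0 = ennreal (exp (- (\<integral>z. (1 - E z) \<partial>m)))"
    have "e0 = ennreal (exp (- J (\<lambda>_. 1)) * exp (J (\<lambda>_. 1))) * e0" by (simp add: mult_exp_exp)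
    also have "\<dots> = ennreal (exp (- J (\<lambda>_. 1))) * (ennreal (exp (J (\<lambda>_. 1))) * e0)"
      by (subst ennreal_mult) (simp_all add: mult.assoc)
    finally show ?thesis unfolding h .
  qed
  then have "(\<integral>\<^sup>+\<eta>. ennreal (atom_prod B w \<eta> * exp (- (\<integral>x. f x \<partial>\<eta>))) \<partial>P) =
      ennreal (exp (J w) * (exp (- J (\<lambda>_. 1)) * exp (- (\<integral>z. (1 - E z) \<partial>m))))"
    using aux[OF w(1-3)] by (simp add: ennreal_mult)
  also have "exp (J w) * (exp (- J (\<lambda>_. 1)) * exp (- (\<integral>z. (1 - E z) \<partial>m))) = exp (J w - J (\<lambda>_. 1) - (\<integral>z. (1 - E z) \<partial>m))"
    by (simp add: mult_exp_exp)
  also have "J w - J (\<lambda>_. 1) = (\<integral>z. indicator B z * w z * E z - indicator B z * 1 * E z \<partial>m)"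
    unfolding J_def by (rule Bochner_Integration.integral_diff[symmetric]) (use int[OF w(1-3)] int[of "\<lambda>_. 1"] i1 in auto)
  also have "\<dots> = (\<integral>z. indicator B z * (w z - 1) * E z \<partial>m)"
    by (intro Bochner_Integration.integral_cong refl) (simp add: algebra_simps)
  finally show ?thesis by (simp add: E_def)
qed

end

section \<open>Comparison of two completely random measures\<close>

text \<open>The limit is taken along an almost everywhere convergent subsequence, and Fatou's lemma turns the Cauchy
property into convergence in mean.\<close>

lemma L1_complete:
  fixes s :: "nat \<Rightarrow> 'a \<Rightarrow> real"
  assumes int: "\<And>n. integrable M (s n)"
    and cauchy: "\<And>e. e > 0 \<Longrightarrow> \<exists>N. \<forall>i\<ge>N. \<forall>j\<ge>N. (\<integral>x. norm (s i x - s j x) \<partial>M) < e"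
    and pos: "\<And>n x. 0 \<le> s n x"
  obtains D where "integrable M D" "\<And>x. 0 \<le> D x" "(\<lambda>n. \<integral>x. norm (s n x - D x) \<partial>M) \<longlonglongrightarrow> 0"
proof -
  note [measurable] = borel_measurable_integrable[OF int]
  obtain r where r: "strict_mono r" "AE x in M. Cauchy (\<lambda>i. s (r i) x)"
    using cauchy_L1_AE_cauchy_subseq[OF int cauchy] by blast
  define D where "D x = max 0 (lim (\<lambda>i. s (r i) x))" for x
  have [measurable]: "D \<in> borel_measurable M" unfolding D_def[abs_def] by measurable
  have lim: "AE x in M. (\<lambda>i. s (r i) x) \<longlonglongrightarrow> D x"
    using r(2)
  proof eventually_elim
    fix x assume "Cauchy (\<lambda>i. s (r i) x)"
    then have c: "(\<lambda>i. s (r i) x) \<longlonglongrightarrow> lim (\<lambda>i. s (r i) x)"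
      by (simp add: Cauchy_convergent_iff convergent_LIMSEQ_iff)
    then have "0 \<le> lim (\<lambda>i. s (r i) x)" by (rule LIMSEQ_le_const) (use pos in auto)
    then show "(\<lambda>i. s (r i) x) \<longlonglongrightarrow> D x" using c by (simp add: D_def)
  qed
  have bound: "\<exists>N. \<forall>i\<ge>N. (\<integral>\<^sup>+x. ennreal (norm (s i x - D x)) \<partial>M) \<le> ennreal e" if e: "e > 0" for e
  proof -
    obtain N where N: "\<And>i j. i \<ge> N \<Longrightarrow> j \<ge> N \<Longrightarrow> (\<integral>x. norm (s i x - s j x) \<partial>M) < e" using cauchy[OF e] by blast
    show ?thesis
    proof (intro exI[of _ N] allI impI)
      fix i assume i: "i \<ge> N"
      have "(\<integral>\<^sup>+x. ennreal (norm (s i x - D x)) \<partial>M) = (\<integral>\<^sup>+x. liminf (\<lambda>j. ennreal (norm (s i x - s (r j) x))) \<partial>M)"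
      proof (rule nn_integral_cong_AE)
        show "AE x in M. ennreal (norm (s i x - D x)) = liminf (\<lambda>j. ennreal (norm (s i x - s (r j) x)))"
          using lim
        proof eventually_elim
          fix x assume "(\<lambda>i. s (r i) x) \<longlonglongrightarrow> D x"
          then have "(\<lambda>j. ennreal (norm (s i x - s (r j) x))) \<longlonglongrightarrow> ennreal (norm (s i x - D x))"
            by (intro tendsto_intros)
          then show "ennreal (norm (s i x - D x)) = liminf (\<lambda>j. ennreal (norm (s i x - s (r j) x)))"
            by (intro lim_imp_Liminf[symmetric]) auto
        qed
      qed
      also have "\<dots> \<le> liminf (\<lambda>j. \<integral>\<^sup>+x. ennreal (norm (s i x - s (r j) x)) \<partial>M)"
        by (rule nn_integral_liminf) measurable
      also have "\<dots> \<le> limsup (\<lambda>j. \<integral>\<^sup>+x. ennreal (norm (s i x - s (r j) x)) \<partial>M)"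
        by (intro Liminf_le_Limsup) simp
      also have "\<dots> \<le> ennreal e"
      proof (rule Limsup_bounded)
        show "\<forall>\<^sub>F j in sequentially. (\<integral>\<^sup>+x. ennreal (norm (s i x - s (r j) x)) \<partial>M) \<le> ennreal e"
          unfolding eventually_sequentially
        proof (intro exI[of _ N] allI impI)
          fix j assume "j \<ge> N"
          then have "r j \<ge> N" using seq_suble[OF r(1), of j] by simp
          then have "(\<integral>x. norm (s i x - s (r j) x) \<partial>M) \<le> e" using N[OF i] by (simp add: less_imp_le)
          moreover have "(\<integral>\<^sup>+x. ennreal (norm (s i x - s (r j) x)) \<partial>M) = ennreal (\<integral>x. norm (s i x - s (r j) x) \<partial>M)"
            by (rule nn_integral_eq_integral) (auto intro!: int)
          ultimately show "(\<integral>\<^sup>+x. ennreal (norm (s i x - s (r j) x)) \<partial>M) \<le> ennreal e" by (simp add: ennreal_leI)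
        qed
      qed
      finally show "(\<integral>\<^sup>+x. ennreal (norm (s i x - D x)) \<partial>M) \<le> ennreal e" .
    qed
  qed
  have intD: "integrable M D"
  proof -
    obtain N where "(\<integral>\<^sup>+x. ennreal (norm (s N x - D x)) \<partial>M) \<le> ennreal 1" using bound[of 1] by auto
    then have "(\<integral>\<^sup>+x. ennreal (norm (s N x - D x)) \<partial>M) < \<infinity>" using le_less_trans by fastforce
    then have "integrable M (\<lambda>x. s N x - D x)" by (intro integrableI_bounded) auto
    from Bochner_Integration.integrable_diff[OF int[of N] this] show ?thesis by simp
  qed
  show ?thesis
  proof (rule that[OF intD])
    show "0 \<le> D x" for x by (simp add: D_def)
    show "(\<lambda>n. \<integral>x. norm (s n x - D x) \<partial>M) \<longlonglongrightarrow> 0"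
      unfolding lim_sequentially
    proof (intro allI impI)
      fix e :: real assume e: "e > 0"
      obtain N where N: "\<And>i. i \<ge> N \<Longrightarrow> (\<integral>\<^sup>+x. ennreal (norm (s i x - D x)) \<partial>M) \<le> ennreal (e/2)"
        using bound[of "e/2"] e by auto
      show "\<exists>N. \<forall>n\<ge>N. dist (\<integral>x. norm (s n x - D x) \<partial>M) 0 < e"
      proof (intro exI[of _ N] allI impI)
        fix n assume "n \<ge> N"
        have "ennreal (\<integral>x. norm (s n x - D x) \<partial>M) = (\<integral>\<^sup>+x. ennreal (norm (s n x - D x)) \<partial>M)"
          by (rule nn_integral_eq_integral[symmetric]) (auto intro!: int intD)
        also have "\<dots> \<le> ennreal (e/2)" by (rule N[OF \<open>n \<ge> N\<close>])
        finally have "(\<integral>x. norm (s n x - D x) \<partial>M) \<le> e/2" using e by (subst (asm) ennreal_le_iff) auto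
        moreover have "0 \<le> (\<integral>x. norm (s n x - D x) \<partial>M)" by (rule Bochner_Integration.integral_nonneg) simp
        ultimately show "dist (\<integral>x. norm (s n x - D x) \<partial>M) 0 < e" using e by (simp add: dist_norm)
      qed
    qed
  qed
qed

lemma atom_prod_mult: "atom_prod B (\<lambda>z. v z * w z) \<eta> = atom_prod B v \<eta> * atom_prod B w \<eta>"
  by (simp add: atom_prod_def prod.distrib)

lemma atom_prod_sqrt:
  assumes "\<And>z. w z > 0"
  shows "sqrt (atom_prod B w \<eta>) = atom_prod B (\<lambda>z. sqrt (w z)) \<eta>"
proof (rule real_sqrt_unique)
  have "(atom_prod B (\<lambda>z. sqrt (w z)) \<eta>)\<^sup>2 = atom_prod B (\<lambda>z. sqrt (w z) * sqrt (w z)) \<eta>"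
    by (simp only: power2_eq_square atom_prod_mult)
  also have "\<dots> = atom_prod B w \<eta>" using assms by (simp add: less_imp_le)
  finally show "(atom_prod B (\<lambda>z. sqrt (w z)) \<eta>)\<^sup>2 = atom_prod B w \<eta>" .
  show "0 \<le> atom_prod B (\<lambda>z. sqrt (w z)) \<eta>" using assms by (intro less_imp_le atom_prod_pos) simp
qed

lemma atom_prod_inverse: "atom_prod B (\<lambda>z. 1 / w z) \<eta> = 1 / atom_prod B w \<eta>"
  by (simp add: atom_prod_def prod_dividef)

lemma atom_prod_subset:
  assumes "C \<subseteq> B" "finite (marked_atoms B \<eta>)"
  shows "atom_prod C w \<eta> = atom_prod B (\<lambda>z. if z \<in> C then w z else 1) \<eta>"
proof -
  have "marked_atoms C \<eta> \<subseteq> marked_atoms B \<eta>" using assms(1) by (auto simp: marked_atoms_def)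
  moreover have "w (x, measure \<eta> {x}) = (if (x, measure \<eta> {x}) \<in> C then w (x, measure \<eta> {x}) else 1)"
    if "x \<in> marked_atoms C \<eta>" for x using that by (simp add: marked_atoms_def)
  ultimately show ?thesis
    unfolding atom_prod_def using assms(2)
    by (intro prod.mono_neutral_cong_left) (auto simp: marked_atoms_def)
qed

lemma (in crm) integrable_one_minus_exp:
  assumes g: "g \<in> Cc_nonneg"
  shows "integrable m (\<lambda>z. 1 - exp (- (snd z * g (fst z))))"
proof (rule Bochner_Integration.integrable_bound[OF Cc_integrable_min[OF g]])
  note [measurable] = Cc_measurable_m[OF Cc_nonnegD(1)[OF g]]
  show "(\<lambda>z. 1 - exp (- (snd z * g (fst z)))) \<in> borel_measurable m" by measurable
  show "AE z in m. norm (1 - exp (- (snd z * g (fst z)))) \<le> norm (min (snd z * g (fst z)) 1)"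
  proof (rule AE_I2)
    fix z assume z: "z \<in> space m"
    have "0 \<le> snd z * g (fst z)" using mark_pos[OF z] Cc_nonnegD(2)[OF g] by simp
    then show "norm (1 - exp (- (snd z * g (fst z)))) \<le> norm (min (snd z * g (fst z)) 1)"
      using exp_ge_add_one_self[of "- (snd z * g (fst z))"] by simp
  qed
qed

text \<open>The intensity of \<open>N\<close> is the expected number of atoms with mark in \<open>N\<close>. It vanishes if and only if almost surely there is no
such atom, and a statement of this kind passes from \<open>P\<close> to \<open>P'\<close>.\<close>

lemma crm_intensity_absolutely_continuous:
  assumes A: "crm m P" and B: "crm m' P'" and ac: "absolutely_continuous P P'"
  shows "absolutely_continuous m m'"
proof -
  interpret A: crm m P by fact
  interpret B: crm m' P' by fact
  show ?thesis
    unfolding absolutely_continuous_def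
  proof
    fix N assume N: "N \<in> null_sets m"
    then have Nm: "N \<in> sets m" by auto
    then have Nm': "N \<in> sets m'" by (simp add: A.sets_m B.sets_m)
    have "(\<integral>\<^sup>+\<eta>. atom_sum (indicator N) \<eta> \<partial>P) = 0" using A.expectation_atom_count[OF Nm] N by auto
    then have "AE \<eta> in P. atom_sum (indicator N) \<eta> = 0"
      using nn_integral_0_iff_AE[OF A.atom_sum_indicator_measurable[OF Nm]] by simp
    then have "AE \<eta> in P'. atom_sum (indicator N) \<eta> = 0"
      by (rule absolutely_continuous_AE[OF _ ac, rotated]) (simp add: A.sets_P B.sets_P)
    then have "(\<integral>\<^sup>+\<eta>. atom_sum (indicator N) \<eta> \<partial>P') = 0"
      using nn_integral_0_iff_AE[OF B.atom_sum_indicator_measurable[OF Nm']] by simp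
    then show "N \<in> null_sets m'" using B.expectation_atom_count[OF Nm'] Nm' by auto
  qed
qed

locale crm_pair = crm m P + B: crm m' P'
  for m :: "('a::euclidean_space \<times> real) measure" and P :: "'a measure measure"
    and m' :: "('a \<times> real) measure" and P' :: "'a measure measure" +
  fixes \<rho> :: "'a \<times> real \<Rightarrow> real"
  assumes rho[measurable]: "\<rho> \<in> borel_measurable m" and rho_pos: "\<And>z. \<rho> z > 0"
    and density: "m' = density m (\<lambda>z. ennreal (\<rho> z))"
begin

lemma B_cell: "B.cell n = cell n"
  by (simp add: B.cell_def cell_def B.space_m space_m)

lemma integrable_m'_iff: "h \<in> borel_measurable m \<Longrightarrow> integrable m' h \<longleftrightarrow> integrable m (\<lambda>z. \<rho> z * h z)"
  unfolding density using rho_pos by (subst integrable_density) (auto simp: less_imp_le)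

lemma integral_m': "h \<in> borel_measurable m \<Longrightarrow> (\<integral>z. h z \<partial>m') = (\<integral>z. \<rho> z * h z \<partial>m)"
  unfolding density using rho_pos by (subst integral_density) (auto simp: less_imp_le)

lemma integrable_cell: "integrable m (\<lambda>z. indicator (cell n) z :: real)"
  using emeasure_cell[of n] by (simp add: integrable_indicator_iff less_top)

text \<open>The condition that makes the cells of finite intensity holds for \<open>m'\<close> as well, which bounds \<open>\<rho>\<close> in mean on
each cell.\<close>

lemma integrable_cell_rho: "integrable m (\<lambda>z. indicator (cell n) z * \<rho> z)"
proof -
  have "integrable m' (\<lambda>z. indicator (cell n) z :: real)"
    using B.emeasure_cell[of n] B.cell_sets[of n] unfolding B_cell by (simp add: integrable_indicator_iff less_top)
  then show ?thesis by (subst (asm) integrable_m'_iff) (auto simp: mult.commute)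
qed

lemma sqrt_rho_le: "sqrt (\<rho> z) \<le> 1 + \<rho> z"
proof -
  have "0 \<le> (sqrt (\<rho> z) - 1)\<^sup>2" by simp
  also have "\<dots> = \<rho> z - 2 * sqrt (\<rho> z) + 1" using rho_pos[of z] by (simp add: power2_diff less_imp_le)
  finally show ?thesis using rho_pos[of z] by (smt (verit) real_sqrt_gt_zero)
qed

lemma integrable_cell_bounded:
  assumes [measurable]: "h \<in> borel_measurable m" and b: "\<And>z. \<bar>h z\<bar> \<le> c * (1 + \<rho> z)"
  shows "integrable m (\<lambda>z. indicator (cell n) z * h z)"
proof (rule Bochner_Integration.integrable_bound)
  show "integrable m (\<lambda>z. c * (indicator (cell n) z + indicator (cell n) z * \<rho> z))"
    by (intro integrable_mult_right Bochner_Integration.integrable_add integrable_cell integrable_cell_rho)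
  show "AE z in m. norm (indicator (cell n) z * h z) \<le> norm (c * (indicator (cell n) z + indicator (cell n) z * \<rho> z))"
  proof (rule AE_I2)
    fix z
    have "\<bar>h z\<bar> \<le> \<bar>c * (1 + \<rho> z)\<bar>" using b[of z] by linarith
    then show "norm (indicator (cell n) z * h z) \<le> norm (c * (indicator (cell n) z + indicator (cell n) z * \<rho> z))"
      by (simp add: indicator_def)
  qed
qed measurable

lemma integrable_cell_sqrt: "integrable m (\<lambda>z. indicator (cell n) z * sqrt (\<rho> z))"
  by (rule integrable_cell_bounded[of _ 1]) (use sqrt_rho_le rho_pos in \<open>auto simp: less_imp_le\<close>)

lemma hellinger_expand: "(sqrt (\<rho> z) - 1)\<^sup>2 = \<rho> z - 2 * sqrt (\<rho> z) + 1"
  using rho_pos[of z] by (simp add: power2_diff less_imp_le)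

lemma integrable_cell_hellinger: "integrable m (\<lambda>z. indicator (cell n) z * (sqrt (\<rho> z) - 1)\<^sup>2)"
proof (rule integrable_cell_bounded[of _ 1])
  show "\<bar>(sqrt (\<rho> z) - 1)\<^sup>2\<bar> \<le> 1 * (1 + \<rho> z)" for z
    using rho_pos[of z] unfolding hellinger_expand[symmetric, THEN sym] by (simp add: hellinger_expand[symmetric]) (simp add: hellinger_expand less_imp_le)
qed measurable

lemma expectation_atom_prod:
  assumes w: "w \<in> borel_measurable m" "\<And>z. w z > 0" "integrable m (\<lambda>z. indicator (cell n) z * w z)"
  shows "(\<integral>\<^sup>+\<eta>. ennreal (atom_prod (cell n) w \<eta>) \<partial>P) = ennreal (exp (\<integral>z. indicator (cell n) z * (w z - 1) \<partial>m))"
  using exponential_formula[OF cell_sets emeasure_cell w Cc_nonneg_zero] by simp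

definition hellinger_on_cells :: "nat \<Rightarrow> real" where
  "hellinger_on_cells n = (\<integral>z. indicator (cell n) z * (sqrt (\<rho> z) - 1)\<^sup>2 \<partial>m)"

lemma nn_integral_hellinger_on_cells: "(\<integral>\<^sup>+z. ennreal (indicator (cell n) z * (sqrt (\<rho> z) - 1)\<^sup>2) \<partial>m) = ennreal (hellinger_on_cells n)"
  unfolding hellinger_on_cells_def by (intro nn_integral_eq_integral integrable_cell_hellinger) auto

lemma hellinger_SUP: "(\<integral>\<^sup>+z. ennreal ((sqrt (\<rho> z) - 1)\<^sup>2) \<partial>m) = (SUP n. ennreal (hellinger_on_cells n))"
proof -
  have "(\<integral>\<^sup>+z. ennreal ((sqrt (\<rho> z) - 1)\<^sup>2) \<partial>m) = (\<integral>\<^sup>+z. (SUP n. ennreal (indicator (cell n) z * (sqrt (\<rho> z) - 1)\<^sup>2)) \<partial>m)"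
  proof (rule nn_integral_cong)
    fix z assume z: "z \<in> space m"
    have e: "ennreal (indicator (cell n) z * (sqrt (\<rho> z) - 1)\<^sup>2) = ennreal ((sqrt (\<rho> z) - 1)\<^sup>2) * indicator (cell n) z" for n
      by (simp add: indicator_def)
    have "(SUP n. indicator (cell n) z) = (1::ennreal)"
      using z indicator_UN_SUP[of cell z] UN_cell by simp
    then show "ennreal ((sqrt (\<rho> z) - 1)\<^sup>2) = (SUP n. ennreal (indicator (cell n) z * (sqrt (\<rho> z) - 1)\<^sup>2))"
      unfolding e by (simp add: SUP_mult_left_ennreal[symmetric])
  qed
  also have "\<dots> = (SUP n. \<integral>\<^sup>+z. ennreal (indicator (cell n) z * (sqrt (\<rho> z) - 1)\<^sup>2) \<partial>m)"
  proof (rule nn_integral_monotone_convergence_SUP)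
    show "incseq (\<lambda>n z. ennreal (indicator (cell n) z * (sqrt (\<rho> z) - 1)\<^sup>2))"
      using cell_mono by (intro monoI le_funI ennreal_leI mult_right_mono) (auto simp: indicator_def)
  qed measurable
  finally show ?thesis by (simp only: nn_integral_hellinger_on_cells)
qed

text \<open>Let \<open>D\<close> be the density of \<open>P'\<close>. For every positive \<open>F\<close>, the Cauchy-Schwarz inequality bounds the square of the affinity
\<open>\<integral>sqrt D dP\<close>, a positive number, by \<open>\<integral>F dP\<close> times \<open>\<integral>1/F dP'\<close>. If \<open>F\<close> is the product of \<open>sqrt \<rho>\<close> over the atoms in a
cell, the exponential formula evaluates this bound as the exponential of minus the Hellinger integral over the cell.\<close>

theorem hellinger_necessary:
  assumes ac: "absolutely_continuous P P'"
  shows "(\<integral>\<^sup>+z. ennreal ((sqrt (\<rho> z) - 1)\<^sup>2) \<partial>m) < \<infinity>"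
proof -
  obtain D where D[measurable]: "D \<in> borel_measurable P" and RN: "AE \<eta> in P. RN_deriv P P' \<eta> = ennreal (D \<eta>)"
    and D0: "AE \<eta> in P'. 0 < D \<eta>" "\<And>\<eta>. 0 \<le> D \<eta>"
    using real_RN_deriv[OF B.finite_measure_axioms ac] sets_P B.sets_P by metis
  have P': "P' = density P (\<lambda>\<eta>. ennreal (D \<eta>))"
  proof -
    have "P' = density P (RN_deriv P P')" using density_RN_deriv[OF ac] sets_P B.sets_P by simp
    also have "\<dots> = density P (\<lambda>\<eta>. ennreal (D \<eta>))" using RN by (intro density_cong) auto
    finally show ?thesis .
  qed
  define c where "c = (\<integral>\<^sup>+\<eta>. ennreal (sqrt (D \<eta>)) \<partial>P)"
  have c0: "c \<noteq> 0"
  proof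
    assume "c = 0"
    then have "AE \<eta> in P. ennreal (sqrt (D \<eta>)) = 0" unfolding c_def by (subst (asm) nn_integral_0_iff_AE) auto
    then have "AE \<eta> in P. D \<eta> = 0"
      by eventually_elim (use D0(2) in \<open>simp add: ennreal_eq_0_iff order_antisym\<close>)
    then have "AE \<eta> in P'. D \<eta> = 0"
      by (rule absolutely_continuous_AE[OF _ ac, rotated]) (simp add: sets_P B.sets_P)
    with D0(1) have "AE \<eta> in P'. False" by eventually_elim simp
    then show False by (simp add: B.AE_False)
  qed
  have main: "c\<^sup>2 \<le> ennreal (exp (- hellinger_on_cells n))" for n
  proof -
    \<comment> \<open>With this \<open>F\<close> the two exponents below add up to a perfect square.\<close>
    define F where "F = atom_prod (cell n) (\<lambda>z. sqrt (\<rho> z))"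
    have wm: "(\<lambda>z. sqrt (\<rho> z)) \<in> borel_measurable m" "(\<lambda>z. 1 / sqrt (\<rho> z)) \<in> borel_measurable m" by measurable
    have wp: "sqrt (\<rho> z) > 0" "1 / sqrt (\<rho> z) > 0" for z using rho_pos[of z] by auto
    have rdiv: "\<rho> z / sqrt (\<rho> z) = sqrt (\<rho> z)" for z using rho_pos[of z] by (intro real_div_sqrt) simp
    have F0: "F \<eta> > 0" for \<eta> unfolding F_def by (rule atom_prod_pos) (rule wp)
    have "F \<in> borel_measurable K"
      unfolding F_def using wm(1) cell_sets[of n] wp(1)
      by (intro atom_prod_measurable) (simp_all add: sets_m measurable_cong_sets[OF sets_m refl])
    then have [measurable]: "F \<in> borel_measurable P" by (simp add: measurable_cong_sets[OF sets_P refl])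
    have EF: "(\<integral>\<^sup>+\<eta>. ennreal (F \<eta>) \<partial>P) = ennreal (exp (\<integral>z. indicator (cell n) z * (sqrt (\<rho> z) - 1) \<partial>m))"
      unfolding F_def by (rule expectation_atom_prod[OF wm(1) wp(1) integrable_cell_sqrt])
    have im': "integrable m' (\<lambda>z. indicator (cell n) z * (1 / sqrt (\<rho> z)))"
    proof (subst integrable_m'_iff)
      have "\<rho> z * (indicator (cell n) z * (1 / sqrt (\<rho> z))) = indicator (cell n) z * sqrt (\<rho> z)" for z
      proof -
        have "\<rho> z * (indicator (cell n) z * (1 / sqrt (\<rho> z))) = indicator (cell n) z * (\<rho> z / sqrt (\<rho> z))" by simp
        then show ?thesis by (simp only: rdiv)
      qed
      then show "integrable m (\<lambda>z. \<rho> z * (indicator (cell n) z * (1 / sqrt (\<rho> z))))"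
        using integrable_cell_sqrt by simp
    qed measurable
    have wm': "(\<lambda>z. 1 / sqrt (\<rho> z)) \<in> borel_measurable m'"
      using wm(2) by (simp add: measurable_cong_sets[OF B.sets_m refl] measurable_cong_sets[OF sets_m refl])
    have "(\<integral>\<^sup>+\<eta>. ennreal (1 / F \<eta>) \<partial>P') = ennreal (exp (\<integral>z. indicator (cell n) z * (1 / sqrt (\<rho> z) - 1) \<partial>m'))"
      using B.exponential_formula[OF B.cell_sets[of n, unfolded B_cell] B.emeasure_cell[of n, unfolded B_cell] wm' wp(2) im' Cc_nonneg_zero]
      by (simp add: atom_prod_inverse F_def)
    also have "(\<integral>z. indicator (cell n) z * (1 / sqrt (\<rho> z) - 1) \<partial>m') = (\<integral>z. indicator (cell n) z * (sqrt (\<rho> z) - \<rho> z) \<partial>m)"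
    proof (subst integral_m')
      have "\<rho> z * (indicator (cell n) z * (1 / sqrt (\<rho> z) - 1)) = indicator (cell n) z * (sqrt (\<rho> z) - \<rho> z)" for z
      proof -
        have "\<rho> z * (indicator (cell n) z * (1 / sqrt (\<rho> z) - 1)) = indicator (cell n) z * (\<rho> z / sqrt (\<rho> z) - \<rho> z)"
          by (simp add: algebra_simps)
        then show ?thesis by (simp only: rdiv)
      qed
      then show "(\<integral>z. \<rho> z * (indicator (cell n) z * (1 / sqrt (\<rho> z) - 1)) \<partial>m) = (\<integral>z. indicator (cell n) z * (sqrt (\<rho> z) - \<rho> z) \<partial>m)"
        by (simp only:)
    qed measurable
    finally have EG: "(\<integral>\<^sup>+\<eta>. ennreal (1 / F \<eta>) \<partial>P') = ennreal (exp (\<integral>z. indicator (cell n) z * (sqrt (\<rho> z) - \<rho> z) \<partial>m))" .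
    have DG: "(\<integral>\<^sup>+\<eta>. ennreal (D \<eta> / F \<eta>) \<partial>P) = (\<integral>\<^sup>+\<eta>. ennreal (1 / F \<eta>) \<partial>P')"
      unfolding P' using D0(2) F0 by (subst nn_integral_density) (auto intro!: nn_integral_cong simp: ennreal_mult[symmetric] less_imp_le)
    have "c = (\<integral>\<^sup>+\<eta>. ennreal (sqrt (F \<eta>)) * ennreal (sqrt (D \<eta> / F \<eta>)) \<partial>P)"
      unfolding c_def using F0 D0(2)
      by (intro nn_integral_cong) (simp add: ennreal_mult[symmetric] real_sqrt_divide less_imp_le less_imp_neq[symmetric])
    then have "c\<^sup>2 \<le> (\<integral>\<^sup>+\<eta>. (ennreal (sqrt (F \<eta>)))\<^sup>2 \<partial>P) * (\<integral>\<^sup>+\<eta>. (ennreal (sqrt (D \<eta> / F \<eta>)))\<^sup>2 \<partial>P)"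
      by (simp only:) (rule Cauchy_Schwarz_nn_integral; measurable)
    also have "\<dots> = (\<integral>\<^sup>+\<eta>. ennreal (F \<eta>) \<partial>P) * (\<integral>\<^sup>+\<eta>. ennreal (D \<eta> / F \<eta>) \<partial>P)"
      using F0 D0(2) by (simp add: ennreal_power less_imp_le)
    also have "\<dots> = ennreal (exp ((\<integral>z. indicator (cell n) z * (sqrt (\<rho> z) - 1) \<partial>m) + (\<integral>z. indicator (cell n) z * (sqrt (\<rho> z) - \<rho> z) \<partial>m)))"
      unfolding DG EF EG by (simp add: ennreal_mult[symmetric] exp_add)
    also have "(\<integral>z. indicator (cell n) z * (sqrt (\<rho> z) - 1) \<partial>m) + (\<integral>z. indicator (cell n) z * (sqrt (\<rho> z) - \<rho> z) \<partial>m) =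
      (\<integral>z. indicator (cell n) z * (sqrt (\<rho> z) - 1) + indicator (cell n) z * (sqrt (\<rho> z) - \<rho> z) \<partial>m)"
      by (rule Bochner_Integration.integral_add[symmetric]; unfold right_diff_distrib)
        (auto intro!: integrable_cell_sqrt integrable_cell_rho integrable_cell)
    also have "\<dots> = (\<integral>z. - (indicator (cell n) z * (sqrt (\<rho> z) - 1)\<^sup>2) \<partial>m)"
      by (intro Bochner_Integration.integral_cong refl) (simp add: hellinger_expand algebra_simps)
    also have "\<dots> = - hellinger_on_cells n" by (simp add: hellinger_on_cells_def)
    finally show ?thesis .
  qed
  have cfin: "c < \<infinity>"
  proof (rule ccontr)
    assume "\<not> c < \<infinity>"
    then have "c\<^sup>2 = \<infinity>" by (simp add: less_top[symmetric] power2_eq_square)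
    then show False using main[of 0] by (simp add: top_unique)
  qed
  define c' where "c' = enn2real c"
  have c': "c = ennreal c'" "c' > 0" using c0 cfin by (auto simp: c'_def enn2real_positive_iff less_top zero_less_iff_neq_zero)
  have "hellinger_on_cells n \<le> - ln (c'\<^sup>2)" for n
  proof -
    have "c'\<^sup>2 \<le> exp (- hellinger_on_cells n)" using main[of n] c' by (simp add: ennreal_power)
    then have "ln (c'\<^sup>2) \<le> ln (exp (- hellinger_on_cells n))" using c'(2) by (subst ln_le_cancel_iff) auto
    then show ?thesis by simp
  qed
  then have "(SUP n. ennreal (hellinger_on_cells n)) \<le> ennreal (- ln (c'\<^sup>2))" by (intro SUP_least ennreal_leI)
  then show ?thesis unfolding hellinger_SUP using le_less_trans by fastforce
qed


text \<open>The normalised products \<open>d n\<close> of \<open>\<rho>\<close> over the atoms in the cells are probability densities with respect to \<open>P\<close>. By the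
exponential formula the affinity of \<open>d n\<close> and \<open>d k\<close> is \<open>exp (- h / 2)\<close>, where \<open>h\<close> is the Hellinger integral over the
difference of the cells. Hence the sequence is Cauchy in mean, and the Laplace functional of its limit \<open>D\<close> times \<open>P\<close> is that
of \<open>P'\<close>.\<close>

theorem hellinger_sufficient:
  assumes fin: "(\<integral>\<^sup>+z. ennreal ((sqrt (\<rho> z) - 1)\<^sup>2) \<partial>m) < \<infinity>"
  shows "absolutely_continuous P P'"
proof -
  have hell0: "0 \<le> hellinger_on_cells n" for n unfolding hellinger_on_cells_def by (rule Bochner_Integration.integral_nonneg) simp
  have hell_mono: "hellinger_on_cells n \<le> hellinger_on_cells k" if "n \<le> k" for n k
    unfolding hellinger_on_cells_def using cell_mono[OF that]
    by (intro integral_mono integrable_cell_hellinger mult_right_mono) (auto simp: indicator_def)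
  have "Cauchy hellinger_on_cells"
  proof -
    obtain H where "H \<ge> 0" and H: "(SUP n. ennreal (hellinger_on_cells n)) = ennreal H"
      using fin unfolding hellinger_SUP by (cases "SUP n. ennreal (hellinger_on_cells n)") auto
    have "hellinger_on_cells n \<le> H" for n
    proof -
      have "ennreal (hellinger_on_cells n) \<le> ennreal H" unfolding H[symmetric] by (rule SUP_upper) simp
      then show ?thesis using \<open>H \<ge> 0\<close> by (simp add: ennreal_le_iff)
    qed
    then have ub: "\<forall>i. hellinger_on_cells i \<le> H" by blast
    have "incseq hellinger_on_cells" using hell_mono by (simp add: incseq_def)
    from incseq_convergent[OF this ub] obtain L where "hellinger_on_cells \<longlonglongrightarrow> L" by blast
    then show ?thesis by (rule LIMSEQ_imp_Cauchy)
  qed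
  define S where "S n = (\<integral>z. indicator (cell n) z * (\<rho> z - 1) \<partial>m)" for n
  define d where "d n \<eta> = atom_prod (cell n) \<rho> \<eta> * exp (- S n)" for n \<eta>
  have ch: "cell n \<in> sets half_space" for n using cell_sets[of n] sets_m by simp
  have apm: "atom_prod (cell n) w \<in> borel_measurable P" if "w \<in> borel_measurable m" "\<And>z. w z > 0" for n w
  proof -
    have "w \<in> borel_measurable half_space" using that(1) by (simp add: measurable_cong_sets[OF sets_m refl])
    from atom_prod_measurable[OF this ch that(2)] show ?thesis by (simp add: measurable_cong_sets[OF sets_P refl])
  qed
  have [measurable]: "atom_prod (cell n) \<rho> \<in> borel_measurable P" for n by (rule apm[OF rho rho_pos])
  have dm[measurable]: "d n \<in> borel_measurable P" for n unfolding d_def[abs_def] by measurable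
  have dpos: "d n \<eta> > 0" for n \<eta> unfolding d_def using atom_prod_pos[of \<rho>, OF rho_pos] by simp
  have int_rho1: "integrable m (\<lambda>z. indicator (cell n) z * (\<rho> z - 1))" for n
    unfolding right_diff_distrib using integrable_cell_rho integrable_cell by simp
  define E where "E f z = exp (- (snd z * f (fst z)))" for f :: "'a \<Rightarrow> real" and z :: "'a \<times> real"
  define A where "A f n = (\<integral>z. indicator (cell n) z * (\<rho> z - 1) * E f z \<partial>m)" for f n
  define \<Lambda> where "\<Lambda> f = (\<integral>z. (1 - E f z) \<partial>m)" for f
  have lapD: "(\<integral>\<^sup>+\<eta>. ennreal (d n \<eta> * exp (- (\<integral>x. f x \<partial>\<eta>))) \<partial>P) = ennreal (exp (A f n - S n - \<Lambda> f))"
    if f: "f \<in> Cc_nonneg" for f n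
  proof -
    have [measurable]: "(\<lambda>\<eta>. \<integral>x. f x \<partial>\<eta>) \<in> borel_measurable P" by (rule integral_measurable_P[OF Cc_nonnegD(1)[OF f]])
    have "(\<integral>\<^sup>+\<eta>. ennreal (d n \<eta> * exp (- (\<integral>x. f x \<partial>\<eta>))) \<partial>P) =
      (\<integral>\<^sup>+\<eta>. ennreal (exp (- S n)) * ennreal (atom_prod (cell n) \<rho> \<eta> * exp (- (\<integral>x. f x \<partial>\<eta>))) \<partial>P)"
      by (intro nn_integral_cong) (simp add: d_def ennreal_mult'[symmetric] mult_ac)
    also have "\<dots> = ennreal (exp (- S n)) * (\<integral>\<^sup>+\<eta>. ennreal (atom_prod (cell n) \<rho> \<eta> * exp (- (\<integral>x. f x \<partial>\<eta>))) \<partial>P)"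
      by (rule nn_integral_cmult) measurable
    also have "\<dots> = ennreal (exp (- S n)) * ennreal (exp (A f n - \<Lambda> f))"
      unfolding A_def E_def \<Lambda>_def
      by (subst exponential_formula[OF cell_sets emeasure_cell rho rho_pos integrable_cell_rho f]) (rule refl)
    also have "\<dots> = ennreal (exp (A f n - S n - \<Lambda> f))"
      by (simp add: ennreal_mult'[symmetric] mult_exp_exp algebra_simps)
    finally show ?thesis .
  qed
  have lapR: "integrable P (\<lambda>\<eta>. d n \<eta> * exp (- (\<integral>x. f x \<partial>\<eta>)))"
      "(\<integral>\<eta>. d n \<eta> * exp (- (\<integral>x. f x \<partial>\<eta>)) \<partial>P) = exp (A f n - S n - \<Lambda> f)" if f: "f \<in> Cc_nonneg" for f n
  proof -
    have [measurable]: "(\<lambda>\<eta>. \<integral>x. f x \<partial>\<eta>) \<in> borel_measurable P" by (rule integral_measurable_P[OF Cc_nonnegD(1)[OF f]])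
    show "integrable P (\<lambda>\<eta>. d n \<eta> * exp (- (\<integral>x. f x \<partial>\<eta>)))"
      by (rule integrableI_nonneg) (use lapD[OF f, of n] dpos in \<open>auto simp: less_imp_le\<close>)
    show "(\<integral>\<eta>. d n \<eta> * exp (- (\<integral>x. f x \<partial>\<eta>)) \<partial>P) = exp (A f n - S n - \<Lambda> f)"
      using lapD[OF f, of n] dpos by (subst integral_eq_nn_integral) (auto simp: less_imp_le)
  qed
  have d_int: "integrable P (d n)" and d_one: "(\<integral>\<eta>. d n \<eta> \<partial>P) = 1" for n
    using lapR[OF Cc_nonneg_zero, of n] by (simp_all add: A_def E_def \<Lambda>_def S_def)
  have sq: "sqrt (d n \<eta>) = atom_prod (cell n) (\<lambda>z. sqrt (\<rho> z)) \<eta> * exp (- (S n / 2))" for n \<eta>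
  proof -
    have "sqrt (exp (- S n)) = exp (- (S n / 2))"
      by (rule real_sqrt_unique) (simp_all add: power2_eq_square mult_exp_exp)
    then show ?thesis by (simp add: d_def real_sqrt_mult atom_prod_sqrt[of \<rho>, OF rho_pos])
  qed
  \<comment> \<open>Over the larger cell the product of the square roots has weight \<open>\<rho>\<close> on the smaller cell and \<open>sqrt \<rho>\<close> on the rest.\<close>
  have affinity: "(\<integral>\<eta>. sqrt (d n \<eta>) * sqrt (d k \<eta>) \<partial>P) = exp (- ((hellinger_on_cells k - hellinger_on_cells n) / 2))" if nk: "n \<le> k" for n k
  proof -
    define v where "v z = (if z \<in> cell n then \<rho> z else sqrt (\<rho> z))" for z
    have v: "v z > 0" for z using rho_pos[of z] by (simp add: v_def)
    have vm[measurable]: "v \<in> borel_measurable m" unfolding v_def[abs_def] by measurable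
    have vi: "integrable m (\<lambda>z. indicator (cell k) z * v z)"
    proof (rule integrable_cell_bounded[of _ 1])
      show "\<bar>v z\<bar> \<le> 1 * (1 + \<rho> z)" for z using sqrt_rho_le[of z] rho_pos[of z] by (auto simp: v_def)
    qed measurable
    have [measurable]: "atom_prod (cell k) v \<in> borel_measurable P" by (rule apm[OF vm v])
    have "AE \<eta> in P. sqrt (d n \<eta>) * sqrt (d k \<eta>) = exp (- ((S n + S k) / 2)) * atom_prod (cell k) v \<eta>"
      using AE_finite_marked[OF cell_sets emeasure_cell, of k]
    proof eventually_elim
      fix \<eta> assume f: "finite (marked_atoms (cell k) \<eta>)"
      have "atom_prod (cell n) (\<lambda>z. sqrt (\<rho> z)) \<eta> * atom_prod (cell k) (\<lambda>z. sqrt (\<rho> z)) \<eta> =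
          atom_prod (cell k) (\<lambda>z. (if z \<in> cell n then sqrt (\<rho> z) else 1) * sqrt (\<rho> z)) \<eta>"
        unfolding atom_prod_subset[OF cell_mono[OF nk] f] atom_prod_mult ..
      also have "(\<lambda>z. (if z \<in> cell n then sqrt (\<rho> z) else 1) * sqrt (\<rho> z)) = v"
        using rho_pos by (auto simp: v_def fun_eq_iff less_imp_le)
      finally have e: "atom_prod (cell n) (\<lambda>z. sqrt (\<rho> z)) \<eta> * atom_prod (cell k) (\<lambda>z. sqrt (\<rho> z)) \<eta> = atom_prod (cell k) v \<eta>" .
      have "sqrt (d n \<eta>) * sqrt (d k \<eta>) = (atom_prod (cell n) (\<lambda>z. sqrt (\<rho> z)) \<eta> * atom_prod (cell k) (\<lambda>z. sqrt (\<rho> z)) \<eta>) *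
          (exp (- (S n / 2)) * exp (- (S k / 2)))"
        unfolding sq by (simp only: mult_ac)
      also have "exp (- (S n / 2)) * exp (- (S k / 2)) = exp (- ((S n + S k) / 2))"
        unfolding mult_exp_exp by (simp add: add_divide_distrib)
      finally show "sqrt (d n \<eta>) * sqrt (d k \<eta>) = exp (- ((S n + S k) / 2)) * atom_prod (cell k) v \<eta>"
        unfolding e by (simp only: mult.commute)
    qed
    then have "(\<integral>\<eta>. sqrt (d n \<eta>) * sqrt (d k \<eta>) \<partial>P) = (\<integral>\<eta>. exp (- ((S n + S k) / 2)) * atom_prod (cell k) v \<eta> \<partial>P)"
      by (intro integral_cong_AE) auto
    also have "\<dots> = exp (- ((S n + S k) / 2)) * (\<integral>\<eta>. atom_prod (cell k) v \<eta> \<partial>P)" by simp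
    also have "(\<integral>\<eta>. atom_prod (cell k) v \<eta> \<partial>P) = exp (\<integral>z. indicator (cell k) z * (v z - 1) \<partial>m)"
      using expectation_atom_prod[OF vm v vi] atom_prod_pos[of v, OF v]
      by (subst integral_eq_nn_integral) (auto simp: less_imp_le)
    also have "exp (- ((S n + S k) / 2)) * exp (\<integral>z. indicator (cell k) z * (v z - 1) \<partial>m) = exp (- ((hellinger_on_cells k - hellinger_on_cells n) / 2))"
    proof -
      have i1: "integrable m (\<lambda>z. indicator (cell k) z * (v z - 1))"
        unfolding right_diff_distrib using vi integrable_cell by simp
      have "(\<integral>z. indicator (cell k) z * (v z - 1) \<partial>m) - (S n + S k) / 2 =
        (\<integral>z. indicator (cell k) z * (v z - 1) - (indicator (cell n) z * (\<rho> z - 1) + indicator (cell k) z * (\<rho> z - 1)) / 2 \<partial>m)"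
        unfolding S_def using i1 int_rho1[of n] int_rho1[of k] by simp
      also have "\<dots> = (\<integral>z. - ((indicator (cell k) z * (sqrt (\<rho> z) - 1)\<^sup>2 - indicator (cell n) z * (sqrt (\<rho> z) - 1)\<^sup>2) / 2) \<partial>m)"
      proof (intro Bochner_Integration.integral_cong refl)
        fix z
        have "z \<in> cell n \<Longrightarrow> z \<in> cell k" using cell_mono[OF nk] by auto
        then show "indicator (cell k) z * (v z - 1) - (indicator (cell n) z * (\<rho> z - 1) + indicator (cell k) z * (\<rho> z - 1)) / 2 =
            - ((indicator (cell k) z * (sqrt (\<rho> z) - 1)\<^sup>2 - indicator (cell n) z * (sqrt (\<rho> z) - 1)\<^sup>2) / 2)"
          unfolding hellinger_expand v_def by (cases "z \<in> cell n"; cases "z \<in> cell k") (simp_all add: field_simps)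
      qed
      also have "\<dots> = - ((hellinger_on_cells k - hellinger_on_cells n) / 2)"
        unfolding hellinger_on_cells_def using integrable_cell_hellinger[of n] integrable_cell_hellinger[of k] by simp
      finally have "(\<integral>z. indicator (cell k) z * (v z - 1) \<partial>m) - (S n + S k) / 2 = - ((hellinger_on_cells k - hellinger_on_cells n) / 2)" .
      then show ?thesis unfolding mult_exp_exp by (simp add: algebra_simps)
    qed
    finally show ?thesis .
  qed
  \<comment> \<open>Factor the difference as a difference of squares and apply the Cauchy-Schwarz inequality.\<close>
  have L1: "(\<integral>\<eta>. norm (d n \<eta> - d k \<eta>) \<partial>P) \<le> 2 * sqrt (hellinger_on_cells k - hellinger_on_cells n)" if nk: "n \<le> k" for n k
  proof -
    define b where "b = exp (- ((hellinger_on_cells k - hellinger_on_cells n) / 2))"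
    have sint: "integrable P (\<lambda>\<eta>. sqrt (d n \<eta>) * sqrt (d k \<eta>))"
    proof (rule Bochner_Integration.integrable_bound)
      show "integrable P (\<lambda>\<eta>. d n \<eta> + d k \<eta>)" using d_int by simp
      show "AE \<eta> in P. norm (sqrt (d n \<eta>) * sqrt (d k \<eta>)) \<le> norm (d n \<eta> + d k \<eta>)"
      proof (rule AE_I2)
        fix \<eta>
        have "0 \<le> (sqrt (d n \<eta>) - sqrt (d k \<eta>))\<^sup>2" by simp
        then have "2 * (sqrt (d n \<eta>) * sqrt (d k \<eta>)) \<le> d n \<eta> + d k \<eta>"
          using dpos[of n \<eta>] dpos[of k \<eta>] by (simp add: power2_diff less_imp_le)
        moreover have "0 \<le> sqrt (d n \<eta>) * sqrt (d k \<eta>)" using dpos by (simp add: less_imp_le)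
        ultimately show "norm (sqrt (d n \<eta>) * sqrt (d k \<eta>)) \<le> norm (d n \<eta> + d k \<eta>)"
          using dpos[of n \<eta>] dpos[of k \<eta>] by (simp only: real_norm_def abs_of_nonneg)
      qed
    qed measurable
    have sqi: "integrable P (\<lambda>\<eta>. (sqrt (d n \<eta>) + c * sqrt (d k \<eta>))\<^sup>2)"
        "(\<integral>\<eta>. (sqrt (d n \<eta>) + c * sqrt (d k \<eta>))\<^sup>2 \<partial>P) = 2 + 2 * c * b" if c: "c\<^sup>2 = 1" for c
    proof -
      have e: "(sqrt (d n \<eta>) + c * sqrt (d k \<eta>))\<^sup>2 = d n \<eta> + d k \<eta> + 2 * c * (sqrt (d n \<eta>) * sqrt (d k \<eta>))" for \<eta>
        using dpos[of n \<eta>] dpos[of k \<eta>] c by (simp add: power2_sum power_mult_distrib less_imp_le)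
      show "integrable P (\<lambda>\<eta>. (sqrt (d n \<eta>) + c * sqrt (d k \<eta>))\<^sup>2)" unfolding e using d_int sint by simp
      show "(\<integral>\<eta>. (sqrt (d n \<eta>) + c * sqrt (d k \<eta>))\<^sup>2 \<partial>P) = 2 + 2 * c * b"
        unfolding e using d_int sint d_one affinity[OF nk] by (simp add: b_def)
    qed
    have nsq: "(\<integral>\<^sup>+\<eta>. (ennreal \<bar>sqrt (d n \<eta>) + c * sqrt (d k \<eta>)\<bar>)\<^sup>2 \<partial>P) = ennreal (2 + 2 * c * b)" if c: "c\<^sup>2 = 1" for c
    proof -
      have "(\<integral>\<^sup>+\<eta>. (ennreal \<bar>sqrt (d n \<eta>) + c * sqrt (d k \<eta>)\<bar>)\<^sup>2 \<partial>P) = (\<integral>\<^sup>+\<eta>. ennreal ((sqrt (d n \<eta>) + c * sqrt (d k \<eta>))\<^sup>2) \<partial>P)"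
        by (intro nn_integral_cong) (simp add: ennreal_power)
      also have "\<dots> = ennreal (2 + 2 * c * b)" unfolding sqi(2)[OF c, symmetric] by (rule nn_integral_eq_integral[OF sqi(1)[OF c]]) simp
      finally show ?thesis .
    qed
    define I where "I = (\<integral>\<eta>. norm (d n \<eta> - d k \<eta>) \<partial>P)"
    have I0: "0 \<le> I" unfolding I_def by (rule Bochner_Integration.integral_nonneg) simp
    have "ennreal I = (\<integral>\<^sup>+\<eta>. ennreal (norm (d n \<eta> - d k \<eta>)) \<partial>P)"
      unfolding I_def by (rule nn_integral_eq_integral[symmetric]) (auto intro!: d_int)
    also have "\<dots> = (\<integral>\<^sup>+\<eta>. ennreal \<bar>sqrt (d n \<eta>) + (-1) * sqrt (d k \<eta>)\<bar> * ennreal \<bar>sqrt (d n \<eta>) + 1 * sqrt (d k \<eta>)\<bar> \<partial>P)"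
    proof (rule nn_integral_cong)
      fix \<eta>
      have "d n \<eta> - d k \<eta> = (sqrt (d n \<eta>) + (-1) * sqrt (d k \<eta>)) * (sqrt (d n \<eta>) + 1 * sqrt (d k \<eta>))"
        using dpos[of n \<eta>] dpos[of k \<eta>] by (simp add: algebra_simps less_imp_le)
      then show "ennreal (norm (d n \<eta> - d k \<eta>)) = ennreal \<bar>sqrt (d n \<eta>) + (-1) * sqrt (d k \<eta>)\<bar> * ennreal \<bar>sqrt (d n \<eta>) + 1 * sqrt (d k \<eta>)\<bar>"
        by (simp only: real_norm_def abs_mult ennreal_mult abs_ge_zero)
    qed
    finally have "(ennreal I)\<^sup>2 \<le> (\<integral>\<^sup>+\<eta>. (ennreal \<bar>sqrt (d n \<eta>) + (-1) * sqrt (d k \<eta>)\<bar>)\<^sup>2 \<partial>P) * (\<integral>\<^sup>+\<eta>. (ennreal \<bar>sqrt (d n \<eta>) + 1 * sqrt (d k \<eta>)\<bar>)\<^sup>2 \<partial>P)"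
      by (simp only:) (rule Cauchy_Schwarz_nn_integral; measurable)
    also have "\<dots> = ennreal (2 + 2 * (-1) * b) * ennreal (2 + 2 * 1 * b)" by (subst (1 2) nsq) simp_all
    also have "\<dots> = ennreal ((2 + 2 * (-1) * b) * (2 + 2 * 1 * b))"
      using hell_mono[OF nk] by (intro ennreal_mult[symmetric]) (auto simp: b_def)
    also have "(2 + 2 * (-1) * b) * (2 + 2 * 1 * b) = 4 * (1 - b * b)" by (simp add: algebra_simps)
    also have "b * b = exp (- (hellinger_on_cells k - hellinger_on_cells n))" unfolding b_def mult_exp_exp by simp
    also have "ennreal (4 * (1 - exp (- (hellinger_on_cells k - hellinger_on_cells n)))) \<le> ennreal (4 * (hellinger_on_cells k - hellinger_on_cells n))"
    proof (rule ennreal_leI)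
      have "4 * (1 - exp (- x)) \<le> 4 * x" for x :: real using exp_ge_add_one_self[of "- x"] by simp
      then show "4 * (1 - exp (- (hellinger_on_cells k - hellinger_on_cells n))) \<le> 4 * (hellinger_on_cells k - hellinger_on_cells n)" .
    qed
    finally have "ennreal (I\<^sup>2) \<le> ennreal (4 * (hellinger_on_cells k - hellinger_on_cells n))" using I0 by (simp add: ennreal_power)
    then have "I\<^sup>2 \<le> 4 * (hellinger_on_cells k - hellinger_on_cells n)" using hell_mono[OF nk] by (subst (asm) ennreal_le_iff) auto
    then have "I \<le> sqrt (4 * (hellinger_on_cells k - hellinger_on_cells n))" by (rule real_le_rsqrt)
    also have "\<dots> = 2 * sqrt (hellinger_on_cells k - hellinger_on_cells n)" by (simp only: real_sqrt_mult real_sqrt_four)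
    finally show ?thesis by (simp only: I_def)
  qed
  have cauchy: "\<exists>N. \<forall>i\<ge>N. \<forall>j\<ge>N. (\<integral>\<eta>. norm (d i \<eta> - d j \<eta>) \<partial>P) < e" if e: "e > 0" for e
  proof -
    have "(e/2)\<^sup>2 > 0" using e by simp
    then obtain N where N: "\<And>i j. i \<ge> N \<Longrightarrow> j \<ge> N \<Longrightarrow> dist (hellinger_on_cells i) (hellinger_on_cells j) < (e/2)\<^sup>2"
      using \<open>Cauchy hellinger_on_cells\<close> unfolding Cauchy_def by meson
    have le: "(\<integral>\<eta>. norm (d i \<eta> - d j \<eta>) \<partial>P) < e" if "i \<ge> N" "j \<ge> N" "i \<le> j" for i j
    proof -
      have "hellinger_on_cells j - hellinger_on_cells i < (e/2)\<^sup>2" using N[OF that(1,2)] by (simp add: dist_real_def)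
      then have "sqrt (hellinger_on_cells j - hellinger_on_cells i) < e / 2" using e by (intro real_less_lsqrt) auto
      then show ?thesis using L1[OF that(3)] by simp
    qed
    show ?thesis
    proof (intro exI[of _ N] allI impI)
      fix i j assume ij: "i \<ge> N" "j \<ge> N"
      show "(\<integral>\<eta>. norm (d i \<eta> - d j \<eta>) \<partial>P) < e"
        using le[OF ij] le[OF ij(2,1)] by (cases "i \<le> j") (simp_all add: abs_minus_commute)
    qed
  qed
  obtain D where D: "integrable P D" "\<And>\<eta>. 0 \<le> D \<eta>" "(\<lambda>n. \<integral>\<eta>. norm (d n \<eta> - D \<eta>) \<partial>P) \<longlonglongrightarrow> 0"
    using L1_complete[of P d, OF d_int cauchy] dpos less_imp_le by blast
  note [measurable] = borel_measurable_integrable[OF D(1)]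
  have lapD': "(\<integral>\<eta>. D \<eta> * exp (- (\<integral>x. f x \<partial>\<eta>)) \<partial>P) = (\<integral>\<eta>. exp (- (\<integral>x. f x \<partial>\<eta>)) \<partial>P')" if f: "f \<in> Cc_nonneg" for f
  proof -
    define W where "W \<eta> = exp (- (\<integral>x. f x \<partial>\<eta>))" for \<eta>
    have [measurable]: "W \<in> borel_measurable P"
      unfolding W_def[abs_def] using integral_measurable_P[OF Cc_nonnegD(1)[OF f]] by measurable
    have W1: "0 \<le> W \<eta>" "W \<eta> \<le> 1" for \<eta> using Cc_nonneg_integral_nonneg[OF f, of \<eta>] by (auto simp: W_def)
    have DW: "integrable P (\<lambda>\<eta>. D \<eta> * W \<eta>)"
      by (rule Bochner_Integration.integrable_bound[OF D(1)]) (use W1 D(2) in \<open>auto simp: abs_mult mult_left_le\<close>)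
    have dW: "integrable P (\<lambda>\<eta>. d n \<eta> * W \<eta>)" for n unfolding W_def by (rule lapR(1)[OF f])
    have l1: "(\<lambda>n. \<integral>\<eta>. d n \<eta> * W \<eta> \<partial>P) \<longlonglongrightarrow> (\<integral>\<eta>. D \<eta> * W \<eta> \<partial>P)"
    proof (rule LIM_zero_cancel, rule Lim_null_comparison[OF _ D(3)], rule always_eventually, rule allI)
      fix n
      have "norm ((\<integral>\<eta>. d n \<eta> * W \<eta> \<partial>P) - (\<integral>\<eta>. D \<eta> * W \<eta> \<partial>P)) = norm (\<integral>\<eta>. (d n \<eta> - D \<eta>) * W \<eta> \<partial>P)"
        using DW dW[of n] by (simp add: left_diff_distrib)
      also have "\<dots> \<le> (\<integral>\<eta>. norm ((d n \<eta> - D \<eta>) * W \<eta>) \<partial>P)" by (rule integral_norm_bound)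
      also have "\<dots> \<le> (\<integral>\<eta>. norm (d n \<eta> - D \<eta>) \<partial>P)"
      proof (rule integral_mono)
        show "integrable P (\<lambda>\<eta>. norm ((d n \<eta> - D \<eta>) * W \<eta>))" using DW dW[of n] by (simp add: left_diff_distrib)
        show "integrable P (\<lambda>\<eta>. norm (d n \<eta> - D \<eta>))" using d_int D(1) by simp
        show "norm ((d n \<eta> - D \<eta>) * W \<eta>) \<le> norm (d n \<eta> - D \<eta>)" for \<eta>
          using W1[of \<eta>] by (simp add: abs_mult mult_left_le)
      qed
      finally show "norm ((\<integral>\<eta>. d n \<eta> * W \<eta> \<partial>P) - (\<integral>\<eta>. D \<eta> * W \<eta> \<partial>P)) \<le> (\<integral>\<eta>. norm (d n \<eta> - D \<eta>) \<partial>P)" .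
    qed
    have [measurable]: "f \<in> borel_measurable borel" using f Cc_borel_measurable by (auto simp: Cc_nonneg_def)
    have Em[measurable]: "E f \<in> borel_measurable m" unfolding E_def[abs_def] by measurable
    have i1: "integrable m (\<lambda>z. 1 - E f z)" unfolding E_def by (rule integrable_one_minus_exp[OF f])
    have "integrable m' (\<lambda>z. 1 - E f z)" unfolding E_def by (rule B.integrable_one_minus_exp[OF f])
    then have i2: "integrable m (\<lambda>z. \<rho> z * (1 - E f z))" by (subst (asm) integrable_m'_iff) auto
    have i3: "integrable m (\<lambda>z. (\<rho> z - 1) * (E f z - 1))"
    proof -
      have "(\<lambda>z. (\<rho> z - 1) * (E f z - 1)) = (\<lambda>z. (1 - E f z) - \<rho> z * (1 - E f z))" by (auto simp: algebra_simps)
      then show ?thesis using i1 i2 by simp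
    qed
    have AS: "A f n - S n = (\<integral>z. indicator (cell n) z * ((\<rho> z - 1) * (E f z - 1)) \<partial>m)" for n
    proof -
      have E1: "z \<in> space m \<Longrightarrow> \<bar>E f z\<bar> \<le> 1" for z
        using mark_pos[of z] Cc_nonnegD(2)[OF f, of "fst z"] by (simp add: E_def)
      have "integrable m (\<lambda>z. indicator (cell n) z * (\<rho> z - 1) * E f z)"
        by (rule Bochner_Integration.integrable_bound[OF int_rho1[of n]])
          (use E1 in \<open>auto simp: abs_mult intro!: AE_I2 mult_left_le\<close>)
      then have "A f n - S n = (\<integral>z. indicator (cell n) z * (\<rho> z - 1) * E f z - indicator (cell n) z * (\<rho> z - 1) \<partial>m)"
        unfolding A_def S_def using int_rho1[of n] by simp
      also have "\<dots> = (\<integral>z. indicator (cell n) z * ((\<rho> z - 1) * (E f z - 1)) \<partial>m)"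
        by (intro Bochner_Integration.integral_cong refl) (simp add: algebra_simps)
      finally show ?thesis .
    qed
    have l2: "(\<lambda>n. A f n - S n) \<longlonglongrightarrow> (\<integral>z. (\<rho> z - 1) * (E f z - 1) \<partial>m)"
      unfolding AS
    proof (rule integral_dominated_convergence[where w="\<lambda>z. \<bar>(\<rho> z - 1) * (E f z - 1)\<bar>"])
      show "integrable m (\<lambda>z. \<bar>(\<rho> z - 1) * (E f z - 1)\<bar>)" using i3 by simp
      show "AE z in m. (\<lambda>n. indicator (cell n) z * ((\<rho> z - 1) * (E f z - 1))) \<longlonglongrightarrow> (\<rho> z - 1) * (E f z - 1)"
      proof (rule AE_I2)
        fix z assume "z \<in> space m"
        then obtain N where N: "z \<in> cell N" using UN_cell by auto
        have "indicator (cell n) z * ((\<rho> z - 1) * (E f z - 1)) = (\<rho> z - 1) * (E f z - 1)" if "n \<ge> N" for n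
          using N cell_mono[OF that] by auto
        then show "(\<lambda>n. indicator (cell n) z * ((\<rho> z - 1) * (E f z - 1))) \<longlonglongrightarrow> (\<rho> z - 1) * (E f z - 1)"
          by (intro tendsto_eventually) (auto simp: eventually_sequentially)
      qed
      show "AE z in m. norm (indicator (cell n) z * ((\<rho> z - 1) * (E f z - 1))) \<le> \<bar>(\<rho> z - 1) * (E f z - 1)\<bar>" for n
        by (intro AE_I2) (simp add: indicator_def)
    qed measurable
    have "(\<lambda>n. \<integral>\<eta>. d n \<eta> * W \<eta> \<partial>P) \<longlonglongrightarrow> exp ((\<integral>z. (\<rho> z - 1) * (E f z - 1) \<partial>m) - \<Lambda> f)"
      unfolding W_def lapR(2)[OF f] by (intro tendsto_intros l2)
    from LIMSEQ_unique[OF l1 this]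
    have "(\<integral>\<eta>. D \<eta> * W \<eta> \<partial>P) = exp ((\<integral>z. (\<rho> z - 1) * (E f z - 1) \<partial>m) - \<Lambda> f)" .
    also have "(\<integral>z. (\<rho> z - 1) * (E f z - 1) \<partial>m) - \<Lambda> f = (\<integral>z. (\<rho> z - 1) * (E f z - 1) - (1 - E f z) \<partial>m)"
      unfolding \<Lambda>_def by (rule Bochner_Integration.integral_diff[OF i3 i1, symmetric])
    also have "\<dots> = (\<integral>z. - (\<rho> z * (1 - E f z)) \<partial>m)"
      by (intro Bochner_Integration.integral_cong refl) (simp add: algebra_simps)
    also have "\<dots> = - (\<integral>z. (1 - E f z) \<partial>m')" by (subst integral_m') simp_all
    also have "exp \<dots> = (\<integral>\<eta>. W \<eta> \<partial>P')" unfolding W_def E_def by (rule B.laplace[OF f, symmetric])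
    finally show ?thesis by (simp add: W_def)
  qed
  have "P' = density P (\<lambda>\<eta>. ennreal (D \<eta>))"
  proof (rule laplace_functional_unique)
    show "finite_measure P'" by (rule B.finite_measure_axioms)
    show "finite_measure (density P (\<lambda>\<eta>. ennreal (D \<eta>)))"
    proof (rule finite_measureI)
      have "emeasure (density P (\<lambda>\<eta>. ennreal (D \<eta>))) (space P) = (\<integral>\<^sup>+\<eta>. ennreal (D \<eta>) \<partial>P)"
        by (subst emeasure_density) (auto intro!: nn_integral_cong)
      also have "\<dots> = ennreal (\<integral>\<eta>. D \<eta> \<partial>P)" using D by (intro nn_integral_eq_integral) auto
      finally show "emeasure (density P (\<lambda>\<eta>. ennreal (D \<eta>))) (space (density P (\<lambda>\<eta>. ennreal (D \<eta>)))) \<noteq> \<infinity>" by simp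
    qed
    show "sets P' = sets K" "sets (density P (\<lambda>\<eta>. ennreal (D \<eta>))) = sets K" by (simp_all add: B.sets_P sets_P)
    fix g :: "'a \<Rightarrow> real" assume g: "g \<in> Cc_nonneg"
    have [measurable]: "(\<lambda>\<eta>. \<integral>x. g x \<partial>\<eta>) \<in> borel_measurable P" by (rule integral_measurable_P[OF Cc_nonnegD(1)[OF g]])
    have "(\<integral>\<eta>. exp (- (\<integral>x. g x \<partial>\<eta>)) \<partial>density P (\<lambda>\<eta>. ennreal (D \<eta>))) = (\<integral>\<eta>. D \<eta> * exp (- (\<integral>x. g x \<partial>\<eta>)) \<partial>P)"
      using D(2) by (subst integral_density) auto
    then show "(\<integral>\<eta>. exp (- (\<integral>x. g x \<partial>\<eta>)) \<partial>P') = (\<integral>\<eta>. exp (- (\<integral>x. g x \<partial>\<eta>)) \<partial>density P (\<lambda>\<eta>. ennreal (D \<eta>)))"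
      using lapD'[OF g] by simp
  qed
  then show ?thesis using absolutely_continuousI_density[of "\<lambda>\<eta>. ennreal (D \<eta>)" P] by simp
qed

end

section \<open>The action of diffeomorphisms\<close>

lemma Diff0D:
  assumes "\<phi> \<in> Diff0"
  shows "bij \<phi>" "continuous_on UNIV \<phi>" "continuous_on UNIV (inv \<phi>)"
    "inv \<phi> (\<phi> x) = x" "\<phi> (inv \<phi> y) = y" "\<phi> \<in> borel_measurable borel"
proof -
  show b: "bij \<phi>" using assms by (simp add: Diff0_def)
  have "times_differentiable 0 \<phi>" "times_differentiable 0 (inv \<phi>)"
    using assms unfolding Diff0_def smooth_def by blast+
  then show c: "continuous_on UNIV \<phi>" "continuous_on UNIV (inv \<phi>)" by simp_all
  show "inv \<phi> (\<phi> x) = x" "\<phi> (inv \<phi> y) = y"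
    using b by (simp_all add: bij_is_inj bij_is_surj surj_f_inv_f)
  show "\<phi> \<in> borel_measurable borel" using c(1) by (rule borel_measurable_continuous_onI)
qed

lemma Diff0_inv:
  assumes "\<phi> \<in> Diff0"
  shows "inv \<phi> \<in> Diff0" "inv (inv \<phi>) = \<phi>"
proof -
  have b: "bij \<phi>" by (rule Diff0D(1)[OF assms])
  show i: "inv (inv \<phi>) = \<phi>" using b by (rule inv_inv_eq)
  obtain C where C: "compact C" "\<And>x. x \<notin> C \<Longrightarrow> \<phi> x = x" using assms unfolding Diff0_def by blast
  have "inv \<phi> x = x" if "x \<notin> C" for x using Diff0D(4)[OF assms, of x] C(2)[OF that] by simp
  then show "inv \<phi> \<in> Diff0"
    using assms b C(1) i unfolding Diff0_def by (auto intro: bij_imp_bij_inv)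
qed

lemma Diff0_bounded_vimage:
  assumes "\<phi> \<in> Diff0" "bounded A"
  shows "bounded (\<phi> -` A)"
proof -
  obtain C where C: "compact C" "\<And>x. x \<notin> C \<Longrightarrow> \<phi> x = x" using assms(1) unfolding Diff0_def by blast
  have "\<phi> -` A \<subseteq> A \<union> C" using C(2) by force
  then show ?thesis using assms(2) compact_imp_bounded[OF C(1)] by (meson bounded_Un bounded_subset)
qed

lemma Cc_compose_Diff0:
  assumes f: "f \<in> Cc" and \<phi>: "\<phi> \<in> Diff0"
  shows "(\<lambda>x. f (\<phi> x)) \<in> Cc"
proof -
  have "bounded (\<phi> -` {x. f x \<noteq> 0})" using f \<phi> by (intro Diff0_bounded_vimage) (auto simp: Cc_iff)
  moreover have "continuous_on UNIV (\<lambda>x. f (\<phi> x))"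
    using f unfolding Cc_iff by (intro continuous_on_compose2[OF _ Diff0D(2)[OF \<phi>] subset_UNIV]) (rule conjunct1)
  ultimately show ?thesis by (simp add: Cc_iff vimage_def)
qed

context
  fixes \<phi> :: "'a::euclidean_space \<Rightarrow> 'a"
  assumes \<phi>: "\<phi> \<in> Diff0"
begin

lemma Diff0_measurable_K: "\<eta> \<in> space K \<Longrightarrow> \<phi> \<in> measurable \<eta> borel"
  using Diff0D(6)[OF \<phi>] by (simp add: measurable_cong_sets[OF discrete_radon_spaceD(3) refl])

lemma integral_push:
  assumes "\<eta> \<in> space K" "f \<in> Cc"
  shows "(\<integral>x. f x \<partial>push \<phi> \<eta>) = (\<integral>x. f (\<phi> x) \<partial>\<eta>)"
  unfolding push_def by (rule integral_distr[OF Diff0_measurable_K[OF assms(1)] Cc_borel_measurable[OF assms(2)]])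

lemma push_in_K:
  assumes \<eta>: "\<eta> \<in> space K"
  shows "push \<phi> \<eta> \<in> space K"
  unfolding space_discrete_radon_space discrete_radon_measures_def
proof (intro CollectI conjI)
  show "push \<phi> \<eta> \<in> radon_measures"
    unfolding radon_measures_def
  proof (intro CollectI conjI allI impI)
    fix C :: "'a set" assume C: "compact C"
    have "emeasure (push \<phi> \<eta>) C = emeasure \<eta> (\<phi> -` C)"
      unfolding push_def using C
      by (subst emeasure_distr[OF Diff0_measurable_K[OF \<eta>]]) (auto simp: compact_imp_closed discrete_radon_spaceD(4)[OF \<eta>])
    also have "\<dots> < \<infinity>"
      by (intro discrete_radon_spaceD(5)[OF \<eta>] Diff0_bounded_vimage[OF \<phi>] compact_imp_bounded C)
    finally show "emeasure (push \<phi> \<eta>) C < \<infinity>" .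
  qed (simp add: push_def)
  obtain S and s :: "'a \<Rightarrow> real" where S: "countable S" "\<And>x. x \<in> S \<Longrightarrow> s x > 0"
    "\<And>A. A \<in> sets borel \<Longrightarrow> emeasure \<eta> A = (\<integral>\<^sup>+x. ennreal (s x) * indicator A x \<partial>count_space S)"
    using discrete_radon_spaceD(1)[OF \<eta>] unfolding discrete_radon_measures_def by blast
  show "\<exists>S s. countable S \<and> (\<forall>x\<in>S. s x > 0) \<and> (\<forall>A\<in>sets borel.
      emeasure (push \<phi> \<eta>) A = (\<integral>\<^sup>+x. ennreal (s x) * indicator A x \<partial>count_space S))"
  proof (rule exI[of _ "\<phi> ` S"], rule exI[of _ "\<lambda>x. s (inv \<phi> x)"], intro conjI ballI)
    show "countable (\<phi> ` S)" using S(1) by simp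
    show "0 < s (inv \<phi> x)" if "x \<in> \<phi> ` S" for x using that S(2) Diff0D(4)[OF \<phi>] by auto
    fix A :: "'a set" assume A: "A \<in> sets borel"
    have "emeasure (push \<phi> \<eta>) A = (\<integral>\<^sup>+x. ennreal (s x) * indicator A (\<phi> x) \<partial>count_space S)"
      by (rule emeasure_push_discrete[OF discrete_radon_spaceD(3)[OF \<eta>] Diff0D(6)[OF \<phi>] A S(3)])
    also have "\<dots> = (\<integral>\<^sup>+x. (\<lambda>y. ennreal (s (inv \<phi> y)) * indicator A y) (\<phi> x) \<partial>count_space S)"
      by (simp add: Diff0D(4)[OF \<phi>])
    also have "\<dots> = (\<integral>\<^sup>+y. ennreal (s (inv \<phi> y)) * indicator A y \<partial>count_space (\<phi> ` S))"
    proof (rule nn_integral_bij_count_space)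
      show "bij_betw \<phi> S (\<phi> ` S)" using Diff0D(1)[OF \<phi>] by (meson bij_betw_subset subset_UNIV)
    qed
    finally show "emeasure (push \<phi> \<eta>) A = (\<integral>\<^sup>+x. ennreal (s (inv \<phi> x)) * indicator A x \<partial>count_space (\<phi> ` S))" .
  qed
qed

text \<open>Since \<open>f \<circ> \<phi>\<close> is a test function whenever \<open>f\<close> is one, this can be read off from the functionals.\<close>

lemma push_measurable: "push \<phi> \<in> measurable K K"
proof (rule measurable_discrete_radon_space)
  show "push \<phi> \<eta> \<in> discrete_radon_measures" if "\<eta> \<in> space K" for \<eta>
    using push_in_K[OF that] by (simp add: space_discrete_radon_space)
  fix f :: "'a \<Rightarrow> real" assume f: "f \<in> Cc_nonneg"
  have "(\<lambda>\<eta>. \<integral>x. f (\<phi> x) \<partial>\<eta>) \<in> borel_measurable K"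
    by (rule integral_measurable_discrete[OF Cc_compose_Diff0[OF Cc_nonnegD(1)[OF f] \<phi>]])
  then show "(\<lambda>\<eta>. \<integral>x. f x \<partial>push \<phi> \<eta>) \<in> borel_measurable K"
    by (rule measurable_cong[THEN iffD2, rotated]) (rule integral_push[OF _ Cc_nonnegD(1)[OF f]])
qed

lemma push_inverse:
  assumes \<eta>: "\<eta> \<in> space K"
  shows "push (inv \<phi>) (push \<phi> \<eta>) = \<eta>"
proof -
  have "inv \<phi> \<in> borel_measurable borel" by (rule Diff0D(6)[OF Diff0_inv(1)[OF \<phi>]])
  then have "push (inv \<phi>) (push \<phi> \<eta>) = distr \<eta> borel (inv \<phi> \<circ> \<phi>)"
    unfolding push_def by (rule distr_distr[OF _ Diff0_measurable_K[OF \<eta>]])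
  also have "inv \<phi> \<circ> \<phi> = id" using Diff0D(4)[OF \<phi>] by auto
  also have "distr \<eta> borel id = \<eta>"
    using discrete_radon_spaceD(3,4)[OF \<eta>] by (intro measure_eqI) (simp_all add: emeasure_distr id_def measurable_ident_sets)
  finally show ?thesis .
qed

lemma push_fst_map_measurable: "(\<lambda>(x, s). (\<phi> x, s)) \<in> measurable half_space half_space"
proof -
  have "(\<lambda>z. (\<phi> (fst z), snd z)) \<in> measurable half_space half_space"
    unfolding half_space_def
    by (rule measurable_Pair[OF measurable_compose[OF measurable_fst Diff0D(6)[OF \<phi>]] measurable_snd])
  then show ?thesis by (simp add: split_beta')
qed

lemma crm_push:
  assumes "crm m P"
  shows "crm (push_fst \<phi> m) (distr P P (push \<phi>))"
proof -
  interpret crm m P by fact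
  let ?T = "\<lambda>(x, s :: real). (\<phi> x, s)"
  have T: "?T \<in> measurable m m" using push_fst_map_measurable by (simp add: measurable_cong_sets[OF sets_m sets_m])
  have pu: "push \<phi> \<in> measurable P P" using push_measurable by (simp add: measurable_cong_sets[OF sets_P sets_P])
  have cm: "f \<in> Cc \<Longrightarrow> f \<in> borel_measurable borel" for f :: "'a \<Rightarrow> real" by (rule Cc_borel_measurable)
  show ?thesis
  proof
    show "sets (push_fst \<phi> m) = sets half_space" by (simp add: push_fst_def sets_m)
    have set: "A \<times> {0<..} \<in> sets m" if A: "A \<in> sets borel" for A :: "'a set"
    proof -
      have "{z \<in> space m. fst z \<in> A} \<in> sets m"
        using measurable_sets[OF m_measurable(1) A] by (simp add: vimage_def Int_def conj_commute)
      moreover have "{z \<in> space m. fst z \<in> A} = A \<times> {0<..}" by (auto simp: space_m)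
      ultimately show ?thesis by simp
    qed
    fix x
    have "emeasure (push_fst \<phi> m) ({x} \<times> {0<..}) = emeasure m (?T -` ({x} \<times> {0<..}) \<inter> space m)"
      unfolding push_fst_def by (rule emeasure_distr[OF T set]) simp
    also have "?T -` ({x} \<times> {0<..}) \<inter> space m = {inv \<phi> x} \<times> {0<..}"
      using Diff0D(4,5)[OF \<phi>] by (auto simp: space_m)
    finally show "emeasure (push_fst \<phi> m) ({x} \<times> {0<..}) = 0" by (simp add: null_fibres)
  next
    fix A :: "'a set" assume A: "A \<in> sets borel" "compact (closure A)"
    have A': "\<phi> -` A \<in> sets borel" using measurable_sets[OF Diff0D(6)[OF \<phi>] A(1)] by simp
    have As: "A \<times> {0<..} \<in> sets m"
    proof -
      have "{z \<in> space m. fst z \<in> A} \<in> sets m"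
        using measurable_sets[OF m_measurable(1) A(1)] by (simp add: vimage_def Int_def conj_commute)
      moreover have "{z \<in> space m. fst z \<in> A} = A \<times> {0<..}" by (auto simp: space_m)
      ultimately show ?thesis by simp
    qed
    have "bounded A" using A(2) by (simp add: compact_closure)
    then have b: "compact (closure (\<phi> -` A))" using Diff0_bounded_vimage[OF \<phi>] by (simp add: compact_closure)
    note As[measurable]
    have "(\<lambda>z. ennreal (min (snd z) 1) * indicator (A \<times> {0<..}) z) \<in> borel_measurable m" by measurable
    then have "(\<integral>\<^sup>+z\<in>A \<times> {0<..}. ennreal (min (snd z) 1) \<partial>push_fst \<phi> m) =
       (\<integral>\<^sup>+z. ennreal (min (snd (?T z)) 1) * indicator (A \<times> {0<..}) (?T z) \<partial>m)"
      unfolding push_fst_def by (subst nn_integral_distr[OF T]) simp_all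
    also have "\<dots> = (\<integral>\<^sup>+z\<in>(\<phi> -` A) \<times> {0<..}. ennreal (min (snd z) 1) \<partial>m)"
      by (intro nn_integral_cong) (auto simp: indicator_def)
    also have "\<dots> < \<infinity>" by (rule integrability[OF A' b])
    finally show "(\<integral>\<^sup>+z\<in>A \<times> {0<..}. ennreal (min (snd z) 1) \<partial>push_fst \<phi> m) < \<infinity>" .
  next
    show "completely_random_measure (push_fst \<phi> m) (distr P P (push \<phi>))"
      unfolding completely_random_measure_def
    proof (intro conjI ballI)
      show "prob_space (distr P P (push \<phi>))" by (rule prob_space_distr[OF pu])
      show "sets (distr P P (push \<phi>)) = sets K" by (simp add: sets_P)
      fix f :: "'a \<Rightarrow> real" assume f: "f \<in> Cc"
      have fm[measurable]: "f \<in> borel_measurable borel" by (rule cm[OF f])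
      have [measurable]: "(\<lambda>\<eta>. \<integral>x. f x \<partial>\<eta>) \<in> borel_measurable P" by (rule integral_measurable_P[OF f])
      have "(\<integral>\<eta>. exp (\<i> * complex_of_real (\<integral>x. f x \<partial>\<eta>)) \<partial>distr P P (push \<phi>)) =
        (\<integral>\<eta>. exp (\<i> * complex_of_real (\<integral>x. f x \<partial>push \<phi> \<eta>)) \<partial>P)"
        by (rule integral_distr[OF pu]) measurable
      also have "\<dots> = (\<integral>\<eta>. exp (\<i> * complex_of_real (\<integral>x. f (\<phi> x) \<partial>\<eta>)) \<partial>P)"
        by (intro Bochner_Integration.integral_cong refl) (simp add: integral_push[OF _ f] space_P)
      also have "\<dots> = exp (\<integral>z. (exp (\<i> * complex_of_real (snd z * f (\<phi> (fst z)))) - 1) \<partial>m)"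
        by (rule crm[unfolded completely_random_measure_def, THEN conjunct2, THEN conjunct2, rule_format, OF Cc_compose_Diff0[OF f \<phi>]])
      also have "(\<integral>z. (exp (\<i> * complex_of_real (snd z * f (\<phi> (fst z)))) - 1) \<partial>m) =
        (\<integral>z. (\<lambda>z. exp (\<i> * complex_of_real (snd z * f (fst z))) - 1) (?T z) \<partial>m)"
        by (simp add: split_beta')
      also have "\<dots> = (\<integral>z. (exp (\<i> * complex_of_real (snd z * f (fst z))) - 1) \<partial>push_fst \<phi> m)"
        unfolding push_fst_def by (rule integral_distr[OF T, symmetric]) measurable
      finally show "(\<integral>\<eta>. exp (\<i> * complex_of_real (\<integral>x. f x \<partial>\<eta>)) \<partial>distr P P (push \<phi>)) =
        exp (\<integral>z. (exp (\<i> * complex_of_real (snd z * f (fst z))) - 1) \<partial>push_fst \<phi> m)" .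
    qed
  qed
qed

end

text \<open>Equivalence makes the density positive and finite almost everywhere; it is changed to \<open>1\<close> on the exceptional null
set.\<close>

lemma crm_pair_RN_deriv:
  assumes "crm m P" "crm m' P'" and eq: "equivalent_measures m m'"
  obtains \<rho> where "crm_pair m P m' P' \<rho>" "AE z in m. RN_deriv m m' z = ennreal (\<rho> z)"
proof -
  interpret A: crm m P by fact
  interpret B: crm m' P' by fact
  have ac: "absolutely_continuous m m'" "absolutely_continuous m' m" and s: "sets m' = sets m"
    using eq by (auto simp: equivalent_measures_def)
  define R where "R = RN_deriv m m'"
  have [measurable]: "R \<in> borel_measurable m" unfolding R_def by simp
  have dens: "density m R = m'" unfolding R_def by (rule A.m.density_RN_deriv[OF ac(1) s])
  have fin: "AE z in m. R z \<noteq> \<infinity>"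
    unfolding R_def by (rule A.m.RN_deriv_finite[OF B.m.sigma_finite_measure_axioms ac(1) s])
  have "{z \<in> space m. R z = 0} \<in> null_sets m'"
    unfolding dens[symmetric] by (subst null_sets_density_iff) auto
  then have "{z \<in> space m. R z = 0} \<in> null_sets m" using ac(2) by (auto simp: absolutely_continuous_def)
  then have pos: "AE z in m. R z \<noteq> 0" by (rule AE_I') auto
  define \<rho> where "\<rho> z = (if 0 < enn2real (R z) then enn2real (R z) else 1)" for z
  have eqR: "AE z in m. R z = ennreal (\<rho> z)"
    using fin pos
  proof eventually_elim
    fix z assume "R z \<noteq> \<infinity>" "R z \<noteq> 0"
    then show "R z = ennreal (\<rho> z)"
      by (cases "R z") (auto simp: \<rho>_def)
  qed
  have pair: "crm_pair m P m' P' \<rho>"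
  proof
    show "\<rho> \<in> borel_measurable m" unfolding \<rho>_def[abs_def] by measurable
    then have [measurable]: "\<rho> \<in> borel_measurable m" .
    show "0 < \<rho> z" for z by (simp add: \<rho>_def)
    have "density m R = density m (\<lambda>z. ennreal (\<rho> z))" using eqR by (intro density_cong) auto
    then show "m' = density m (\<lambda>z. ennreal (\<rho> z))" using dens by simp
  qed
  from that[OF pair] eqR show ?thesis by (simp add: R_def)
qed

section \<open>Quasi-invariance\<close>

theorem theorem30:
  fixes m :: "((real ^ 'd) \<times> real) measure"
    and \<mu> :: "(real ^ 'd) measure measure"
  assumes sets_m: "sets m = sets half_space"
    and null_fibres: "\<And>x. emeasure m ({x} \<times> {0<..}) = 0"
    and integrability: "\<And>A. A \<in> sets borel \<Longrightarrow> compact (closure A) \<Longrightarrow>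
          (\<integral>\<^sup>+z\<in>A \<times> {0<..}. ennreal (min (snd z) 1) \<partial>m) < \<infinity>"
    and crm: "completely_random_measure m \<mu>"
  shows "quasi_invariant \<mu> \<longleftrightarrow>
    (\<forall>\<phi>\<in>Diff0.
       equivalent_measures m (push_fst \<phi> m) \<and>
       (\<integral>\<^sup>+z. ennreal ((sqrt (enn2real (RN_deriv m (push_fst \<phi> m) z)) - 1)\<^sup>2) \<partial>m) < \<infinity>)"
proof -
  have C: "crm m \<mu>" using sets_m null_fibres integrability crm by (rule crm.intro)
  interpret crm m \<mu> by (rule C)
  let ?m = "\<lambda>\<phi>. push_fst \<phi> m" and ?\<mu> = "\<lambda>\<phi>. distr \<mu> \<mu> (push \<phi>)"
  let ?H = "\<lambda>\<phi>. (\<integral>\<^sup>+z. ennreal ((sqrt (enn2real (RN_deriv m (?m \<phi>) z)) - 1)\<^sup>2) \<partial>m)"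
  have C': "crm (?m \<phi>) (?\<mu> \<phi>)" if "\<phi> \<in> Diff0" for \<phi> using that C by (rule crm_push)
  have criterion: "absolutely_continuous \<mu> (?\<mu> \<phi>) \<longleftrightarrow> ?H \<phi> < \<infinity>" 
    if \<phi>: "\<phi> \<in> Diff0" and eq: "equivalent_measures m (?m \<phi>)" for \<phi>
  proof -
    obtain \<rho> where pair: "crm_pair m \<mu> (?m \<phi>) (?\<mu> \<phi>) \<rho>" and R: "AE z in m. RN_deriv m (?m \<phi>) z = ennreal (\<rho> z)"
      using crm_pair_RN_deriv[OF C C'[OF \<phi>] eq] by blast
    interpret crm_pair m \<mu> "?m \<phi>" "?\<mu> \<phi>" \<rho> by (rule pair)
    have "?H \<phi> = (\<integral>\<^sup>+z. ennreal ((sqrt (\<rho> z) - 1)\<^sup>2) \<partial>m)"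
    proof (rule nn_integral_cong_AE)
      show "AE z in m. ennreal ((sqrt (enn2real (RN_deriv m (?m \<phi>) z)) - 1)\<^sup>2) = ennreal ((sqrt (\<rho> z) - 1)\<^sup>2)"
        using R
      proof eventually_elim
        fix z assume "RN_deriv m (?m \<phi>) z = ennreal (\<rho> z)"
        then show "ennreal ((sqrt (enn2real (RN_deriv m (?m \<phi>) z)) - 1)\<^sup>2) = ennreal ((sqrt (\<rho> z) - 1)\<^sup>2)"
          using rho_pos[of z] by simp
      qed
    qed
    then show ?thesis using hellinger_necessary hellinger_sufficient by auto
  qed
  show ?thesis
  proof
    assume qi: "quasi_invariant \<mu>"
    show "\<forall>\<phi>\<in>Diff0. equivalent_measures m (?m \<phi>) \<and> ?H \<phi> < \<infinity>"
    proof
      fix \<phi> :: "real ^ 'd \<Rightarrow> real ^ 'd" assume \<phi>: "\<phi> \<in> Diff0"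
      have ac: "absolutely_continuous \<mu> (?\<mu> \<phi>)" "absolutely_continuous (?\<mu> \<phi>) \<mu>"
        using qi \<phi> by (auto simp: quasi_invariant_def equivalent_measures_def)
      have eq: "equivalent_measures m (?m \<phi>)"
        unfolding equivalent_measures_def
        using crm_intensity_absolutely_continuous[OF C C'[OF \<phi>] ac(1)] crm_intensity_absolutely_continuous[OF C'[OF \<phi>] C ac(2)]
        by (simp add: push_fst_def)
      then show "equivalent_measures m (?m \<phi>) \<and> ?H \<phi> < \<infinity>" using criterion[OF \<phi> eq] ac(1) by simp
    qed
  next
    assume h: "\<forall>\<phi>\<in>Diff0. equivalent_measures m (?m \<phi>) \<and> ?H \<phi> < \<infinity>"
    then have ac: "absolutely_continuous \<mu> (?\<mu> \<phi>)" if "\<phi> \<in> Diff0" for \<phi> using that criterion by blast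
    show "quasi_invariant \<mu>"
      unfolding quasi_invariant_def
    proof
      fix \<phi> :: "real ^ 'd \<Rightarrow> real ^ 'd" assume \<phi>: "\<phi> \<in> Diff0"
      have \<phi>i: "inv \<phi> \<in> Diff0" by (rule Diff0_inv(1)[OF \<phi>])
      have pu: "push \<phi> \<in> measurable \<mu> \<mu>" if "\<phi> \<in> Diff0" for \<phi> :: "real ^ 'd \<Rightarrow> real ^ 'd"
        using push_measurable[OF that] by (simp add: measurable_cong_sets[OF sets_P sets_P])
      \<comment> \<open>The opposite direction is the assumption for the inverse diffeomorphism, transported by \<open>\<phi>\<close>.\<close>
      have "absolutely_continuous (?\<mu> \<phi>) \<mu>"
        unfolding absolutely_continuous_def
      proof
        fix A assume A: "A \<in> null_sets (?\<mu> \<phi>)"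
        then have Am: "A \<in> sets \<mu>" by auto
        define E where "E = push \<phi> -` A \<inter> space \<mu>"
        have Em: "E \<in> sets \<mu>" unfolding E_def by (rule measurable_sets[OF pu[OF \<phi>] Am])
        have "emeasure \<mu> E = 0" using A Am by (simp add: E_def null_sets_def emeasure_distr[OF pu[OF \<phi>]])
        then have "E \<in> null_sets (?\<mu> (inv \<phi>))"
          using ac[OF \<phi>i] Em by (auto simp: absolutely_continuous_def)
        then have "emeasure \<mu> (push (inv \<phi>) -` E \<inter> space \<mu>) = 0"
          using Em by (simp add: null_sets_def emeasure_distr[OF pu[OF \<phi>i]])
        moreover have "push (inv \<phi>) -` E \<inter> space \<mu> = A"
        proof -
          have "push \<phi> (push (inv \<phi>) \<eta>) = \<eta>" if "\<eta> \<in> space \<mu>" for \<eta>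
            using push_inverse[OF \<phi>i, of \<eta>] that by (simp add: Diff0_inv(2)[OF \<phi>] space_P)
          moreover have "push (inv \<phi>) \<eta> \<in> space \<mu>" if "\<eta> \<in> space \<mu>" for \<eta>
            using measurable_space[OF pu[OF \<phi>i] that] .
          ultimately show ?thesis using sets.sets_into_space[OF Am] by (auto simp: E_def)
        qed
        ultimately show "A \<in> null_sets \<mu>" using Am by auto
      qed
      then show "equivalent_measures (?\<mu> \<phi>) \<mu>"
        using ac[OF \<phi>] by (simp add: equivalent_measures_def)
    qed
  qed
qed

end
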